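(* Let $X$ be a random vector in $\mathbb{R}^d$ and let $Y_1 = \tfrac{1}{\sqrt2} X + \tfrac{1}{\sqrt2} W_0$, where $W_0 \sim \mathcal{N}(0,I)$ is independent of $X$. Let $Y_{k+1} = a_k Y_k + \sqrt{1-a_k^2}\,W_k$ for $k = 1,2,\dots$, with the adaptive stepsizes $a_0 = 1/\sqrt{2}$ and, for $k=1,2,\dots$, $$B_k := \sup_{y\in\mathbb{R}^d} \|\mathrm{cov}(X \mid Y_k = y)\|_{\mathrm{op}}, \qquad \lambda_k := 4 B_k \prod_{\ell=0}^{k-1} a_\ell^2, \qquad a_k^2 = \frac{2\lambda_k+2}{2\lambda_k+3}.$$ Suppose there is $B_{\max}<\infty$ such that $B_k \le B_{\max}$ for all $k=1,2,\dots$. Then there is a trajectory length $K\ge 1$ with $$K \;\le\; 7\,(1+B_{\max})$$ such that $\prod_{\ell=0}^{K-1} a_\ell^2 \le \frac{1}{8 B_K}$, and hence: all of the sampling sub-problems $\{p_K\}\cup\{p_{k\mid k+1}\}_{k=1}^{K-1}$ are strongly log-concave (SLC) with condition number at most $4$; and for any $D \in \{D_{\mathrm{TV}}, D_{\mathrm{KL}}\}$ and $\varepsilon>0$, by using any SLC sampler with query complexity $N_{\mathrm{SLC}}$ (with respect to $D$), one can obtain samples from the law of $Y_1$ that are $\varepsilon$-accurate in $D$ using at most $\sum_{k=0}^{K} N_{\mathrm{SLC}}\big(\varepsilon/(K+1)\big)$ queries.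
   Context: The $W_k\sim\mathcal{N}(0,I)$ are standard Gaussian vectors in $\mathbb{R}^d$, independent of each other and of $X$. $p_k$ is the density of $Y_k$ and $p_{k\mid k+1}$ the conditional density of $Y_k$ given $Y_{k+1}$. $\|\cdot\|_{\mathrm{op}}$ is the operator norm. If $B_K=0$, the condition $\prod a_\ell^2\le 1/(8B_K)$ is vacuous. A twice differentiable density $p$ on $\mathbb{R}^d$ is SLC with condition number at most $c$ if there are $0<m'\le M'$ with $M'/m'\le c$ and $m' I \preceq -\nabla^2\log p(x) \preceq M' I$ for all $x$. For the conditional $p_{k\mid k+1}$ this is required of $p_{k\mid k+1}(\cdot\mid y)$ for every $y\in\mathbb{R}^d$, with the same $m',M'$. $D_{\mathrm{TV}}$ is total variation and $D_{\mathrm{KL}}(q,p)=D_{\mathrm{KL}}(q\|p)$ is Kullback–Leibler divergence; a sample with law $q$ is $\varepsilon$-accurate for $p$ in $D$ if $D(q,p)\le\varepsilon$. An SLC sampler with query complexity $N_{\mathrm{SLC}}$ is a procedure which, for any density on $\mathbb{R}^d$ that is SLC with condition number at most $4$ and any $\delta>0$, outputs a sample whose law is within $\delta$ of that density in $D$, using at most $N_{\mathrm{SLC}}(\delta)$ queries to an oracle for that density (its score $\nabla\log$, and its log-density up to an additive constant if the sampler uses it). The overall procedure is assumed to have such oracle access to the marginal densities $p_k$; access to the backward conditionals follows from $\nabla_y \log p_{k\mid k+1}(y\mid y') = \nabla \log p_k(y) - \frac{a_k}{1-a_k^2}(a_k y - y')$. *)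

theory Defs
  imports "HOL-Probability.Probability"
begin

subsection \<open>Gaussian vectors, densities and conditional laws\<close>

definition std_gaussian_density :: "real ^ 'n \<Rightarrow> real" where
  "std_gaussian_density z = (\<Prod>i\<in>UNIV. std_normal_density (z $ i))"

text \<open>
  Densities and regular conditional laws are only determined almost everywhere, whereas
  \<open>\<nabla>\<^sup>2 log p\<close> and \<open>cov (X | Y = y)\<close> are needed at every point.  The continuous version is meant
  throughout: the continuous Lebesgue density, and the weakly continuous conditional law (which is
  unique if the law of \<open>Y\<close> has full support).
\<close>

definition is_pdf :: "'w measure \<Rightarrow> ('w \<Rightarrow> 'b::euclidean_space) \<Rightarrow> ('b \<Rightarrow> real) \<Rightarrow> bool" where
  "is_pdf M Y p \<longleftrightarrow>
     continuous_on UNIV p \<and> (\<forall>y. 0 \<le> p y) \<and> distributed M lborel Y (\<lambda>y. ennreal (p y))"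

definition pdf :: "'w measure \<Rightarrow> ('w \<Rightarrow> 'b::euclidean_space) \<Rightarrow> 'b \<Rightarrow> real" where
  "pdf M Y = (THE p. is_pdf M Y p)"

definition cond_pdf ::
    "'w measure \<Rightarrow> ('w \<Rightarrow> 'b::euclidean_space) \<Rightarrow> ('w \<Rightarrow> 'b) \<Rightarrow> 'b \<Rightarrow> 'b \<Rightarrow> real" where
  "cond_pdf M Y Y' y' y = pdf M (\<lambda>\<omega>. (Y \<omega>, Y' \<omega>)) (y, y') / pdf M Y' y'"

definition is_cond_law ::
    "'w measure \<Rightarrow> ('w \<Rightarrow> 'b::euclidean_space) \<Rightarrow> ('w \<Rightarrow> 'b) \<Rightarrow> ('b \<Rightarrow> 'b measure) \<Rightarrow> bool" where
  "is_cond_law M X Y \<kappa> \<longleftrightarrow>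
     \<kappa> \<in> borel \<rightarrow>\<^sub>M prob_algebra borel \<and>
     (\<forall>A\<in>sets borel. \<forall>C\<in>sets borel.
        emeasure M {\<omega> \<in> space M. Y \<omega> \<in> A \<and> X \<omega> \<in> C} =
          (\<integral>\<^sup>+\<omega>. indicator A (Y \<omega>) * emeasure (\<kappa> (Y \<omega>)) C \<partial>M)) \<and>
     (\<forall>f :: 'b \<Rightarrow> real. continuous_on UNIV f \<longrightarrow> bounded (range f) \<longrightarrow>
        continuous_on UNIV (\<lambda>y. \<integral>x. f x \<partial>\<kappa> y))"

definition cond_law ::
    "'w measure \<Rightarrow> ('w \<Rightarrow> 'b::euclidean_space) \<Rightarrow> ('w \<Rightarrow> 'b) \<Rightarrow> 'b \<Rightarrow> 'b measure" where
  "cond_law M X Y = (THE \<kappa>. is_cond_law M X Y \<kappa>)"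

definition cov_matrix :: "(real ^ 'n) measure \<Rightarrow> real ^ 'n ^ 'n" where
  "cov_matrix \<mu> =
     (\<chi> i j. \<integral>x. (x $ i - (\<integral>z. z \<partial>\<mu>) $ i) * (x $ j - (\<integral>z. z \<partial>\<mu>) $ j) \<partial>\<mu>)"

definition cond_cov ::
    "'w measure \<Rightarrow> ('w \<Rightarrow> real ^ 'n) \<Rightarrow> ('w \<Rightarrow> real ^ 'n) \<Rightarrow> real ^ 'n \<Rightarrow> real ^ 'n ^ 'n" where
  "cond_cov M X Y y = cov_matrix (cond_law M X Y y)"

definition op_norm :: "real ^ 'n ^ 'n \<Rightarrow> real" where
  "op_norm A = onorm (\<lambda>v. A *v v)"


subsection \<open>Strong log-concavity\<close>

definition loewner_le :: "real ^ 'n ^ 'n \<Rightarrow> real ^ 'n ^ 'n \<Rightarrow> bool" where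
  "loewner_le A B \<longleftrightarrow> (\<forall>v. v \<bullet> (A *v v) \<le> v \<bullet> (B *v v))"

definition slc_bounds :: "real \<Rightarrow> real \<Rightarrow> (real ^ 'n \<Rightarrow> real) \<Rightarrow> bool" where
  "slc_bounds m' M' p \<longleftrightarrow>
     p \<in> borel_measurable borel \<and> (\<forall>x. 0 < p x) \<and> (\<integral>\<^sup>+x. ennreal (p x) \<partial>lborel) = 1 \<and>
     (\<exists>g H. \<forall>x.
        (GDERIV (\<lambda>z. ln (p z)) x :> g x) \<and>
        (g has_derivative (\<lambda>v. H x *v v)) (at x) \<and>
        loewner_le (m' *\<^sub>R mat 1) (- H x) \<and>
        loewner_le (- H x) (M' *\<^sub>R mat 1))"

definition slc :: "real \<Rightarrow> (real ^ 'n \<Rightarrow> real) \<Rightarrow> bool" where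
  "slc c p \<longleftrightarrow> (\<exists>m' M'. 0 < m' \<and> m' \<le> M' \<and> M' / m' \<le> c \<and> slc_bounds m' M' p)"

definition slc_cond :: "real \<Rightarrow> ('b \<Rightarrow> real ^ 'n \<Rightarrow> real) \<Rightarrow> bool" where
  "slc_cond c q \<longleftrightarrow>
     (\<exists>m' M'. 0 < m' \<and> m' \<le> M' \<and> M' / m' \<le> c \<and> (\<forall>y'. slc_bounds m' M' (q y')))"


subsection \<open>Discrepancies\<close>

definition tv_dist :: "'b measure \<Rightarrow> 'b measure \<Rightarrow> ereal" where
  "tv_dist q p = (SUP A\<in>sets p. ereal \<bar>measure q A - measure p A\<bar>)"

text \<open>
  \<open>KL(q || p)\<close>; note that \<^const>\<open>KL_divergence\<close> takes the reference measure first.  The negative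
  part of the integrand is always \<open>q\<close>-integrable, so non-integrability means that the integral is
  \<open>\<infinity>\<close>.
\<close>

definition kl_div :: "'b measure \<Rightarrow> 'b measure \<Rightarrow> ereal" where
  "kl_div q p =
     (if absolutely_continuous p q \<and> integrable q (entropy_density (exp 1) p q)
      then ereal (KL_divergence (exp 1) p q) else \<infinity>)"


subsection \<open>Procedures with oracle access\<close>

text \<open>
  For a fixed value of its random seed, a procedure is an adaptive query strategy, that is, a
  well-founded decision tree whose next step may depend arbitrarily on the answers so far.  Each
  inner node is one oracle query.  It can see the oracle only through the answers.
\<close>

datatype ('q, 'r, 'o) oracle_prog =
    Return 'o
  | Query 'q "'r \<Rightarrow> ('q, 'r, 'o) oracle_prog"

primrec run :: "('q \<Rightarrow> 'r) \<Rightarrow> ('q, 'r, 'o) oracle_prog \<Rightarrow> 'o" where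
  "run \<O> (Return z) = z"
| "run \<O> (Query x f) = run \<O> (f (\<O> x))"

primrec query_count :: "('q \<Rightarrow> 'r) \<Rightarrow> ('q, 'r, 'o) oracle_prog \<Rightarrow> nat" where
  "query_count \<O> (Return z) = 0"
| "query_count \<O> (Query x f) = Suc (query_count \<O> (f (\<O> x)))"

primrec bind_prog ::
    "('q, 'r, 'o) oracle_prog \<Rightarrow> ('o \<Rightarrow> ('q, 'r, 'u) oracle_prog) \<Rightarrow> ('q, 'r, 'u) oracle_prog" where
  "bind_prog (Return z) h = h z"
| "bind_prog (Query x f) h = Query x (\<lambda>r. bind_prog (f r) h)"

text \<open>
  \<open>relay t conv P\<close> runs \<open>P\<close> against another oracle: a query \<open>x\<close> of \<open>P\<close> is replaced by the single
  query \<open>t x\<close>, and \<open>P\<close> continues with the post-processed answer \<open>conv x r\<close>.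
\<close>

primrec relay ::
    "('q \<Rightarrow> 'q2) \<Rightarrow> ('q \<Rightarrow> 'r2 \<Rightarrow> 'r) \<Rightarrow> ('q, 'r, 'o) oracle_prog \<Rightarrow> ('q2, 'r2, 'o) oracle_prog" where
  "relay t conv (Return z) = Return z"
| "relay t conv (Query x f) = Query (t x) (\<lambda>r. relay t conv (f (conv x r)))"

definition score :: "(real ^ 'n \<Rightarrow> real) \<Rightarrow> real ^ 'n \<Rightarrow> real ^ 'n" where
  "score p x = (THE g. GDERIV (\<lambda>z. ln (p z)) x :> g)"

text \<open>
  The answer to a query is the score together with the log-density up to the unknown additive
  constant \<open>c\<close>; procedures that use only the score ignore the second component.
\<close>

type_synonym 'n answer = "(real ^ 'n) \<times> real"

type_synonym 'n sampler_prog = "(real ^ 'n, 'n answer, real ^ 'n) oracle_prog"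

definition density_oracle :: "(real ^ 'n \<Rightarrow> real) \<Rightarrow> real \<Rightarrow> real ^ 'n \<Rightarrow> 'n answer" where
  "density_oracle p c x = (score p x, ln (p x) + c)"

text \<open>
  The output must depend measurably on the seed, jointly with a parameter on which the oracle
  depends measurably; otherwise the law of the output is not defined when the target density itself
  depends on an earlier sample.
\<close>

definition measurable_procedure :: "'s measure \<Rightarrow> ('s \<Rightarrow> 'n::finite sampler_prog) \<Rightarrow> bool" where
  "measurable_procedure R P \<longleftrightarrow>
     (\<forall>\<O> :: real ^ 'n \<Rightarrow> real ^ 'n \<Rightarrow> 'n answer.
        (\<lambda>(y, x). \<O> y x) \<in> borel_measurable (borel \<Otimes>\<^sub>M borel) \<longrightarrow>
        (\<lambda>(y, s). run (\<O> y) (P s)) \<in> borel_measurable (borel \<Otimes>\<^sub>M R))"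

text \<open>
  \<open>S \<delta>\<close> is the procedure run at accuracy \<open>\<delta>\<close> with a seed of law \<open>R\<close>.  The bound \<open>N \<delta> = \<infinity>\<close>
  is allowed and means that no uniform bound is claimed.
\<close>

definition slc_sampler ::
    "((real ^ 'n) measure \<Rightarrow> (real ^ 'n) measure \<Rightarrow> ereal) \<Rightarrow> (real \<Rightarrow> enat) \<Rightarrow>
     's measure \<Rightarrow> (real \<Rightarrow> 's \<Rightarrow> 'n::finite sampler_prog) \<Rightarrow> bool" where
  "slc_sampler D N R S \<longleftrightarrow>
     prob_space R \<and>
     (\<forall>\<delta>>0. measurable_procedure R (S \<delta>) \<and>
       (\<forall>p c. slc 4 p \<longrightarrow>
          D (distr R borel (\<lambda>s. run (density_oracle p c) (S \<delta> s)))
            (density lborel (\<lambda>x. ennreal (p x))) \<le> ereal \<delta> \<and>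
          (\<forall>s\<in>space R. enat (query_count (density_oracle p c) (S \<delta> s)) \<le> N \<delta>)))"


subsection \<open>Sequential sampling from the marginal oracles\<close>

text \<open>
  A query \<open>(k, x)\<close> is answered by the oracle for the marginal density \<open>p\<^sub>k\<close> at \<open>x\<close>.  The answer is
  converted into one for the backward conditional density given \<open>y'\<close>, using, for \<open>b = a\<^sub>k\<close>,
  \<open>log p(x | y') = log p\<^sub>k(x) - |y' - b x|\<^sup>2 / (2 (1 - b\<^sup>2)) + const(y')\<close>.
\<close>

definition backward_answer ::
    "real \<Rightarrow> real ^ 'n \<Rightarrow> real ^ 'n \<Rightarrow> 'n answer \<Rightarrow> 'n answer" where
  "backward_answer b y' x r =
     (fst r - (b / (1 - b\<^sup>2)) *\<^sub>R (b *\<^sub>R x - y'),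
      snd r - (norm (y' - b *\<^sub>R x))\<^sup>2 / (2 * (1 - b\<^sup>2)))"

type_synonym 'n marginal_prog = "(nat \<times> (real ^ 'n), 'n answer, real ^ 'n) oracle_prog"

text \<open>
  The overall procedure samples \<open>y\<^sub>K\<close> from \<open>p\<^sub>K\<close> and then, for \<open>k = K - 1, \<dots>, 1\<close>, samples \<open>y\<^sub>k\<close>
  from the backward conditional density given \<open>y\<^sub>k\<^sub>+\<^sub>1\<close>, each time by the given sampler \<open>P\<close>; stage
  \<open>k\<close> uses the seed \<open>\<omega> k\<close>.
\<close>

primrec backward_prog ::
    "(nat \<Rightarrow> real) \<Rightarrow> ('s \<Rightarrow> 'n::finite sampler_prog) \<Rightarrow> (nat \<Rightarrow> 's) \<Rightarrow> nat \<Rightarrow> real ^ 'n \<Rightarrow>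
     'n marginal_prog" where
  "backward_prog a P \<omega> 0 y' = Return y'"
| "backward_prog a P \<omega> (Suc j) y' =
     bind_prog (relay (Pair (Suc j)) (backward_answer (a (Suc j)) y') (P (\<omega> (Suc j))))
       (backward_prog a P \<omega> j)"

definition sequential_prog ::
    "(nat \<Rightarrow> real) \<Rightarrow> ('s \<Rightarrow> 'n::finite sampler_prog) \<Rightarrow> nat \<Rightarrow> (nat \<Rightarrow> 's) \<Rightarrow> 'n marginal_prog" where
  "sequential_prog a P K \<omega> =
     bind_prog (relay (Pair K) (\<lambda>x r. r) (P (\<omega> K))) (backward_prog a P \<omega> (K - 1))"

definition marginal_oracle ::
    "(nat \<Rightarrow> real ^ 'n \<Rightarrow> real) \<Rightarrow> (nat \<Rightarrow> real) \<Rightarrow> nat \<times> (real ^ 'n) \<Rightarrow> 'n answer" where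
  "marginal_oracle p c = (\<lambda>(k, x). density_oracle (p k) (c k) x)"

end

theory Submission
  imports Defs
begin

text \<open>
  Put \<open>\<alpha>\<^sub>k = \<Prod>l<k. a\<^sub>l\<close> and \<open>\<sigma>\<^sub>k\<^sup>2 = 1 - \<alpha>\<^sub>k\<^sup>2\<close>.  Composing the steps of the chain shows that \<open>Y\<^sub>k\<close> is distributed like
  \<open>\<alpha>\<^sub>k X + \<sigma>\<^sub>k G\<close> with a standard Gaussian \<open>G\<close> independent of \<open>X\<close>.  Hence \<open>p\<^sub>k\<close> is a mixture of Gaussians,
  and by Bayes' rule the law of \<open>X\<close> given \<open>Y\<^sub>k = y\<close> is the law of \<open>X\<close> reweighted by
  \<open>exp (z \<bullet> x - \<beta> |x|\<^sup>2)\<close> with \<open>z = (\<alpha>\<^sub>k / \<sigma>\<^sub>k\<^sup>2) y\<close>.  Two derivatives of the logarithm of the normalising constant of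
  such a family give the mean and the covariance, so that

  \<open>- \<nabla>\<^sup>2 log p\<^sub>k(y) = I / \<sigma>\<^sub>k\<^sup>2 - (\<alpha>\<^sub>k / \<sigma>\<^sub>k\<^sup>2)\<^sup>2 cov (X | Y\<^sub>k = y)\<close>.

  A covariance lies between \<open>0\<close> and \<open>B\<^sub>k I\<close>, and \<open>\<sigma>\<^sub>k\<^sup>2 \<ge> 1/2\<close>.  If \<open>8 B\<^sub>K \<alpha>\<^sub>K\<^sup>2 \<le> 1\<close>, the second term removes at
  most a quarter of the first, and \<open>p\<^sub>K\<close> has condition number at most \<open>4/3\<close> (\<open>slc_dens\<close>).  Otherwise
  \<open>- \<nabla>\<^sup>2 log p\<^sub>k\<close> is only bounded from below by \<open>1 / \<sigma>\<^sub>k\<^sup>2 - \<lambda>\<^sub>k\<close> (times \<open>I\<close>), but conditioning on \<open>Y\<^sub>k\<^sub>+\<^sub>1\<close> adds the constant curvature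
  \<open>a\<^sub>k\<^sup>2 / (1 - a\<^sub>k\<^sup>2) = 2 \<lambda>\<^sub>k + 2\<close>, which leaves a condition number of at most \<open>2\<close> (\<open>slc_bwd\<close>).

  The number of steps is controlled by a potential.  For \<open>u\<^sub>k = \<alpha>\<^sub>k\<^sup>2\<close> the stepsize rule says
  \<open>u\<^sub>k\<^sub>+\<^sub>1 = u\<^sub>k (1 - 1 / (2 \<lambda>\<^sub>k + 3))\<close>, which makes \<open>8 B\<^sub>m\<^sub>a\<^sub>x u\<^sub>k + 3 ln u\<^sub>k\<close> drop by at least \<open>1\<close> in each step.  While
  \<open>8 B\<^sub>k u\<^sub>k > 1\<close> the potential is bounded from below, so this can last for at most \<open>7 B\<^sub>m\<^sub>a\<^sub>x + 3\<close> steps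
  (\<open>trajectory_length\<close>).

  For the accuracy, the output of the procedure and \<open>Y\<^sub>1\<close> both arise by running through \<open>K\<close> Markov kernels,
  and corresponding kernels are within \<open>\<delta> = \<epsilon> / (K + 1)\<close> of each other.  That the errors add up is proved for both
  discrepancies at once, by writing \<open>D (q, p) \<le> c\<close> as a family of inequalities
  \<open>\<integral>f dq \<le> c + \<psi> (\<integral>\<phi>(f) dp)\<close> over test functions \<open>f\<close>: for total variation \<open>\<phi> = \<psi> = id\<close> and \<open>0 \<le> f \<le> 1\<close>; for
  the Kullback-Leibler divergence \<open>\<phi> = exp\<close>, \<open>\<psi> = ln\<close> and \<open>f\<close> bounded, which is the Donsker-Varadhan formula
  (\<open>tv_dist_le_iff\<close>, \<open>kl_div_le_iff\<close>).  In this form the bounds compose along kernels simply by choosing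
  \<open>y \<mapsto> \<psi> (\<integral>\<phi>(f) dk(y))\<close> as the next test function (\<open>mean_bound_bind\<close>), whereas the chain rule for the divergence would need a jointly
  measurable choice of the densities of the kernels.
\<close>

section \<open>Centred Gaussian densities\<close>

definition gaussian_density :: "real \<Rightarrow> real ^ 'n \<Rightarrow> real" where
  "gaussian_density s z = (\<Prod>i\<in>UNIV. normal_density 0 s (z $ i))"

lemma std_gaussian_density_eq: "std_gaussian_density = gaussian_density 1"
  by (simp add: fun_eq_iff std_gaussian_density_def gaussian_density_def)

lemma norm_vec_square: "(norm (z :: real ^ 'n))\<^sup>2 = (\<Sum>i\<in>UNIV. (z $ i)\<^sup>2)"
  unfolding power2_norm_eq_inner by (simp add: inner_vec_def power2_eq_square)

lemma gaussian_density_eq_exp: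
  "gaussian_density s (z :: real ^ 'n) =
     (1 / sqrt (2 * pi * s\<^sup>2)) ^ CARD('n) * exp (- ((norm z)\<^sup>2 / (2 * s\<^sup>2)))"
  by (simp add: gaussian_density_def normal_density_def prod.distrib norm_vec_square
      sum_divide_distrib sum_negf [symmetric] exp_sum power_one_over prod_dividef)

lemma gaussian_density_pos: "0 < s \<Longrightarrow> 0 < gaussian_density s z"
  by (simp add: gaussian_density_def prod_pos normal_density_pos)

lemma gaussian_density_nonneg: "0 \<le> gaussian_density s z"
  by (simp add: gaussian_density_def prod_nonneg)

lemma gaussian_density_le:
  "gaussian_density s (z :: real ^ 'n) \<le> (1 / sqrt (2 * pi * s\<^sup>2)) ^ CARD('n)"
  unfolding gaussian_density_eq_exp by (rule mult_right_le_one_le) auto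

lemma continuous_on_gaussian_density [continuous_intros]:
  "continuous_on A f \<Longrightarrow> continuous_on A (\<lambda>x. gaussian_density s (f x))"
  unfolding gaussian_density_eq_exp divide_inverse by (intro continuous_intros)

lemma borel_measurable_gaussian_density [measurable]:
  "gaussian_density s \<in> borel_measurable borel"
  by (intro borel_measurable_continuous_onI continuous_on_gaussian_density continuous_intros)

lemma nn_integral_lborel_prod_vec:
  fixes f :: "'n::finite \<Rightarrow> real \<Rightarrow> ennreal"
  assumes "\<And>i. f i \<in> borel_measurable borel"
  shows "(\<integral>\<^sup>+z. (\<Prod>i\<in>UNIV. f i (z $ i)) \<partial>(lborel :: (real ^ 'n) measure))
    = (\<Prod>i\<in>UNIV. \<integral>\<^sup>+x. f i x \<partial>lborel)"
proof -
  have reindex: "(\<Prod>b\<in>Basis. g b) = (\<Prod>i\<in>UNIV. g (axis i 1))"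
    for g :: "real ^ 'n \<Rightarrow> ennreal"
  proof -
    have Basis: "(Basis :: (real ^ 'n) set) = (\<lambda>i. axis i 1) ` UNIV"
      by (auto simp: Basis_vec_def)
    have "inj (\<lambda>i. axis i (1 :: real) :: real ^ 'n)"
      by (simp add: inj_def axis_eq_axis)
    then show ?thesis
      unfolding Basis by (subst prod.reindex) (simp_all add: o_def)
  qed
  have "(\<integral>\<^sup>+z. (\<Prod>b\<in>Basis. f (axis_index b) (z \<bullet> b)) \<partial>(lborel :: (real ^ 'n) measure))
    = (\<Prod>b\<in>(Basis :: (real ^ 'n) set). \<integral>\<^sup>+x. f (axis_index b) x \<partial>lborel)"
    by (rule nn_integral_lborel_prod) (use assms in auto)
  then show ?thesis
    by (simp add: reindex inner_axis)
qed

text \<open>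
  The substitution \<open>z = a (x - m)\<close> turns the integral into the convolution of the centred normal densities with
  standard deviations \<open>|a| \<sigma>\<close> and \<open>s\<close>.
\<close>

lemma normal_density_affine_convolution:
  assumes "0 < \<sigma>" "0 < s" "a \<noteq> 0"
  shows "(\<integral>\<^sup>+x. ennreal (normal_density 0 \<sigma> (x - m) * normal_density 0 s (y - a * x)) \<partial>lborel)
    = ennreal (normal_density 0 (sqrt (a\<^sup>2 * \<sigma>\<^sup>2 + s\<^sup>2)) (y - a * m))"
proof -
  have scale: "\<bar>a\<bar> * normal_density 0 (\<bar>a\<bar> * \<sigma>) (- (a * m) + a * x) = normal_density 0 \<sigma> (x - m)" for x
  proof -
    have "(- (a * m) + a * x)\<^sup>2 = a\<^sup>2 * (x - m)\<^sup>2"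
      by (simp add: power2_eq_square algebra_simps)
    then show ?thesis
      using assms by (simp add: normal_density_def power_mult_distrib real_sqrt_mult field_simps)
  qed
  have "ennreal (normal_density 0 (sqrt (s\<^sup>2 + (\<bar>a\<bar> * \<sigma>)\<^sup>2)) (y - a * m))
    = (\<integral>\<^sup>+z. ennreal (normal_density 0 s (y - a * m - z) * normal_density 0 (\<bar>a\<bar> * \<sigma>) z) \<partial>lborel)"
    using conv_normal_density_zero_mean[of s "\<bar>a\<bar> * \<sigma>"] assms by (simp add: fun_eq_iff)
  also have "\<dots> = \<bar>a\<bar> * (\<integral>\<^sup>+x. ennreal (normal_density 0 s (y - a * m - (- (a * m) + a * x))
      * normal_density 0 (\<bar>a\<bar> * \<sigma>) (- (a * m) + a * x)) \<partial>lborel)"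
    by (rule nn_integral_real_affine) (use assms in auto)
  also have "\<dots> = (\<integral>\<^sup>+x. ennreal (\<bar>a\<bar> * (normal_density 0 s (y - a * m - (- (a * m) + a * x))
      * normal_density 0 (\<bar>a\<bar> * \<sigma>) (- (a * m) + a * x))) \<partial>lborel)"
    by (simp add: nn_integral_cmult [symmetric] ennreal_mult')
  also have "\<dots> = (\<integral>\<^sup>+x. ennreal (normal_density 0 \<sigma> (x - m) * normal_density 0 s (y - a * x)) \<partial>lborel)"
    unfolding scale [symmetric] by (intro nn_integral_cong arg_cong [where f = ennreal]) (simp add: algebra_simps)
  finally show ?thesis
    by (simp add: power_mult_distrib add.commute)
qed

text \<open>
  The effect of a step \<open>x \<mapsto> a x + s w\<close> of the chain on a Gaussian vector with mean \<open>m\<close>; the coordinates separate.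
\<close>

lemma gaussian_density_affine_convolution:
  fixes m y :: "real ^ 'n"
  assumes "0 < \<sigma>" "0 < s" "a \<noteq> 0"
  shows "(\<integral>\<^sup>+x. ennreal (gaussian_density \<sigma> (x - m) * gaussian_density s (y - a *\<^sub>R x)) \<partial>lborel)
    = ennreal (gaussian_density (sqrt (a\<^sup>2 * \<sigma>\<^sup>2 + s\<^sup>2)) (y - a *\<^sub>R m))"
proof -
  have "(\<integral>\<^sup>+x. ennreal (gaussian_density \<sigma> (x - m) * gaussian_density s (y - a *\<^sub>R x)) \<partial>lborel)
    = (\<integral>\<^sup>+x. (\<Prod>i\<in>UNIV. ennreal (normal_density 0 \<sigma> (x $ i - m $ i) * normal_density 0 s (y $ i - a * x $ i))) \<partial>lborel)"
    by (intro nn_integral_cong)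
      (simp add: gaussian_density_def prod.distrib [symmetric] prod_ennreal)
  also have "\<dots> = (\<Prod>i\<in>UNIV. \<integral>\<^sup>+t. ennreal (normal_density 0 \<sigma> (t - m $ i) * normal_density 0 s (y $ i - a * t)) \<partial>lborel)"
    by (rule nn_integral_lborel_prod_vec) measurable
  also have "\<dots> = ennreal (gaussian_density (sqrt (a\<^sup>2 * \<sigma>\<^sup>2 + s\<^sup>2)) (y - a *\<^sub>R m))"
    using assms by (simp add: normal_density_affine_convolution gaussian_density_def prod_ennreal)
  finally show ?thesis .
qed

lemma nn_integral_gaussian_density:
  fixes m :: "real ^ 'n"
  assumes "0 < s"
  shows "(\<integral>\<^sup>+x. ennreal (gaussian_density s (x - m)) \<partial>lborel) = 1"
proof -
  have eq: "(\<integral>\<^sup>+t. ennreal (normal_density 0 s (t - c)) \<partial>lborel) = 1" for c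
  proof -
    have "(\<integral>\<^sup>+t. ennreal (normal_density 0 s (t - c)) \<partial>lborel) = (\<integral>\<^sup>+t. ennreal (normal_density c s t) \<partial>lborel)"
      by (simp add: normal_density_def)
    also have "\<dots> = 1"
      using prob_space.emeasure_space_1[OF prob_space_normal_density[OF assms, of c]]
      by (simp add: emeasure_density)
    finally show ?thesis .
  qed
  have "(\<integral>\<^sup>+x. ennreal (gaussian_density s (x - m)) \<partial>lborel)
    = (\<integral>\<^sup>+x. (\<Prod>i\<in>UNIV. ennreal (normal_density 0 s (x $ i - m $ i))) \<partial>lborel)"
    by (intro nn_integral_cong) (simp add: gaussian_density_def prod_ennreal)
  also have "\<dots> = (\<Prod>i\<in>UNIV. \<integral>\<^sup>+t. ennreal (normal_density 0 s (t - m $ i)) \<partial>lborel)"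
    by (rule nn_integral_lborel_prod_vec) measurable
  finally show ?thesis by (simp add: eq)
qed

lemma nn_integral_affine_gaussian:
  fixes g :: "real ^ 'n \<Rightarrow> ennreal" and m :: "real ^ 'n"
  assumes [measurable]: "g \<in> borel_measurable borel" and s: "0 < s"
  shows "(\<integral>\<^sup>+w. g (m + s *\<^sub>R w) * ennreal (gaussian_density 1 w) \<partial>lborel)
    = (\<integral>\<^sup>+y. g y * ennreal (gaussian_density s (y - m)) \<partial>lborel)"
proof -
  have scale: "s ^ CARD('n) * gaussian_density s (s *\<^sub>R w) = gaussian_density 1 w" for w :: "real ^ 'n"
    using s by (simp add: gaussian_density_eq_exp power_mult_distrib real_sqrt_mult power_divide field_simps)
  have "(\<integral>\<^sup>+y. g y * ennreal (gaussian_density s (y - m)) \<partial>lborel)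
    = (\<integral>\<^sup>+y. g y * ennreal (gaussian_density s (y - m))
         \<partial>density (distr lborel borel (\<lambda>x. m + s *\<^sub>R x)) (\<lambda>_. ennreal (\<bar>s\<bar> ^ DIM(real ^ 'n))))"
    using s by (subst lborel_affine[of s m]) auto
  also have "\<dots> = (\<integral>\<^sup>+w. ennreal (\<bar>s\<bar> ^ DIM(real ^ 'n)) * (g (m + s *\<^sub>R w) * ennreal (gaussian_density s (s *\<^sub>R w))) \<partial>lborel)"
    by (subst nn_integral_density) (simp_all add: nn_integral_distr)
  also have "\<dots> = (\<integral>\<^sup>+w. g (m + s *\<^sub>R w) * ennreal (gaussian_density 1 w) \<partial>lborel)"
    using s by (intro nn_integral_cong)
      (simp add: scale [symmetric] ennreal_mult' mult_ac)
  finally show ?thesis ..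
qed

section \<open>Exponential tilting of a measure with a Gaussian weight\<close>

text \<open>
  Integrals depending on a parameter are differentiated through this criterion: a remainder estimate that is
  quadratic in the increment can be integrated pointwise, and no interchange of limit and integral is left.
\<close>

lemma has_derivative_from_quadratic_remainder:
  fixes f :: "'a::real_normed_vector \<Rightarrow> 'b::real_normed_vector"
  assumes D: "bounded_linear D"
    and rem: "\<And>v. norm v \<le> 1 \<Longrightarrow> norm (f (z + v) - f z - D v) \<le> C * (norm v)\<^sup>2"
  shows "(f has_derivative D) (at z)"
  unfolding has_derivative_at
proof (intro conjI D)
  have "((\<lambda>v :: 'a. C * norm v) \<longlongrightarrow> C * norm (0 :: 'a)) (at 0)"
    by (rule tendsto_mult[OF tendsto_const tendsto_norm[OF tendsto_ident_at]])
  then have lim: "((\<lambda>v::'a. C * norm v) \<longlongrightarrow> 0) (at 0)" by simp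
  show "(\<lambda>v. norm (f (z + v) - f z - D v) / norm v) \<midarrow>0\<rightarrow> 0"
  proof (rule tendsto_sandwich[OF _ _ tendsto_const lim])
    show "\<forall>\<^sub>F v in at 0. norm (f (z + v) - f z - D v) / norm v \<le> C * norm v"
      unfolding eventually_at
    proof (intro exI[of _ 1] conjI ballI impI)
      fix v :: 'a
      assume v: "v \<noteq> 0 \<and> dist v 0 < 1"
      with rem[of v] have "norm (f (z + v) - f z - D v) \<le> (C * norm v) * norm v"
        by (simp add: power2_eq_square mult_ac)
      with v show "norm (f (z + v) - f z - D v) / norm v \<le> C * norm v"
        by (simp add: divide_le_eq)
    qed simp
  qed simp
qed

lemma exp_remainder_le:
  fixes t :: real
  shows "\<bar>exp t - 1 - t\<bar> \<le> t\<^sup>2 * exp \<bar>t\<bar>"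
proof -
  obtain s where s: "\<bar>s\<bar> \<le> \<bar>t\<bar>" "exp t = (\<Sum>m<2. t ^ m / fact m) + exp s / fact 2 * t\<^sup>2"
    using Maclaurin_exp_le[of t 2] by auto
  have "exp t - 1 - t = exp s / 2 * t\<^sup>2"
    using s(2) by (simp add: numeral_2_eq_2)
  then have "\<bar>exp t - 1 - t\<bar> = exp s / 2 * t\<^sup>2" by (simp only: abs_mult) simp
  also have "\<dots> \<le> exp \<bar>t\<bar> * t\<^sup>2"
  proof (intro mult_right_mono)
    have "exp s \<le> exp \<bar>t\<bar>" using s(1) by simp
    then show "exp s / 2 \<le> exp \<bar>t\<bar>" using exp_gt_zero[of s] by linarith
  qed simp
  finally show ?thesis by (simp add: mult.commute)
qed

text \<open>
  The weight \<open>exp (- \<beta> |x|\<^sup>2)\<close> makes every function of at most exponential growth integrable.  This is why the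
  conditional laws of \<open>X\<close> have all moments although nothing is assumed about the moments of \<open>X\<close>.
\<close>

locale gaussian_weighted = prob_space \<mu> for \<mu> :: "(real ^ 'n) measure" +
  fixes \<beta> :: real
  assumes sets_base [measurable_cong]: "sets \<mu> = sets borel" and \<beta>: "0 < \<beta>"
begin

definition wgt :: "real ^ 'n \<Rightarrow> real ^ 'n \<Rightarrow> real" where
  "wgt z x = exp (z \<bullet> x - \<beta> * (norm x)\<^sup>2)"

definition exp_bounded :: "(real ^ 'n \<Rightarrow> 'b::real_normed_vector) \<Rightarrow> bool" where
  "exp_bounded h \<longleftrightarrow> h \<in> borel_measurable borel \<and> (\<exists>C c. \<forall>x. norm (h x) \<le> C * exp (c * norm x))"

lemma wgt_pos: "0 < wgt z x" by (simp add: wgt_def)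

lemma wgt_measurable [measurable]: "wgt z \<in> borel_measurable borel"
  unfolding wgt_def by measurable

text \<open>
Completing the square.
\<close>

lemma exp_linear_minus_square_le: "exp (c * r) * exp (- (\<beta> * r\<^sup>2)) \<le> exp (c\<^sup>2 / (4 * \<beta>))"
proof -
  have "0 \<le> (c - 2 * \<beta> * r)\<^sup>2 / (4 * \<beta>)" using \<beta> by simp
  also have "\<dots> = c\<^sup>2 / (4 * \<beta>) - (c * r - \<beta> * r\<^sup>2)"
    using \<beta> by (simp add: field_simps power2_eq_square)
  finally show ?thesis by (simp add: exp_add [symmetric])
qed

lemma wgt_le: "wgt z x \<le> exp (norm z * norm x) * exp (- (\<beta> * (norm x)\<^sup>2))"
  using norm_cauchy_schwarz[of z x] by (simp add: wgt_def exp_add [symmetric])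

lemma integrable_wgt:
  fixes h :: "real ^ 'n \<Rightarrow> 'b::euclidean_space"
  assumes "exp_bounded h"
  shows "integrable \<mu> (\<lambda>x. wgt z x *\<^sub>R h x)"
proof -
  from assms obtain C c where [measurable]: "h \<in> borel_measurable borel"
    and h: "\<And>x. norm (h x) \<le> C * exp (c * norm x)"
    by (auto simp: exp_bounded_def)
  have C: "0 \<le> C" using h[of 0] order_trans[OF norm_ge_zero] by fastforce
  show ?thesis
  proof (rule integrable_const_bound)
    show "AE x in \<mu>. norm (wgt z x *\<^sub>R h x) \<le> C * exp ((norm z + c)\<^sup>2 / (4 * \<beta>))"
    proof (rule AE_I2)
      fix x
      have "norm (wgt z x *\<^sub>R h x) \<le> (exp (norm z * norm x) * exp (- (\<beta> * (norm x)\<^sup>2))) * (C * exp (c * norm x))"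
        using wgt_le[of z x] h[of x] wgt_pos[of z x] by (auto intro!: mult_mono)
      also have "\<dots> = C * (exp ((norm z + c) * norm x) * exp (- (\<beta> * (norm x)\<^sup>2)))"
        by (simp add: exp_add distrib_right)
      also have "\<dots> \<le> C * exp ((norm z + c)\<^sup>2 / (4 * \<beta>))"
        by (intro mult_left_mono exp_linear_minus_square_le C)
      finally show "norm (wgt z x *\<^sub>R h x) \<le> C * exp ((norm z + c)\<^sup>2 / (4 * \<beta>))" .
    qed
  qed measurable
qed

lemma exp_bounded_const: "exp_bounded (\<lambda>_. c)"
  unfolding exp_bounded_def by (intro conjI exI[of _ "norm c"] exI[of _ 0]) simp_all

lemma exp_bounded_id: "exp_bounded (\<lambda>x. x)"
  unfolding exp_bounded_def
proof (intro conjI exI allI)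
  show "norm x \<le> 1 * exp (1 * norm x)" for x :: "real ^ 'n"
    using exp_ge_add_one_self[of "norm x"] by (simp del: exp_ge_add_one_self)
qed simp

lemma exp_bounded_mono:
  assumes "exp_bounded g" "h \<in> borel_measurable borel" "\<And>x. norm (h x) \<le> C * norm (g x)"
  shows "exp_bounded h"
proof -
  obtain C' c where g: "\<And>x. norm (g x) \<le> C' * exp (c * norm x)"
    using assms(1) by (auto simp: exp_bounded_def)
  then have "norm (h x) \<le> (\<bar>C\<bar> * C') * exp (c * norm x)" for x
  proof -
    have "norm (h x) \<le> C * norm (g x)" by (rule assms(3))
    also have "\<dots> \<le> \<bar>C\<bar> * (C' * exp (c * norm x))"
      using g[of x] by (intro mult_mono) auto
    finally show ?thesis by (simp add: mult.assoc)
  qed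
  with assms(2) show ?thesis by (auto simp: exp_bounded_def)
qed

lemma exp_bounded_scaleR:
  assumes "exp_bounded f" "exp_bounded h"
  shows "exp_bounded (\<lambda>x. f x *\<^sub>R h x :: 'b::euclidean_space)"
proof -
  obtain C c D d where [measurable]: "f \<in> borel_measurable borel" "h \<in> borel_measurable borel"
    and b: "\<And>x. norm (f x) \<le> C * exp (c * norm x)" "\<And>x. norm (h x) \<le> D * exp (d * norm x)"
    using assms by (auto simp: exp_bounded_def)
  have "norm (f x *\<^sub>R h x) \<le> (C * D) * exp ((c + d) * norm x)" for x
  proof -
    have "norm (f x *\<^sub>R h x) \<le> (C * exp (c * norm x)) * (D * exp (d * norm x))"
      using b(1)[of x] b(2)[of x] order_trans[OF norm_ge_zero b(1)]
      by (simp, intro mult_mono) auto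
    then show ?thesis by (simp add: algebra_simps exp_add [symmetric])
  qed
  then show ?thesis unfolding exp_bounded_def by (intro conjI exI[of _ "C * D"] exI[of _ "c + d"] allI) simp_all
qed

lemma exp_bounded_norm: "exp_bounded h \<Longrightarrow> exp_bounded (\<lambda>x. norm (h x))"
  unfolding exp_bounded_def by auto

lemma exp_bounded_inner: "exp_bounded (\<lambda>x. v \<bullet> x)"
  by (rule exp_bounded_mono[OF exp_bounded_id, of _ "norm v"]) (auto simp: Cauchy_Schwarz_ineq2)

text \<open>
  Replacing \<open>z\<close> by \<open>z + v\<close> multiplies the weight by \<open>exp (v \<bullet> x)\<close>, whose linearisation error is at most
  \<open>|v|\<^sup>2 |x|\<^sup>2 exp |x|\<close> for \<open>|v| \<le> 1\<close>; this is again of at most exponential growth.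
\<close>

lemma has_derivative_integral_wgt:
  fixes h :: "real ^ 'n \<Rightarrow> 'b::euclidean_space"
  assumes h: "exp_bounded h"
  shows "((\<lambda>z. \<integral>x. wgt z x *\<^sub>R h x \<partial>\<mu>) has_derivative
           (\<lambda>v. \<integral>x. wgt z x *\<^sub>R ((v \<bullet> x) *\<^sub>R h x) \<partial>\<mu>)) (at z)"
proof (rule has_derivative_from_quadratic_remainder)
  let ?I = "\<lambda>z. \<integral>x. wgt z x *\<^sub>R h x \<partial>\<mu>"
  let ?D = "\<lambda>v. \<integral>x. wgt z x *\<^sub>R ((v \<bullet> x) *\<^sub>R h x) \<partial>\<mu>"
  have hm [measurable]: "h \<in> borel_measurable borel" using h by (simp add: exp_bounded_def)
  note int0 = integrable_wgt[OF h]
  note int1 = integrable_wgt[OF exp_bounded_scaleR[OF exp_bounded_inner h]]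
  have intn: "integrable \<mu> (\<lambda>x. wgt z x * (norm x * norm (h x)))"
    using integrable_wgt[OF exp_bounded_scaleR[OF exp_bounded_norm[OF exp_bounded_id] exp_bounded_norm[OF h]], of z]
    by simp
  show "bounded_linear (\<lambda>v. \<integral>x. wgt z x *\<^sub>R ((v \<bullet> x) *\<^sub>R h x) \<partial>\<mu>)"
  proof (rule bounded_linear_intro)
    show "(\<integral>x. wgt z x *\<^sub>R (((u + v) \<bullet> x) *\<^sub>R h x) \<partial>\<mu>) =
      (\<integral>x. wgt z x *\<^sub>R ((u \<bullet> x) *\<^sub>R h x) \<partial>\<mu>) + (?D v)" for u v
      by (subst Bochner_Integration.integral_add [symmetric])
         (use int1 in \<open>simp_all add: inner_add_left algebra_simps\<close>)
    show "(\<integral>x. wgt z x *\<^sub>R (((r *\<^sub>R v) \<bullet> x) *\<^sub>R h x) \<partial>\<mu>) =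
      r *\<^sub>R (?D v)" for r v
      by (subst integral_scaleR_right [symmetric]) (auto simp: mult_ac)
    show "norm (?D v) \<le> norm v * (\<integral>x. wgt z x * (norm x * norm (h x)) \<partial>\<mu>)" for v
    proof -
      have "norm (?D v) \<le> (\<integral>x. norm v * (wgt z x * (norm x * norm (h x))) \<partial>\<mu>)"
      proof (rule Bochner_Integration.integral_norm_bound_integral)
        show "norm (wgt z x *\<^sub>R (v \<bullet> x) *\<^sub>R h x) \<le> norm v * (wgt z x * (norm x * norm (h x)))" for x
        proof -
          have "norm (wgt z x *\<^sub>R (v \<bullet> x) *\<^sub>R h x) = wgt z x * (\<bar>v \<bullet> x\<bar> * norm (h x))"
            using wgt_pos[of z x] by (simp add: abs_mult)
          also have "\<dots> \<le> wgt z x * ((norm v * norm x) * norm (h x))"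
            using wgt_pos[of z x] by (intro mult_left_mono mult_right_mono Cauchy_Schwarz_ineq2) auto
          finally show ?thesis by (simp add: mult_ac)
        qed
      qed (rule int1, rule integrable_mult_right, rule intn)
      then show ?thesis by simp
    qed
  qed
  define K where "K = (\<integral>x. wgt z x * ((norm x * norm x) * (exp (norm x) * norm (h x))) \<partial>\<mu>)"
  have expb: "exp_bounded (\<lambda>x. exp (norm x))"
    unfolding exp_bounded_def by (auto intro!: exI[of _ 1])
  have intK: "integrable \<mu> (\<lambda>x. wgt z x * ((norm x * norm x) * (exp (norm x) * norm (h x))))"
    using integrable_wgt[OF exp_bounded_scaleR[OF exp_bounded_scaleR[OF exp_bounded_norm[OF exp_bounded_id] exp_bounded_norm[OF exp_bounded_id]]
       exp_bounded_scaleR[OF expb exp_bounded_norm[OF h]]], of z]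
    by simp
  fix v :: "real ^ 'n" assume v: "norm v \<le> 1"
  have "(?I (z + v)) - (?I z) - (?D v)
    = (\<integral>x. (wgt (z + v) x *\<^sub>R h x - wgt z x *\<^sub>R h x) - wgt z x *\<^sub>R ((v \<bullet> x) *\<^sub>R h x) \<partial>\<mu>)"
    by (subst Bochner_Integration.integral_diff; (intro Bochner_Integration.integrable_diff int0 int1)?)
       (simp add: Bochner_Integration.integral_diff int0)
  also have "norm \<dots> \<le> (\<integral>x. (norm v)\<^sup>2 * (wgt z x * ((norm x * norm x) * (exp (norm x) * norm (h x)))) \<partial>\<mu>)"
  proof (rule Bochner_Integration.integral_norm_bound_integral)
    fix x
    let ?t = "v \<bullet> x"
    have t: "\<bar>?t\<bar> \<le> norm v * norm x" by (rule Cauchy_Schwarz_ineq2)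
    have t1: "\<bar>?t\<bar> \<le> norm x" using t v mult_right_mono[of "norm v" 1 "norm x"] by simp
    have "wgt (z + v) x = wgt z x * exp ?t"
      by (simp add: wgt_def inner_add_left exp_add [symmetric])
    then have "(wgt (z + v) x *\<^sub>R h x - wgt z x *\<^sub>R h x) - wgt z x *\<^sub>R (?t *\<^sub>R h x) = (wgt z x * (exp ?t - 1 - ?t)) *\<^sub>R h x"
      by (simp add: algebra_simps)
    then have "norm ((wgt (z + v) x *\<^sub>R h x - wgt z x *\<^sub>R h x) - wgt z x *\<^sub>R (?t *\<^sub>R h x))
        = wgt z x * (\<bar>exp ?t - 1 - ?t\<bar> * norm (h x))"
      using wgt_pos[of z x] by (simp add: abs_mult)
    also have "\<dots> \<le> wgt z x * (((norm v * norm x)\<^sup>2 * exp (norm x)) * norm (h x))"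
    proof (intro mult_left_mono mult_right_mono)
      have "\<bar>exp ?t - 1 - ?t\<bar> \<le> ?t\<^sup>2 * exp \<bar>?t\<bar>" by (rule exp_remainder_le)
      also have "\<dots> \<le> (norm v * norm x)\<^sup>2 * exp (norm x)"
        using t t1 by (intro mult_mono) (auto simp: abs_le_square_iff [symmetric])
      finally show "\<bar>exp ?t - 1 - ?t\<bar> \<le> (norm v * norm x)\<^sup>2 * exp (norm x)" .
    qed (use wgt_pos[of z x] in auto)
    also have "\<dots> = (norm v)\<^sup>2 * (wgt z x * ((norm x * norm x) * (exp (norm x) * norm (h x))))"
      by (simp add: power2_eq_square mult_ac)
    finally show "norm (wgt (z + v) x *\<^sub>R h x - wgt z x *\<^sub>R h x - wgt z x *\<^sub>R ?t *\<^sub>R h x)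
      \<le> (norm v)\<^sup>2 * (wgt z x * ((norm x * norm x) * (exp (norm x) * norm (h x))))" .
  qed (intro Bochner_Integration.integrable_diff int0 int1, rule integrable_mult_right, rule intK)
  also have "\<dots> = K * (norm v)\<^sup>2" by (simp add: K_def)
  finally show "norm ((?I (z + v)) - (?I z) - (?D v)) \<le> K * (norm v)\<^sup>2" .
qed

text \<open>
  The Laplace transform of the weighted measure; its logarithm generates the cumulants of the tilted measures.
\<close>

definition Z :: "real ^ 'n \<Rightarrow> real" where
  "Z z = (\<integral>x. wgt z x \<partial>\<mu>)"

definition tilted :: "real ^ 'n \<Rightarrow> (real ^ 'n) measure" where
  "tilted z = density \<mu> (\<lambda>x. ennreal (wgt z x / Z z))"

lemma integrable_wgt_1: "integrable \<mu> (wgt z)"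
  using integrable_wgt[OF exp_bounded_const[of "1::real"], of z] by simp

lemma Z_pos: "0 < Z z"
proof -
  have "Z z \<noteq> 0"
  proof
    assume "Z z = 0"
    then have "AE x in \<mu>. wgt z x = 0"
      using integral_nonneg_eq_0_iff_AE[OF integrable_wgt_1[of z]] wgt_pos by (simp add: Z_def less_imp_le)
    then have "AE x in \<mu>. False"
      by (rule eventually_mono) (use wgt_pos in \<open>auto simp: less_le\<close>)
    then show False by simp
  qed
  moreover have "0 \<le> Z z" unfolding Z_def by (intro integral_nonneg_AE AE_I2 less_imp_le wgt_pos)
  ultimately show ?thesis by simp
qed

lemma sets_tilted [measurable_cong, simp]: "sets (tilted z) = sets borel"
  by (simp add: tilted_def sets_base)

lemma integral_tilted:
  fixes h :: "real ^ 'n \<Rightarrow> 'b::euclidean_space"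
  assumes [measurable]: "h \<in> borel_measurable borel"
  shows "(\<integral>x. h x \<partial>tilted z) = (\<integral>x. wgt z x *\<^sub>R h x \<partial>\<mu>) /\<^sub>R Z z"
proof -
  have "(\<integral>x. h x \<partial>tilted z) = (\<integral>x. (wgt z x / Z z) *\<^sub>R h x \<partial>\<mu>)"
    unfolding tilted_def using Z_pos[of z] wgt_pos[of z]
    by (intro integral_density) (auto simp: less_imp_le)
  also have "\<dots> = (\<integral>x. inverse (Z z) *\<^sub>R (wgt z x *\<^sub>R h x) \<partial>\<mu>)"
    by (simp add: divide_inverse mult.commute)
  finally show ?thesis by (simp only: integral_scaleR_right)
qed

lemma integrable_tilted:
  fixes h :: "real ^ 'n \<Rightarrow> 'b::euclidean_space"
  assumes "exp_bounded h"
  shows "integrable (tilted z) h"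
proof -
  have [measurable]: "h \<in> borel_measurable borel" using assms by (simp add: exp_bounded_def)
  have "integrable \<mu> (\<lambda>x. inverse (Z z) *\<^sub>R (wgt z x *\<^sub>R h x))"
    by (intro integrable_scaleR_right integrable_wgt assms)
  then have "integrable \<mu> (\<lambda>x. (wgt z x / Z z) *\<^sub>R h x)"
    by (simp add: field_simps)
  then show ?thesis
    unfolding tilted_def using Z_pos[of z] wgt_pos[of z]
    by (subst integrable_density) (auto simp: less_imp_le)
qed

lemma prob_space_tilted: "prob_space (tilted z)"
proof
  have "emeasure (tilted z) (space (tilted z)) = (\<integral>\<^sup>+x. ennreal (wgt z x / Z z) \<partial>\<mu>)"
    by (simp add: tilted_def emeasure_density)
  also have "\<dots> = ennreal (\<integral>x. wgt z x / Z z \<partial>\<mu>)"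
    using Z_pos[of z] wgt_pos[of z] integrable_wgt_1[of z]
    by (intro nn_integral_eq_integral) (auto simp: less_imp_le)
  also have "(\<integral>x. wgt z x / Z z \<partial>\<mu>) = 1"
    using Z_pos[of z] by (simp add: Z_def)
  finally show "emeasure (tilted z) (space (tilted z)) = 1" by simp
qed

definition mean :: "real ^ 'n \<Rightarrow> real ^ 'n" where
  "mean z = (\<integral>x. x \<partial>tilted z)"

lemma integral_inner_tilted: "(\<integral>x. v \<bullet> x \<partial>tilted z) = v \<bullet> mean z"
  unfolding mean_def by (intro integral_inner_right integrable_tilted exp_bounded_id)

lemma exp_bounded_add:
  assumes "exp_bounded f" "exp_bounded h"
  shows "exp_bounded (\<lambda>x. f x + h x :: 'b::euclidean_space)"
proof -
  obtain C c D d where [measurable]: "f \<in> borel_measurable borel" "h \<in> borel_measurable borel"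
    and b: "\<And>x. norm (f x) \<le> C * exp (c * norm x)" "\<And>x. norm (h x) \<le> D * exp (d * norm x)"
    using assms by (auto simp: exp_bounded_def)
  have nonneg: "0 \<le> C" "0 \<le> D"
    using order_trans[OF norm_ge_zero b(1)[of 0]] order_trans[OF norm_ge_zero b(2)[of 0]] by simp_all
  have "norm (f x + h x) \<le> (C + D) * exp (max c d * norm x)" for x
  proof -
    have "norm (f x + h x) \<le> C * exp (c * norm x) + D * exp (d * norm x)"
      using b(1)[of x] b(2)[of x] norm_triangle_ineq[of "f x" "h x"] by linarith
    also have "\<dots> \<le> C * exp (max c d * norm x) + D * exp (max c d * norm x)"
      using nonneg by (intro add_mono mult_left_mono) (auto intro!: mult_right_mono)
    finally show ?thesis by (simp add: distrib_right)
  qed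
  then show ?thesis unfolding exp_bounded_def by (intro conjI exI[of _ "C + D"] exI[of _ "max c d"] allI) simp_all
qed

lemma exp_bounded_nth: "exp_bounded (\<lambda>x. x $ i)"
  using exp_bounded_inner[of "axis i 1"] by (simp add: inner_axis')

lemma cov_matrix_tilted_mult:
  "(cov_matrix (tilted z) *v v) $ i = (\<integral>x. (x $ i - mean z $ i) * (v \<bullet> (x - mean z)) \<partial>tilted z)"
proof -
  have centred: "exp_bounded (\<lambda>x. x $ j - mean z $ j)" for j
    using exp_bounded_add[OF exp_bounded_nth[of j] exp_bounded_const[of "- (mean z $ j)"]] by simp
  have int: "integrable (tilted z) (\<lambda>x. ((x $ i - mean z $ i) * (x $ j - mean z $ j)) * v $ j)" for j
    using integrable_tilted[OF exp_bounded_scaleR[OF centred[of i] centred[of j]], of z] by simp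
  have "(cov_matrix (tilted z) *v v) $ i
      = (\<Sum>j\<in>UNIV. (\<integral>x. ((x $ i - mean z $ i) * (x $ j - mean z $ j)) * v $ j \<partial>tilted z))"
    by (simp add: matrix_vector_mult_def cov_matrix_def mean_def [symmetric])
  also have "\<dots> = (\<integral>x. (\<Sum>j\<in>UNIV. ((x $ i - mean z $ i) * (x $ j - mean z $ j)) * v $ j) \<partial>tilted z)"
    by (rule Bochner_Integration.integral_sum [symmetric]) (rule int)
  also have "\<dots> = (\<integral>x. (x $ i - mean z $ i) * (v \<bullet> (x - mean z)) \<partial>tilted z)"
    by (intro Bochner_Integration.integral_cong refl)
       (simp add: inner_vec_def sum_distrib_left mult_ac)
  finally show ?thesis .
qed

text \<open>
  \<open>cov v = E[(v \<bullet> x) x] - (v \<bullet> E x) E x\<close>, the form in which the covariance comes out of the quotient rule below.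
\<close>

lemma cov_matrix_tilted_mult':
  "cov_matrix (tilted z) *v v = (\<integral>x. (v \<bullet> x) *\<^sub>R x \<partial>tilted z) - (v \<bullet> mean z) *\<^sub>R mean z"
proof -
  interpret t: prob_space "tilted z" by (rule prob_space_tilted)
  have intx: "integrable (tilted z) (\<lambda>x. x $ i)" for i by (rule integrable_tilted[OF exp_bounded_nth])
  have intv: "integrable (tilted z) (\<lambda>x. v \<bullet> x)" by (rule integrable_tilted[OF exp_bounded_inner])
  have intvv: "integrable (tilted z) (\<lambda>x. (v \<bullet> x) *\<^sub>R x)"
    by (intro integrable_tilted exp_bounded_scaleR exp_bounded_inner exp_bounded_id)
  have nth: "(\<integral>x. f x \<partial>tilted z) $ i = (\<integral>x. f x $ i \<partial>tilted z)" if "integrable (tilted z) f" for f :: "_ \<Rightarrow> real ^ 'n" and i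
    using integral_inner_right[OF that, of "axis i 1"] by (simp add: inner_axis')
  have intvi: "integrable (tilted z) (\<lambda>x. (v \<bullet> x) * x $ i)" for i
    using integrable_tilted[OF exp_bounded_scaleR[OF exp_bounded_inner exp_bounded_nth]] by simp
  show ?thesis
  proof (intro vec_eq_iff[THEN iffD2] allI)
    fix i
    have mi: "(\<integral>x. x $ i \<partial>tilted z) = mean z $ i"
      unfolding mean_def by (rule nth [symmetric]) (rule integrable_tilted[OF exp_bounded_id])
    have "(cov_matrix (tilted z) *v v) $ i
      = (\<integral>x. ((v \<bullet> x) * x $ i - (v \<bullet> mean z) * x $ i) - (mean z $ i * (v \<bullet> x) - mean z $ i * (v \<bullet> mean z)) \<partial>tilted z)"
      unfolding cov_matrix_tilted_mult
      by (intro Bochner_Integration.integral_cong refl) (simp add: algebra_simps inner_diff_right)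
    also have "\<dots> = ((\<integral>x. (v \<bullet> x) * x $ i \<partial>tilted z) - (v \<bullet> mean z) * mean z $ i) - (mean z $ i * (v \<bullet> mean z) - mean z $ i * (v \<bullet> mean z))"
      using intx intv intvi
      by (simp add: Bochner_Integration.integral_diff mi integral_inner_tilted t.prob_space)
    also have "\<dots> = ((\<integral>x. (v \<bullet> x) *\<^sub>R x \<partial>tilted z) - (v \<bullet> mean z) *\<^sub>R mean z) $ i"
      by (simp add: nth[OF intvv])
    finally show "(cov_matrix (tilted z) *v v) $ i = ((\<integral>x. (v \<bullet> x) *\<^sub>R x \<partial>tilted z) - (v \<bullet> mean z) *\<^sub>R mean z) $ i" .
  qed
qed

text \<open>
The quadratic form is the variance of \<open>v \<bullet> x\<close>.
\<close>

lemma cov_matrix_tilted_nonneg: "0 \<le> v \<bullet> (cov_matrix (tilted z) *v v)"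
proof -
  have centred: "exp_bounded (\<lambda>x. x $ j - mean z $ j)" for j
    using exp_bounded_add[OF exp_bounded_nth[of j] exp_bounded_const[of "- (mean z $ j)"]] by simp
  have "exp_bounded (\<lambda>x. v \<bullet> (x - mean z))"
    using exp_bounded_add[OF exp_bounded_inner[of v] exp_bounded_const[of "- (v \<bullet> mean z)"]]
    by (simp add: inner_diff_right)
  then have int: "integrable (tilted z) (\<lambda>x. (x $ i - mean z $ i) * (v \<bullet> (x - mean z)))" for i
    using integrable_tilted[OF exp_bounded_scaleR[OF centred[of i]], of "\<lambda>x. v \<bullet> (x - mean z)" z] by simp
  have "v \<bullet> (cov_matrix (tilted z) *v v)
      = (\<Sum>i\<in>UNIV. (\<integral>x. v $ i * ((x $ i - mean z $ i) * (v \<bullet> (x - mean z))) \<partial>tilted z))"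
    by (simp add: inner_vec_def [of v "cov_matrix (tilted z) *v v"] cov_matrix_tilted_mult)
  also have "\<dots> = (\<integral>x. (\<Sum>i\<in>UNIV. v $ i * ((x $ i - mean z $ i) * (v \<bullet> (x - mean z)))) \<partial>tilted z)"
    by (rule Bochner_Integration.integral_sum [symmetric]) (intro integrable_mult_right int)
  also have "\<dots> = (\<integral>x. (v \<bullet> (x - mean z))\<^sup>2 \<partial>tilted z)"
    by (intro Bochner_Integration.integral_cong refl)
       (simp add: inner_vec_def power2_eq_square sum_distrib_right mult_ac)
  finally show ?thesis by simp
qed

lemma has_derivative_Z: "(Z has_derivative (\<lambda>v. Z z * (v \<bullet> mean z))) (at z)"
proof -
  have "((\<lambda>z. \<integral>x. wgt z x *\<^sub>R (1 :: real) \<partial>\<mu>) has_derivative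
      (\<lambda>v. \<integral>x. wgt z x *\<^sub>R ((v \<bullet> x) *\<^sub>R 1) \<partial>\<mu>)) (at z)"
    by (rule has_derivative_integral_wgt[OF exp_bounded_const])
  moreover have "(\<integral>x. wgt z x *\<^sub>R ((v \<bullet> x) *\<^sub>R 1) \<partial>\<mu>) = Z z * (v \<bullet> mean z)" for v
    using integral_tilted[of "\<lambda>x. v \<bullet> x" z] Z_pos[of z]
    by (simp add: integral_inner_tilted field_simps)
  ultimately show ?thesis by (simp add: Z_def [abs_def])
qed

lemma has_derivative_ln_Z: "((\<lambda>z. ln (Z z)) has_derivative (\<lambda>v. v \<bullet> mean z)) (at z)"
proof -
  have "Z z * (v \<bullet> mean z) * inverse (Z z) = v \<bullet> mean z" for v
    using Z_pos[of z] by (simp add: field_simps)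
  with has_derivative_ln[OF Z_pos[of z] has_derivative_Z[of z]] show ?thesis by simp
qed

lemma has_derivative_mean: "(mean has_derivative (\<lambda>v. cov_matrix (tilted z) *v v)) (at z)"
proof -
  define I where "I z = (\<integral>x. wgt z x *\<^sub>R x \<partial>\<mu>)" for z
  have mean_eq: "mean z = inverse (Z z) *\<^sub>R I z" for z
    by (simp add: mean_def integral_tilted I_def)
  have "(I has_derivative (\<lambda>v. \<integral>x. wgt z x *\<^sub>R ((v \<bullet> x) *\<^sub>R x) \<partial>\<mu>)) (at z)"
    unfolding I_def [abs_def] by (rule has_derivative_integral_wgt[OF exp_bounded_id])
  moreover have "((\<lambda>z. inverse (Z z)) has_derivative (\<lambda>v. - (inverse (Z z) * (Z z * (v \<bullet> mean z)) * inverse (Z z)))) (at z)"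
    using Z_pos[of z] by (intro Deriv.has_derivative_inverse has_derivative_Z) simp
  ultimately have "((\<lambda>z. inverse (Z z) *\<^sub>R I z) has_derivative
      (\<lambda>v. inverse (Z z) *\<^sub>R (\<integral>x. wgt z x *\<^sub>R ((v \<bullet> x) *\<^sub>R x) \<partial>\<mu>)
         + (- (inverse (Z z) * (Z z * (v \<bullet> mean z)) * inverse (Z z))) *\<^sub>R I z)) (at z)"
    by (intro has_derivative_scaleR)
  moreover have "inverse (Z z) *\<^sub>R (\<integral>x. wgt z x *\<^sub>R ((v \<bullet> x) *\<^sub>R x) \<partial>\<mu>)
         + (- (inverse (Z z) * (Z z * (v \<bullet> mean z)) * inverse (Z z))) *\<^sub>R I z
      = cov_matrix (tilted z) *v v" for v
    unfolding cov_matrix_tilted_mult' using Z_pos[of z]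
    by (simp add: integral_tilted mean_eq)
  ultimately show ?thesis
    unfolding mean_eq [abs_def] by simp
qed

end

section \<open>Uniqueness of continuous densities and conditional laws\<close>

text \<open>
  The set where two continuous functions differ is open, and a nonempty open set is not a null set.  This is what
  makes pointwise statements about densities and conditional laws meaningful.
\<close>

lemma AE_lborel_continuous_imp_eq:
  fixes f g :: "'b::euclidean_space \<Rightarrow> 'c::real_normed_vector"
  assumes "continuous_on UNIV f" "continuous_on UNIV g" "AE x in lborel. f x = g x"
  shows "f = g"
proof (rule ccontr)
  assume "f \<noteq> g"
  define U where "U = {x. f x \<noteq> g x}"
  have U: "open U" "U \<noteq> {}"
    using \<open>f \<noteq> g\<close> open_Collect_neq[OF assms(1,2)] by (auto simp: U_def)
  have "U \<in> null_sets lborel"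
    using assms(3) U(1) by (simp add: AE_iff_null U_def borel_open)
  then have "negligible U"
    by (simp add: negligible_iff_null_sets null_sets_completionI)
  with U open_not_negligible show False by blast
qed

text \<open>
  The indicator of an open set \<open>U\<close> is the limit of the functions \<open>min 1 (n dist (x, - U))\<close>, and the open sets generate
  the Borel sets.
\<close>

lemma measure_eqI_bounded_continuous:
  fixes \<mu> \<nu> :: "'b::metric_space measure"
  assumes "prob_space \<mu>" "prob_space \<nu>" and sets: "sets \<mu> = sets borel" "sets \<nu> = sets borel"
    and eq: "\<And>f :: 'b \<Rightarrow> real. continuous_on UNIV f \<Longrightarrow> bounded (range f) \<Longrightarrow> (\<And>x. 0 \<le> f x) \<Longrightarrow>
      (\<integral>x. f x \<partial>\<mu>) = (\<integral>x. f x \<partial>\<nu>)"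
  shows "\<mu> = \<nu>"
proof -
  interpret \<mu>: prob_space \<mu> by fact
  interpret \<nu>: prob_space \<nu> by fact
  have opens: "measure \<mu> U = measure \<nu> U" if "open U" "U \<noteq> UNIV" for U
  proof -
    \<comment> \<open>the complement of \<open>U\<close> must be nonempty here, as the distance to the empty set is \<open>0\<close>\<close>
    define f where "f n x = min 1 (real n * infdist x (- U))" for n :: nat and x
    have f0: "0 \<le> f n x" and f1: "f n x \<le> 1" for n x by (simp_all add: f_def infdist_nonneg)
    have cont: "continuous_on UNIV (f n)" for n
      unfolding f_def by (intro continuous_intros)
    have bdd: "bounded (range (f n))" for n
      unfolding bounded_iff using f0 f1 by (intro exI[of _ 1]) auto
    have lim: "(\<lambda>n. f n x) \<longlonglongrightarrow> indicator U x" for x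
    proof (cases "x \<in> U")
      case True
      have pos: "0 < infdist x (- U)"
        using that True by (intro infdist_pos_not_in_closed) (auto simp: closed_Compl)
      obtain N where N: "1 / infdist x (- U) < real N" using reals_Archimedean2 by blast
      have "f n x = 1" if "N \<le> n" for n
      proof -
        have "1 / infdist x (- U) < real n" using N that by linarith
        then show ?thesis using pos by (simp add: f_def divide_less_eq)
      qed
      then show ?thesis using True
        by (intro tendsto_eventually) (auto simp: eventually_sequentially)
    next
      case False
      then show ?thesis by (simp add: f_def)
    qed
    have conv: "(\<lambda>n. \<integral>x. f n x \<partial>\<kappa>) \<longlonglongrightarrow> measure \<kappa> U"
      if "prob_space \<kappa>" and s: "sets \<kappa> = sets borel" for \<kappa> :: "'b measure"
    proof -
      interpret \<kappa>: prob_space \<kappa> by fact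
      have [measurable]: "f n \<in> borel_measurable \<kappa>" for n
        unfolding measurable_cong_sets[OF s refl] by (rule borel_measurable_continuous_onI[OF cont])
      have [measurable]: "U \<in> sets \<kappa>" using \<open>open U\<close> s by simp
      have "(\<lambda>n. \<integral>x. f n x \<partial>\<kappa>) \<longlonglongrightarrow> (\<integral>x. indicator U x \<partial>\<kappa>)"
        by (rule integral_dominated_convergence[where w = "\<lambda>_. 1"]) (use lim f0 f1 in auto)
      then show ?thesis by simp
    qed
    have "(\<lambda>n. \<integral>x. f n x \<partial>\<mu>) = (\<lambda>n. \<integral>x. f n x \<partial>\<nu>)"
      using eq[OF cont bdd f0] by simp
    with conv[OF assms(1) sets(1)] conv[OF assms(2) sets(2)] show ?thesis
      using LIMSEQ_unique by metis
  qed
  have "space \<mu> = UNIV" "space \<nu> = UNIV" using sets by (metis sets_eq_imp_space_eq space_borel)+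
  then have total: "emeasure \<mu> UNIV = 1" "emeasure \<nu> UNIV = 1"
    using \<mu>.emeasure_space_1 \<nu>.emeasure_space_1 by auto
  show ?thesis
  proof (rule measure_eqI_generator_eq[where E = "{U. open U}" and \<Omega> = UNIV and A = "\<lambda>_. UNIV"])
    show "Int_stable {U :: 'b set. open U}" by (auto simp: Int_stable_def)
    show "sets \<mu> = sigma_sets UNIV {U. open U}" "sets \<nu> = sigma_sets UNIV {U. open U}"
      by (simp_all add: sets borel_def)
    fix U :: "'b set" assume "U \<in> {U. open U}"
    then show "emeasure \<mu> U = emeasure \<nu> U"
      using opens[of U] total by (cases "U = UNIV") (auto simp: \<mu>.emeasure_eq_measure \<nu>.emeasure_eq_measure)
  qed (auto simp: total)
qed

context prob_space
begin

lemma pdf_eqI: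
  assumes "is_pdf M Y p"
  shows "pdf M Y = p"
  unfolding pdf_def
proof (rule the_equality)
  fix q assume "is_pdf M Y q"
  with assms have "AE y in lborel. ennreal (q y) = ennreal (p y)"
    by (intro distributed_unique) (auto simp: is_pdf_def)
  then have "AE y in lborel. q y = p y"
    by (rule eventually_mono) (use assms \<open>is_pdf M Y q\<close> in \<open>auto simp: is_pdf_def\<close>)
  then show "q = p"
    using assms \<open>is_pdf M Y q\<close> by (intro AE_lborel_continuous_imp_eq) (auto simp: is_pdf_def)
qed fact

lemma is_cond_law_nn_integral:
  assumes \<kappa>: "is_cond_law M X Y \<kappa>"
    and [measurable]: "X \<in> borel_measurable M" "Y \<in> borel_measurable M" "A \<in> sets borel"
    and f: "f \<in> borel_measurable borel"
  shows "(\<integral>\<^sup>+\<omega>. indicator A (Y \<omega>) * f (X \<omega>) \<partial>M)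
    = (\<integral>\<^sup>+\<omega>. indicator A (Y \<omega>) * (\<integral>\<^sup>+x. f x \<partial>\<kappa> (Y \<omega>)) \<partial>M)"
  using f
proof (induction rule: borel_measurable_induct)
  have [measurable]: "\<kappa> \<in> borel \<rightarrow>\<^sub>M subprob_algebra borel"
    using \<kappa> by (auto simp: is_cond_law_def intro: measurable_prob_algebraD)
  have sets: "sets (\<kappa> y) = sets borel" for y
    using sets_kernel[OF \<open>\<kappa> \<in> borel \<rightarrow>\<^sub>M subprob_algebra borel\<close>, of y] by simp
  note [measurable_cong] = sets
  {
    case (cong f g) then show ?case by (simp add: space_borel)
  next
    case (set C)
    note [measurable] = set
    have "(\<integral>\<^sup>+\<omega>. indicator A (Y \<omega>) * indicator C (X \<omega>) \<partial>M) = (\<integral>\<^sup>+\<omega>. indicator {\<omega> \<in> space M. Y \<omega> \<in> A \<and> X \<omega> \<in> C} \<omega> \<partial>M)"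
      by (intro nn_integral_cong) (auto split: split_indicator)
    also have "\<dots> = emeasure M {\<omega> \<in> space M. Y \<omega> \<in> A \<and> X \<omega> \<in> C}"
      using set by (intro nn_integral_indicator) measurable
    also have "\<dots> = (\<integral>\<^sup>+\<omega>. indicator A (Y \<omega>) * emeasure (\<kappa> (Y \<omega>)) C \<partial>M)"
      using \<kappa> set by (auto simp: is_cond_law_def)
    finally show ?case using set sets by (simp add: nn_integral_indicator)
  next
    case (mult u c)
    note [measurable] = mult(2)
    have "(\<integral>\<^sup>+\<omega>. indicator A (Y \<omega>) * (c * u (X \<omega>)) \<partial>M) = c * (\<integral>\<^sup>+\<omega>. indicator A (Y \<omega>) * u (X \<omega>) \<partial>M)"
      by (subst nn_integral_cmult [symmetric]) (auto simp: mult_ac)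
    also have "\<dots> = (\<integral>\<^sup>+\<omega>. c * (indicator A (Y \<omega>) * (\<integral>\<^sup>+x. u x \<partial>\<kappa> (Y \<omega>))) \<partial>M)"
      unfolding mult by (subst nn_integral_cmult) auto
    finally show ?case by (simp add: nn_integral_cmult mult_ac)
  next
    case (add u v)
    note [measurable] = add.hyps(1,3)
    have "(\<integral>\<^sup>+\<omega>. indicator A (Y \<omega>) * (v (X \<omega>) + u (X \<omega>)) \<partial>M)
      = (\<integral>\<^sup>+\<omega>. indicator A (Y \<omega>) * v (X \<omega>) \<partial>M) + (\<integral>\<^sup>+\<omega>. indicator A (Y \<omega>) * u (X \<omega>) \<partial>M)"
      by (subst nn_integral_add [symmetric]) (auto simp: distrib_left)
    also have "\<dots> = (\<integral>\<^sup>+\<omega>. indicator A (Y \<omega>) * (\<integral>\<^sup>+x. v x \<partial>\<kappa> (Y \<omega>)) + indicator A (Y \<omega>) * (\<integral>\<^sup>+x. u x \<partial>\<kappa> (Y \<omega>)) \<partial>M)"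
      unfolding add by (subst nn_integral_add) auto
    finally show ?case by (simp add: nn_integral_add distrib_left)
  next
    case (seq U)
    note [measurable] = seq(1)
    have U: "incseq (\<lambda>i x. c * U i (g x))" for c and g :: "'z \<Rightarrow> 'b"
      using seq(3) by (auto simp: incseq_def le_fun_def intro: mult_left_mono)
    have "(\<integral>\<^sup>+\<omega>. indicator A (Y \<omega>) * (SUP i. U i) (X \<omega>) \<partial>M) = (SUP i. \<integral>\<^sup>+\<omega>. indicator A (Y \<omega>) * U i (X \<omega>) \<partial>M)"
      by (subst nn_integral_monotone_convergence_SUP [symmetric])
         (use seq(3) in \<open>auto simp: SUP_mult_left_ennreal incseq_def le_fun_def image_comp intro: mult_left_mono\<close>)
    also have "\<dots> = (SUP i. \<integral>\<^sup>+\<omega>. indicator A (Y \<omega>) * (\<integral>\<^sup>+x. U i x \<partial>\<kappa> (Y \<omega>)) \<partial>M)"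
      using seq.IH by simp
    also have "\<dots> = (\<integral>\<^sup>+\<omega>. indicator A (Y \<omega>) * (\<integral>\<^sup>+x. (SUP i. U i) x \<partial>\<kappa> (Y \<omega>)) \<partial>M)"
    proof (subst nn_integral_monotone_convergence_SUP [symmetric])
      show "incseq (\<lambda>i \<omega>. indicator A (Y \<omega>) * (\<integral>\<^sup>+x. U i x \<partial>\<kappa> (Y \<omega>)))"
        using seq(3) by (auto simp: incseq_def le_fun_def intro!: mult_left_mono nn_integral_mono)
      have "(\<integral>\<^sup>+x. (SUP i. U i) x \<partial>\<kappa> y) = (SUP i. \<integral>\<^sup>+x. U i x \<partial>\<kappa> y)" for y
        using seq(3) by (simp add: image_comp nn_integral_monotone_convergence_SUP)
      then show "(\<integral>\<^sup>+\<omega>. (SUP i. indicator A (Y \<omega>) * (\<integral>\<^sup>+x. U i x \<partial>\<kappa> (Y \<omega>))) \<partial>M) =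
        (\<integral>\<^sup>+\<omega>. indicator A (Y \<omega>) * (\<integral>\<^sup>+x. (SUP i. U i) x \<partial>\<kappa> (Y \<omega>)) \<partial>M)"
        by (simp add: SUP_mult_left_ennreal)
    qed measurable
    finally show ?case by (simp add: image_comp)
  }
qed

text \<open>
  Two conditional laws give the same integral of a fixed bounded continuous function for almost every \<open>y\<close> with respect to
  the law of \<open>Y\<close>, hence, the density of \<open>Y\<close> being positive, for Lebesgue-almost every \<open>y\<close>.  By weak continuity there
  is no exceptional \<open>y\<close>, so that the exceptional null sets of the different test functions need not be united.
\<close>

lemma cond_law_eqI:
  fixes Y :: "'a \<Rightarrow> 'b::euclidean_space"
  assumes \<kappa>: "is_cond_law M X Y \<kappa>"
    and X [measurable]: "X \<in> borel_measurable M"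
    and p: "distributed M lborel Y (\<lambda>y. ennreal (p y))" and p_pos: "\<And>y. 0 < p y"
  shows "cond_law M X Y = \<kappa>"
  unfolding cond_law_def
proof (rule the_equality)
  fix \<kappa>' assume \<kappa>': "is_cond_law M X Y \<kappa>'"
  have Y [measurable]: "Y \<in> borel_measurable M" using distributed_measurable[OF p] by simp
  have pm [measurable]: "(\<lambda>y. ennreal (p y)) \<in> borel_measurable borel"
    using distributed_borel_measurable[OF p] by simp
  interpret D: prob_space "distr M borel Y" by (rule prob_space_distr) simp
  have D: "distr M borel Y = density lborel (\<lambda>y. ennreal (p y))"
    using distributed_distr_eq_density[OF p] by (simp cong: distr_cong)
  have kernel: "prob_space (k y)" "sets (k y) = sets borel" if "is_cond_law M X Y k" for k y
    using that measurable_space[of k borel "prob_algebra borel" y]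
    by (auto simp: is_cond_law_def space_prob_algebra)
  have kmeas: "k \<in> borel \<rightarrow>\<^sub>M subprob_algebra borel" if "is_cond_law M X Y k" for k
    using that by (auto simp: is_cond_law_def intro: measurable_prob_algebraD)
  note [measurable] = kmeas[OF \<kappa>] kmeas[OF \<kappa>']
  have "\<kappa>' y = \<kappa> y" for y
  proof (rule measure_eqI_bounded_continuous)
    fix f :: "'b \<Rightarrow> real"
    assume f: "continuous_on UNIV f" "bounded (range f)" and f0: "\<And>x. 0 \<le> f x"
    obtain C where C: "\<And>x. f x \<le> C"
      using f(2) by (auto simp: bounded_iff abs_le_iff)
    have [measurable]: "f \<in> borel_measurable borel" using f(1) by (rule borel_measurable_continuous_onI)
    have int: "integrable (k y) f" if "is_cond_law M X Y k" for k y
    proof -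
      interpret k: prob_space "k y" by (rule kernel[OF that])
      show ?thesis
        using f0 C by (intro k.integrable_const_bound[of _ C]) (auto simp: measurable_cong_sets[OF kernel(2)[OF that] refl])
    qed
    have "AE y in distr M borel Y. (\<integral>\<^sup>+x. f x \<partial>\<kappa>' y) = (\<integral>\<^sup>+x. f x \<partial>\<kappa> y)"
    proof (rule D.density_unique_finite_measure)
      fix A assume "A \<in> sets (distr M borel Y)"
      then have [measurable]: "A \<in> sets borel" by simp
      have "(\<integral>\<^sup>+y. (\<integral>\<^sup>+x. f x \<partial>k y) * indicator A y \<partial>distr M borel Y) = (\<integral>\<^sup>+\<omega>. indicator A (Y \<omega>) * ennreal (f (X \<omega>)) \<partial>M)"
        if k: "is_cond_law M X Y k" for k
      proof -
        note [measurable] = kmeas[OF k]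
        show ?thesis
          by (subst is_cond_law_nn_integral[OF k X Y]) (simp_all add: nn_integral_distr mult.commute)
      qed
      from this[OF \<kappa>] this[OF \<kappa>']
      show "(\<integral>\<^sup>+y. (\<integral>\<^sup>+x. f x \<partial>\<kappa>' y) * indicator A y \<partial>distr M borel Y) = (\<integral>\<^sup>+y. (\<integral>\<^sup>+x. f x \<partial>\<kappa> y) * indicator A y \<partial>distr M borel Y)"
        by simp
    qed simp_all
    then have "AE y in lborel. (\<integral>\<^sup>+x. f x \<partial>\<kappa>' y) = (\<integral>\<^sup>+x. f x \<partial>\<kappa> y)"
      unfolding D using p_pos by (subst (asm) AE_density) auto
    then have "AE y in lborel. (\<integral>x. f x \<partial>\<kappa>' y) = (\<integral>x. f x \<partial>\<kappa> y)"
      by (rule eventually_mono)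
         (simp add: nn_integral_eq_integral int \<kappa> \<kappa>' f0)
    then have "(\<lambda>y. \<integral>x. f x \<partial>\<kappa>' y) = (\<lambda>y. \<integral>x. f x \<partial>\<kappa> y)"
      using \<kappa> \<kappa>' f by (intro AE_lborel_continuous_imp_eq) (auto simp: is_cond_law_def)
    then show "(\<integral>x. f x \<partial>\<kappa>' y) = (\<integral>x. f x \<partial>\<kappa> y)" by (rule fun_cong)
  qed (use kernel \<kappa> \<kappa>' in auto)
  then show "\<kappa>' = \<kappa>" by auto
qed fact

end

section \<open>The Gaussian channel\<close>

lemma continuous_on_integral_bounded:
  fixes F :: "'a::metric_space \<Rightarrow> 'x \<Rightarrow> real"
  assumes "finite_measure \<mu>"
    and meas [measurable]: "\<And>y. F y \<in> borel_measurable \<mu>"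
    and cont: "\<And>x. continuous_on UNIV (\<lambda>y. F y x)"
    and bound: "\<And>y x. \<bar>F y x\<bar> \<le> C"
  shows "continuous_on UNIV (\<lambda>y. \<integral>x. F y x \<partial>\<mu>)"
proof (rule continuous_on_sequentiallyI)
  interpret finite_measure \<mu> by fact
  fix u :: "nat \<Rightarrow> 'a" and l
  assume u: "u \<longlonglongrightarrow> l"
  show "(\<lambda>n. \<integral>x. F (u n) x \<partial>\<mu>) \<longlonglongrightarrow> (\<integral>x. F l x \<partial>\<mu>)"
  proof (rule integral_dominated_convergence[where w = "\<lambda>_. C"])
    show "AE x in \<mu>. (\<lambda>n. F (u n) x) \<longlonglongrightarrow> F l x"
      using continuous_on_tendsto_compose[OF cont u] by auto
  qed (use bound in auto)
qed

text \<open>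
  The channel maps an input \<open>x\<close> of law \<open>\<mu>\<close> to \<open>\<alpha> x + \<sigma> G\<close> with standard Gaussian noise \<open>G\<close>.  As a function of \<open>x\<close>, the likelihood of an output \<open>y\<close> is
  an exponential tilt with parameter \<open>(\<alpha> / \<sigma>\<^sup>2) y\<close> and Gaussian weight \<open>\<beta> = \<alpha>\<^sup>2 / (2 \<sigma>\<^sup>2)\<close>.
\<close>

locale gaussian_channel = prob_space \<mu> for \<mu> :: "(real ^ 'n) measure" +
  fixes \<alpha> \<sigma> :: real
  assumes sets_input [measurable_cong]: "sets \<mu> = sets borel" and \<alpha>: "\<alpha> \<noteq> 0" and \<sigma>: "0 < \<sigma>"

sublocale gaussian_channel \<subseteq> gaussian_weighted \<mu> "\<alpha>\<^sup>2 / (2 * \<sigma>\<^sup>2)"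
  using \<alpha> \<sigma> by unfold_locales (auto simp: sets_input)

context gaussian_channel
begin

definition out_density :: "real ^ 'n \<Rightarrow> real" where
  "out_density y = (\<integral>x. gaussian_density \<sigma> (y - \<alpha> *\<^sub>R x) \<partial>\<mu>)"

definition posterior :: "real ^ 'n \<Rightarrow> (real ^ 'n) measure" where
  "posterior y = tilted ((\<alpha> / \<sigma>\<^sup>2) *\<^sub>R y)"

definition out_score :: "real ^ 'n \<Rightarrow> real ^ 'n" where
  "out_score y = (\<alpha> / \<sigma>\<^sup>2) *\<^sub>R mean ((\<alpha> / \<sigma>\<^sup>2) *\<^sub>R y) - (1 / \<sigma>\<^sup>2) *\<^sub>R y"

definition out_hessian :: "real ^ 'n \<Rightarrow> real ^ 'n ^ 'n" where
  "out_hessian y = (\<alpha> / \<sigma>\<^sup>2)\<^sup>2 *\<^sub>R cov_matrix (posterior y) - (1 / \<sigma>\<^sup>2) *\<^sub>R mat 1"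

definition norm_const :: real where
  "norm_const = (1 / sqrt (2 * pi * \<sigma>\<^sup>2)) ^ CARD('n)"

lemma norm_const_pos: "0 < norm_const"
  using \<sigma> by (simp add: norm_const_def)

lemma gaussian_density_channel:
  "gaussian_density \<sigma> (y - \<alpha> *\<^sub>R x) =
     norm_const * exp (- ((norm y)\<^sup>2 / (2 * \<sigma>\<^sup>2))) * wgt ((\<alpha> / \<sigma>\<^sup>2) *\<^sub>R y) x"
proof -
  have "- ((norm (y - \<alpha> *\<^sub>R x))\<^sup>2 / (2 * \<sigma>\<^sup>2)) =
      - ((norm y)\<^sup>2 / (2 * \<sigma>\<^sup>2)) + ((\<alpha> / \<sigma>\<^sup>2) *\<^sub>R y \<bullet> x - \<alpha>\<^sup>2 / (2 * \<sigma>\<^sup>2) * (norm x)\<^sup>2)"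
    using \<sigma> unfolding power2_norm_eq_inner
    by (simp add: inner_diff_left inner_diff_right inner_commute field_simps power2_eq_square)
  then show ?thesis
    by (simp add: gaussian_density_eq_exp norm_const_def wgt_def exp_add [symmetric])
qed

lemma out_density_eq:
  "out_density y = norm_const * exp (- ((norm y)\<^sup>2 / (2 * \<sigma>\<^sup>2))) * Z ((\<alpha> / \<sigma>\<^sup>2) *\<^sub>R y)"
  unfolding out_density_def gaussian_density_channel Z_def by simp

lemma out_density_pos: "0 < out_density y"
  using norm_const_pos Z_pos by (simp add: out_density_eq)

lemma nn_integral_out_density:
  "(\<integral>\<^sup>+x. ennreal (gaussian_density \<sigma> (y - \<alpha> *\<^sub>R x)) \<partial>\<mu>) = ennreal (out_density y)"
  unfolding out_density_def
proof (rule nn_integral_eq_integral)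
  show "integrable \<mu> (\<lambda>x. gaussian_density \<sigma> (y - \<alpha> *\<^sub>R x))"
    unfolding gaussian_density_channel by (intro integrable_mult_right integrable_wgt_1)
qed (simp add: gaussian_density_nonneg)

lemma continuous_out_density: "continuous_on UNIV out_density"
  unfolding out_density_def [abs_def]
proof (rule continuous_on_integral_bounded)
  show "\<bar>gaussian_density \<sigma> (y - \<alpha> *\<^sub>R x)\<bar> \<le> (1 / sqrt (2 * pi * \<sigma>\<^sup>2)) ^ CARD('n)" for y x :: "real ^ 'n"
    by (simp add: gaussian_density_nonneg gaussian_density_le del: power_divide)
qed (auto intro!: continuous_intros finite_measure_axioms)

text \<open>
  Tweedie's formula: up to the Gaussian factor \<open>exp (- |y|\<^sup>2 / (2 \<sigma>\<^sup>2))\<close> the density is a Laplace transform at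
  \<open>(\<alpha> / \<sigma>\<^sup>2) y\<close>, whose logarithmic gradient is the posterior mean.  The Hessian then contains the
  derivative of the posterior mean, which is the posterior covariance.
\<close>

lemma GDERIV_ln_out_density: "GDERIV (\<lambda>y. ln (out_density y)) y :> out_score y"
proof -
  have "((\<lambda>y. ln norm_const - (norm y)\<^sup>2 / (2 * \<sigma>\<^sup>2) + ln (Z ((\<alpha> / \<sigma>\<^sup>2) *\<^sub>R y))) has_derivative
      (\<lambda>v. 0 - (y \<bullet> v + v \<bullet> y) / (2 * \<sigma>\<^sup>2) + ((\<alpha> / \<sigma>\<^sup>2) *\<^sub>R v) \<bullet> mean ((\<alpha> / \<sigma>\<^sup>2) *\<^sub>R y))) (at y)"
    unfolding power2_norm_eq_inner
    by (intro has_derivative_add has_derivative_diff has_derivative_const bounded_linear.has_derivative[OF bounded_linear_divide]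
        has_derivative_inner has_derivative_ident
        has_derivative_compose[where f = "\<lambda>y. (\<alpha> / \<sigma>\<^sup>2) *\<^sub>R y", OF _ has_derivative_ln_Z]
        has_derivative_scaleR_right)
  moreover have "(\<lambda>y. ln norm_const - (norm y)\<^sup>2 / (2 * \<sigma>\<^sup>2) + ln (Z ((\<alpha> / \<sigma>\<^sup>2) *\<^sub>R y))) = (\<lambda>y. ln (out_density y))"
    using norm_const_pos Z_pos[THEN less_imp_neq] by (simp add: fun_eq_iff out_density_eq ln_mult)
  moreover have "(\<lambda>v. 0 - (y \<bullet> v + v \<bullet> y) / (2 * \<sigma>\<^sup>2) + ((\<alpha> / \<sigma>\<^sup>2) *\<^sub>R v) \<bullet> mean ((\<alpha> / \<sigma>\<^sup>2) *\<^sub>R y)) = (\<lambda>v. v \<bullet> out_score y)"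
    using \<sigma> by (simp add: fun_eq_iff out_score_def inner_diff_right inner_commute field_simps)
  ultimately show ?thesis unfolding gderiv_def by simp
qed

lemma has_derivative_out_score: "(out_score has_derivative (\<lambda>v. out_hessian y *v v)) (at y)"
proof -
  have "((\<lambda>y. (\<alpha> / \<sigma>\<^sup>2) *\<^sub>R mean ((\<alpha> / \<sigma>\<^sup>2) *\<^sub>R y) - (1 / \<sigma>\<^sup>2) *\<^sub>R y) has_derivative
      (\<lambda>v. (\<alpha> / \<sigma>\<^sup>2) *\<^sub>R (cov_matrix (tilted ((\<alpha> / \<sigma>\<^sup>2) *\<^sub>R y)) *v ((\<alpha> / \<sigma>\<^sup>2) *\<^sub>R v)) - (1 / \<sigma>\<^sup>2) *\<^sub>R v)) (at y)"
    by (intro has_derivative_diff has_derivative_ident has_derivative_scaleR_right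
        has_derivative_compose[where f = "\<lambda>y. (\<alpha> / \<sigma>\<^sup>2) *\<^sub>R y", OF _ has_derivative_mean])
  moreover have "(\<alpha> / \<sigma>\<^sup>2) *\<^sub>R (cov_matrix (tilted ((\<alpha> / \<sigma>\<^sup>2) *\<^sub>R y)) *v ((\<alpha> / \<sigma>\<^sup>2) *\<^sub>R v)) - (1 / \<sigma>\<^sup>2) *\<^sub>R v
      = out_hessian y *v v" for v
    by (simp add: out_hessian_def posterior_def matrix_vector_mult_diff_rdistrib
        scaleR_matrix_vector_assoc [symmetric] matrix_vector_mult_scaleR power2_eq_square)
  ultimately show ?thesis by (simp add: out_score_def [abs_def])
qed

lemma out_hessian_upper: "v \<bullet> (- out_hessian y *v v) \<le> (1 / \<sigma>\<^sup>2) * (norm v)\<^sup>2"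
  and out_hessian_lower:
    "v \<bullet> (cov_matrix (posterior y) *v v) \<le> b * (norm v)\<^sup>2 \<Longrightarrow>
     (1 / \<sigma>\<^sup>2 - (\<alpha> / \<sigma>\<^sup>2)\<^sup>2 * b) * (norm v)\<^sup>2 \<le> v \<bullet> (- out_hessian y *v v)"
proof -
  have eq: "v \<bullet> (- out_hessian y *v v) = (1 / \<sigma>\<^sup>2) * (norm v)\<^sup>2 - (\<alpha> / \<sigma>\<^sup>2)\<^sup>2 * (v \<bullet> (cov_matrix (posterior y) *v v))"
    unfolding power2_norm_eq_inner
    by (simp add: out_hessian_def matrix_vector_mult_diff_rdistrib
        scaleR_matrix_vector_assoc [symmetric] inner_diff_right)
  show "v \<bullet> (- out_hessian y *v v) \<le> (1 / \<sigma>\<^sup>2) * (norm v)\<^sup>2"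
    using cov_matrix_tilted_nonneg[of v "(\<alpha> / \<sigma>\<^sup>2) *\<^sub>R y"] unfolding eq by (simp add: posterior_def)
  assume "v \<bullet> (cov_matrix (posterior y) *v v) \<le> b * (norm v)\<^sup>2"
  then have "(\<alpha> / \<sigma>\<^sup>2)\<^sup>2 * (v \<bullet> (cov_matrix (posterior y) *v v)) \<le> (\<alpha> / \<sigma>\<^sup>2)\<^sup>2 * (b * (norm v)\<^sup>2)"
    by (rule mult_left_mono) simp
  then show "(1 / \<sigma>\<^sup>2 - (\<alpha> / \<sigma>\<^sup>2)\<^sup>2 * b) * (norm v)\<^sup>2 \<le> v \<bullet> (- out_hessian y *v v)"
    unfolding eq by (simp only: left_diff_distrib mult.assoc)
qed

lemma posterior_eq:
  "posterior y = density \<mu> (\<lambda>x. ennreal (gaussian_density \<sigma> (y - \<alpha> *\<^sub>R x) / out_density y))"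
  unfolding posterior_def tilted_def gaussian_density_channel out_density_eq
  using norm_const_pos Z_pos[of "(\<alpha> / \<sigma>\<^sup>2) *\<^sub>R y"] by (simp add: field_simps)

lemma borel_measurable_out_density [measurable]: "out_density \<in> borel_measurable borel"
  by (rule borel_measurable_continuous_onI[OF continuous_out_density])

lemma sets_posterior [simp, measurable_cong]: "sets (posterior y) = sets borel"
  by (simp add: posterior_def)

lemma emeasure_posterior:
  assumes "C \<in> sets borel"
  shows "emeasure (posterior y) C
    = (\<integral>\<^sup>+x. ennreal (gaussian_density \<sigma> (y - \<alpha> *\<^sub>R x) / out_density y) * indicator C x \<partial>\<mu>)"
  using assms unfolding posterior_eq by (subst emeasure_density) (simp_all add: sets_input)

lemma posterior_kernel: "posterior \<in> borel \<rightarrow>\<^sub>M prob_algebra borel"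
proof (intro measurable_prob_algebraI measurable_subprob_algebra)
  show prob: "prob_space (posterior y)" for y
    unfolding posterior_def by (rule prob_space_tilted)
  then show "subprob_space (posterior y)" for y by (rule prob_space_imp_subprob_space)
  fix C :: "(real ^ 'n) set" assume [measurable]: "C \<in> sets borel"
  show "(\<lambda>y. emeasure (posterior y) C) \<in> borel_measurable borel"
    unfolding emeasure_posterior[OF \<open>C \<in> sets borel\<close>] by measurable
qed simp

lemma continuous_integral_posterior:
  fixes f :: "real ^ 'n \<Rightarrow> real"
  assumes f: "continuous_on UNIV f" "bounded (range f)"
  shows "continuous_on UNIV (\<lambda>y. \<integral>x. f x \<partial>posterior y)"
proof -
  have [measurable]: "f \<in> borel_measurable borel" using f(1) by (rule borel_measurable_continuous_onI)
  obtain C where C: "\<And>x. \<bar>f x\<bar> \<le> C" using f(2) by (auto simp: bounded_iff)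
  have "(\<integral>x. f x \<partial>posterior y) = (\<integral>x. gaussian_density \<sigma> (y - \<alpha> *\<^sub>R x) * f x \<partial>\<mu>) / out_density y" for y
    unfolding posterior_eq using out_density_pos[of y]
    by (subst integral_density) (auto simp: gaussian_density_nonneg less_imp_le)
  moreover have "continuous_on UNIV (\<lambda>y. \<integral>x. gaussian_density \<sigma> (y - \<alpha> *\<^sub>R x) * f x \<partial>\<mu>)"
  proof (rule continuous_on_integral_bounded)
    show "\<bar>gaussian_density \<sigma> (y - \<alpha> *\<^sub>R x) * f x\<bar> \<le> (1 / sqrt (2 * pi * \<sigma>\<^sup>2)) ^ CARD('n) * C" for y x
      unfolding abs_mult using C[of x] order_trans[OF abs_ge_zero C[of x]]
      by (intro mult_mono) (simp_all add: gaussian_density_nonneg gaussian_density_le del: power_divide)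
  qed (auto intro!: continuous_intros finite_measure_axioms)
  ultimately show ?thesis
    using out_density_pos by (auto intro!: continuous_intros continuous_out_density simp: less_imp_neq[THEN not_sym])
qed

end

text \<open>
  Bayes' rule for the joint density of input and output.  The explicit density and posterior are continuous, and therefore
  are the versions selected by \<^const>\<open>pdf\<close> and \<^const>\<open>cond_law\<close>.
\<close>

lemma (in prob_space) channel_pdf_and_cond_law:
  fixes X Y :: "'a \<Rightarrow> real ^ 'n"
  assumes X [measurable]: "X \<in> borel_measurable M"
    and ch: "gaussian_channel (distr M borel X) \<alpha> \<sigma>"
    and joint: "distributed M (distr M borel X \<Otimes>\<^sub>M lborel) (\<lambda>\<omega>. (X \<omega>, Y \<omega>))
      (\<lambda>(x, y). ennreal (gaussian_density \<sigma> (y - \<alpha> *\<^sub>R x)))"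
  shows channel_is_pdf: "is_pdf M Y (gaussian_channel.out_density (distr M borel X) \<alpha> \<sigma>)"
    and channel_cond_law: "cond_law M X Y = gaussian_channel.posterior (distr M borel X) \<alpha> \<sigma>"
proof -
  interpret ch: gaussian_channel "distr M borel X" \<alpha> \<sigma> by fact
  have XY: "(\<lambda>\<omega>. (X \<omega>, Y \<omega>)) \<in> M \<rightarrow>\<^sub>M distr M borel X \<Otimes>\<^sub>M lborel"
    using distributed_measurable[OF joint] .
  have Y [measurable]: "Y \<in> borel_measurable M"
    using measurable_comp[OF XY measurable_snd] by (simp add: o_def)
  have int: "(\<integral>\<^sup>+\<omega>. g (X \<omega>) (Y \<omega>) \<partial>M)
     = (\<integral>\<^sup>+y. (\<integral>\<^sup>+x. ennreal (gaussian_density \<sigma> (y - \<alpha> *\<^sub>R x)) * g x y \<partial>distr M borel X) \<partial>lborel)"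
    if [measurable]: "case_prod g \<in> borel_measurable (borel \<Otimes>\<^sub>M borel)" for g
  proof -
    interpret P: pair_sigma_finite "distr M borel X" "lborel :: (real ^ 'n) measure" ..
    have "(\<integral>\<^sup>+\<omega>. g (X \<omega>) (Y \<omega>) \<partial>M) = (\<integral>\<^sup>+\<omega>. (\<lambda>(x, y). g x y) (X \<omega>, Y \<omega>) \<partial>M)" by simp
    also have "\<dots> = (\<integral>\<^sup>+z. (case z of (x, y) \<Rightarrow> ennreal (gaussian_density \<sigma> (y - \<alpha> *\<^sub>R x))) * (case z of (x, y) \<Rightarrow> g x y) \<partial>(distr M borel X \<Otimes>\<^sub>M lborel))"
      by (rule distributed_nn_integral[OF joint, symmetric]) measurable
    also have "\<dots> = (\<integral>\<^sup>+y. (\<integral>\<^sup>+x. ennreal (gaussian_density \<sigma> (y - \<alpha> *\<^sub>R x)) * g x y \<partial>distr M borel X) \<partial>lborel)"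
      by (subst P.nn_integral_snd [symmetric]) (simp_all add: case_prod_beta')
    finally show ?thesis .
  qed
  have distr: "distributed M lborel Y (\<lambda>y. ennreal (ch.out_density y))"
    unfolding distributed_def
  proof (intro conjI measure_eqI)
    fix A assume "A \<in> sets (distr M lborel Y)"
    then have [measurable]: "A \<in> sets borel" by simp
    have "emeasure (distr M lborel Y) A = (\<integral>\<^sup>+y. indicator A y \<partial>distr M lborel Y)"
      by simp
    also have "\<dots> = (\<integral>\<^sup>+\<omega>. indicator A (Y \<omega>) \<partial>M)"
      by (rule nn_integral_distr) measurable
    also have "\<dots> = (\<integral>\<^sup>+y. (\<integral>\<^sup>+x. ennreal (gaussian_density \<sigma> (y - \<alpha> *\<^sub>R x)) * indicator A y \<partial>distr M borel X) \<partial>lborel)"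
      by (rule int) measurable
    also have "\<dots> = (\<integral>\<^sup>+y. ennreal (ch.out_density y) * indicator A y \<partial>lborel)"
      unfolding ch.nn_integral_out_density [symmetric]
      by (intro nn_integral_cong nn_integral_multc) measurable
    finally show "emeasure (distr M lborel Y) A = emeasure (density lborel (\<lambda>y. ennreal (ch.out_density y))) A"
      by (simp add: emeasure_density)
  qed (simp_all add: Y)
  then show "is_pdf M Y ch.out_density"
    by (simp add: is_pdf_def ch.continuous_out_density less_imp_le ch.out_density_pos)
  have "is_cond_law M X Y ch.posterior"
    unfolding is_cond_law_def
  proof (intro conjI ballI allI impI)
    fix A C :: "(real ^ 'n) set" assume [measurable]: "A \<in> sets borel" "C \<in> sets borel"
    note [measurable] = measurable_prob_algebraD[OF ch.posterior_kernel]
    have "emeasure M {\<omega> \<in> space M. Y \<omega> \<in> A \<and> X \<omega> \<in> C} = (\<integral>\<^sup>+\<omega>. indicator {\<omega> \<in> space M. Y \<omega> \<in> A \<and> X \<omega> \<in> C} \<omega> \<partial>M)"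
      by (rule nn_integral_indicator [symmetric]) measurable
    also have "\<dots> = (\<integral>\<^sup>+\<omega>. indicator A (Y \<omega>) * indicator C (X \<omega>) \<partial>M)"
      by (intro nn_integral_cong) (auto split: split_indicator)
    also have "\<dots> = (\<integral>\<^sup>+y. (\<integral>\<^sup>+x. ennreal (gaussian_density \<sigma> (y - \<alpha> *\<^sub>R x)) * (indicator A y * indicator C x) \<partial>distr M borel X) \<partial>lborel)"
      by (rule int) measurable
    also have "\<dots> = (\<integral>\<^sup>+y. ennreal (ch.out_density y) * (indicator A y * emeasure (ch.posterior y) C) \<partial>lborel)"
    proof (intro nn_integral_cong)
      fix y
      have "ennreal (gaussian_density \<sigma> (y - \<alpha> *\<^sub>R x)) = ennreal (ch.out_density y) * ennreal (gaussian_density \<sigma> (y - \<alpha> *\<^sub>R x) / ch.out_density y)" for x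
        using ch.out_density_pos[of y]
        by (subst ennreal_mult [symmetric]) (auto simp: gaussian_density_nonneg less_imp_le)
      then have "(\<integral>\<^sup>+x. ennreal (gaussian_density \<sigma> (y - \<alpha> *\<^sub>R x)) * (indicator A y * indicator C x) \<partial>distr M borel X)
        = (\<integral>\<^sup>+x. (ennreal (ch.out_density y) * indicator A y) *
            (ennreal (gaussian_density \<sigma> (y - \<alpha> *\<^sub>R x) / ch.out_density y) * indicator C x) \<partial>distr M borel X)"
        by (simp add: mult_ac)
      also have "\<dots> = (ennreal (ch.out_density y) * indicator A y) * emeasure (ch.posterior y) C"
        unfolding ch.emeasure_posterior[OF \<open>C \<in> sets borel\<close>] by (intro nn_integral_cmult) measurable
      finally show "(\<integral>\<^sup>+x. ennreal (gaussian_density \<sigma> (y - \<alpha> *\<^sub>R x)) * (indicator A y * indicator C x) \<partial>distr M borel X)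
        = ennreal (ch.out_density y) * (indicator A y * emeasure (ch.posterior y) C)"
        by (simp add: mult_ac)
    qed
    also have "\<dots> = (\<integral>\<^sup>+\<omega>. indicator A (Y \<omega>) * emeasure (ch.posterior (Y \<omega>)) C \<partial>M)"
      by (rule distributed_nn_integral[OF distr]) measurable
    finally show "emeasure M {\<omega> \<in> space M. Y \<omega> \<in> A \<and> X \<omega> \<in> C} = (\<integral>\<^sup>+\<omega>. indicator A (Y \<omega>) * emeasure (ch.posterior (Y \<omega>)) C \<partial>M)" .
  qed (simp_all add: ch.posterior_kernel ch.continuous_integral_posterior)
  then show "cond_law M X Y = ch.posterior"
    using distr ch.out_density_pos by (intro cond_law_eqI) auto
qed

section \<open>The backward conditional density\<close>

context gaussian_channel
begin

lemma nn_integral_out_density_1: "(\<integral>\<^sup>+y. ennreal (out_density y) \<partial>lborel) = 1"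
proof -
  interpret P: pair_sigma_finite \<mu> "lborel :: (real ^ 'n) measure" ..
  have "(\<integral>\<^sup>+y. ennreal (out_density y) \<partial>lborel)
      = (\<integral>\<^sup>+y. (\<integral>\<^sup>+x. ennreal (gaussian_density \<sigma> (y - \<alpha> *\<^sub>R x)) \<partial>\<mu>) \<partial>lborel)"
    by (simp add: nn_integral_out_density)
  also have "\<dots> = (\<integral>\<^sup>+x. (\<integral>\<^sup>+y. ennreal (gaussian_density \<sigma> (y - \<alpha> *\<^sub>R x)) \<partial>lborel) \<partial>\<mu>)"
    by (rule P.Fubini') measurable
  finally show ?thesis using \<sigma> by (simp add: nn_integral_gaussian_density emeasure_space_1)
qed

lemma slc_bounds_out_density:
  assumes cov: "\<And>y v. v \<bullet> (cov_matrix (posterior y) *v v) \<le> b * (norm v)\<^sup>2"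
  shows "slc_bounds (1 / \<sigma>\<^sup>2 - (\<alpha> / \<sigma>\<^sup>2)\<^sup>2 * b) (1 / \<sigma>\<^sup>2) out_density"
  unfolding slc_bounds_def
proof (intro conjI allI exI[of _ out_score] exI[of _ out_hessian])
  fix y
  show "loewner_le ((1 / \<sigma>\<^sup>2 - (\<alpha> / \<sigma>\<^sup>2)\<^sup>2 * b) *\<^sub>R mat 1) (- out_hessian y)"
    using out_hessian_lower[OF cov]
    by (simp add: loewner_le_def scaleR_matrix_vector_assoc [symmetric] power2_norm_eq_inner)
  show "loewner_le (- out_hessian y) ((1 / \<sigma>\<^sup>2) *\<^sub>R mat 1)"
    using out_hessian_upper
    by (simp add: loewner_le_def scaleR_matrix_vector_assoc [symmetric] power2_norm_eq_inner)
qed (simp_all add: out_density_pos nn_integral_out_density_1 GDERIV_ln_out_density has_derivative_out_score)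

text \<open>
  A further step \<open>y' = a y + s w\<close> after a channel \<open>(\<alpha>, \<sigma>)\<close> results in the channel
  \<open>(a \<alpha>, sqrt (a\<^sup>2 \<sigma>\<^sup>2 + s\<^sup>2))\<close>, whose output density is the normalising constant of the conditional density of \<open>y\<close> given \<open>y'\<close>.
\<close>

definition backward_density :: "real \<Rightarrow> real \<Rightarrow> real ^ 'n \<Rightarrow> real ^ 'n \<Rightarrow> real" where
  "backward_density a s y' y = out_density y * gaussian_density s (y' - a *\<^sub>R y) /
     gaussian_channel.out_density \<mu> (a * \<alpha>) (sqrt (a\<^sup>2 * \<sigma>\<^sup>2 + s\<^sup>2)) y'"

context
  fixes a s :: real
  assumes a: "a \<noteq> 0" and s: "0 < s"
begin

interpretation nxt: gaussian_channel \<mu> "a * \<alpha>" "sqrt (a\<^sup>2 * \<sigma>\<^sup>2 + s\<^sup>2)"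
  using a \<alpha> s \<sigma> by unfold_locales (auto simp: sets_input intro: add_nonneg_pos)

lemma next_channel: "gaussian_channel \<mu> (a * \<alpha>) (sqrt (a\<^sup>2 * \<sigma>\<^sup>2 + s\<^sup>2))"
  by (rule nxt.gaussian_channel_axioms)

lemma backward_density_pos: "0 < backward_density a s y' y"
  using s by (simp add: backward_density_def out_density_pos nxt.out_density_pos gaussian_density_pos)

lemma nn_integral_out_density_step:
  "(\<integral>\<^sup>+y. ennreal (out_density y * gaussian_density s (y' - a *\<^sub>R y)) \<partial>lborel) = ennreal (nxt.out_density y')"
proof -
  interpret P: pair_sigma_finite \<mu> "lborel :: (real ^ 'n) measure" ..
  have "(\<integral>\<^sup>+y. ennreal (out_density y * gaussian_density s (y' - a *\<^sub>R y)) \<partial>lborel)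
    = (\<integral>\<^sup>+y. (\<integral>\<^sup>+x. ennreal (gaussian_density \<sigma> (y - \<alpha> *\<^sub>R x)) \<partial>\<mu>) * ennreal (gaussian_density s (y' - a *\<^sub>R y)) \<partial>lborel)"
    by (simp add: nn_integral_out_density ennreal_mult less_imp_le[OF out_density_pos] gaussian_density_nonneg)
  also have "\<dots> = (\<integral>\<^sup>+y. (\<integral>\<^sup>+x. ennreal (gaussian_density \<sigma> (y - \<alpha> *\<^sub>R x) * gaussian_density s (y' - a *\<^sub>R y)) \<partial>\<mu>) \<partial>lborel)"
    by (simp add: nn_integral_multc [symmetric] ennreal_mult gaussian_density_nonneg)
  also have "\<dots> = (\<integral>\<^sup>+x. (\<integral>\<^sup>+y. ennreal (gaussian_density \<sigma> (y - \<alpha> *\<^sub>R x) * gaussian_density s (y' - a *\<^sub>R y)) \<partial>lborel) \<partial>\<mu>)"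
    by (rule P.Fubini') measurable
  also have "\<dots> = ennreal (nxt.out_density y')"
    using a s \<sigma> by (simp add: gaussian_density_affine_convolution nxt.nn_integral_out_density [symmetric])
  finally show ?thesis .
qed

lemma nn_integral_backward_density: "(\<integral>\<^sup>+y. ennreal (backward_density a s y' y) \<partial>lborel) = 1"
proof -
  have "(\<integral>\<^sup>+y. ennreal (backward_density a s y' y) \<partial>lborel)
      = (\<integral>\<^sup>+y. ennreal (out_density y * gaussian_density s (y' - a *\<^sub>R y)) * ennreal (inverse (nxt.out_density y')) \<partial>lborel)"
    unfolding backward_density_def divide_inverse
    by (intro nn_integral_cong ennreal_mult)
       (simp_all add: less_imp_le[OF out_density_pos] less_imp_le[OF nxt.out_density_pos] gaussian_density_nonneg)
  also have "\<dots> = ennreal (nxt.out_density y') * ennreal (inverse (nxt.out_density y'))"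
    by (subst nn_integral_multc) (simp_all add: nn_integral_out_density_step)
  also have "\<dots> = 1"
    using nxt.out_density_pos[of y'] by (subst ennreal_mult [symmetric]) simp_all
  finally show ?thesis .
qed

lemma ln_backward_density:
  "ln (backward_density a s y' y) = ln (out_density y) - (norm (y' - a *\<^sub>R y))\<^sup>2 / (2 * s\<^sup>2)
     + (real CARD('n) * ln (1 / sqrt (2 * pi * s\<^sup>2)) - ln (nxt.out_density y'))"
proof -
  have c: "0 < (1 / sqrt (2 * pi * s\<^sup>2)) ^ CARD('n)" using s by simp
  have "ln (gaussian_density s (y' - a *\<^sub>R y))
      = ln ((1 / sqrt (2 * pi * s\<^sup>2)) ^ CARD('n)) - (norm (y' - a *\<^sub>R y))\<^sup>2 / (2 * s\<^sup>2)"
    unfolding gaussian_density_eq_exp using c s by (simp add: ln_mult)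
  moreover have "ln ((1 / sqrt (2 * pi * s\<^sup>2)) ^ CARD('n)) = real CARD('n) * ln (1 / sqrt (2 * pi * s\<^sup>2))"
    by (rule ln_realpow)
  ultimately show ?thesis
    unfolding backward_density_def
    using s out_density_pos[of y] nxt.out_density_pos[of y'] gaussian_density_pos[OF s, of "y' - a *\<^sub>R y"]
    by (simp add: ln_div ln_mult)
qed

lemma GDERIV_ln_backward_density:
  "GDERIV (\<lambda>y. ln (backward_density a s y' y)) y :> out_score y - (a / s\<^sup>2) *\<^sub>R (a *\<^sub>R y - y')"
proof -
  let ?c = "real CARD('n) * ln (1 / sqrt (2 * pi * s\<^sup>2)) - ln (nxt.out_density y')"
  have 1: "((\<lambda>y. ln (out_density y)) has_derivative (\<lambda>v. v \<bullet> out_score y)) (at y)"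
    using GDERIV_ln_out_density by (simp add: gderiv_def)
  have "((\<lambda>y. ln (out_density y) - ((y' - a *\<^sub>R y) \<bullet> (y' - a *\<^sub>R y)) / (2 * s\<^sup>2) + ?c) has_derivative
     (\<lambda>v. v \<bullet> out_score y - ((y' - a *\<^sub>R y) \<bullet> (0 - a *\<^sub>R v) + (0 - a *\<^sub>R v) \<bullet> (y' - a *\<^sub>R y)) / (2 * s\<^sup>2) + 0)) (at y)"
    by (intro has_derivative_add has_derivative_diff has_derivative_const 1
        bounded_linear.has_derivative[OF bounded_linear_divide] has_derivative_inner has_derivative_ident
        has_derivative_scaleR_right)
  moreover have "(\<lambda>v. v \<bullet> out_score y - ((y' - a *\<^sub>R y) \<bullet> (0 - a *\<^sub>R v) + (0 - a *\<^sub>R v) \<bullet> (y' - a *\<^sub>R y)) / (2 * s\<^sup>2) + 0)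
     = (\<lambda>v. v \<bullet> (out_score y - (a / s\<^sup>2) *\<^sub>R (a *\<^sub>R y - y')))"
    using s by (simp add: fun_eq_iff inner_diff_right inner_diff_left inner_add_right inner_commute field_simps)
  ultimately show ?thesis
    unfolding gderiv_def ln_backward_density power2_norm_eq_inner by simp
qed

text \<open>
  The factor \<open>exp (- |y' - a y|\<^sup>2 / (2 s\<^sup>2))\<close> adds the curvature \<open>a\<^sup>2 / s\<^sup>2\<close> in all directions, for every \<open>y'\<close>.
\<close>

lemma slc_bounds_backward_density:
  assumes cov: "\<And>y v. v \<bullet> (cov_matrix (posterior y) *v v) \<le> b * (norm v)\<^sup>2"
  shows "slc_bounds (1 / \<sigma>\<^sup>2 - (\<alpha> / \<sigma>\<^sup>2)\<^sup>2 * b + a\<^sup>2 / s\<^sup>2) (1 / \<sigma>\<^sup>2 + a\<^sup>2 / s\<^sup>2) (backward_density a s y')"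
  unfolding slc_bounds_def
proof (intro conjI allI exI[of _ "\<lambda>y. out_score y - (a / s\<^sup>2) *\<^sub>R (a *\<^sub>R y - y')"]
    exI[of _ "\<lambda>y. out_hessian y - (a\<^sup>2 / s\<^sup>2) *\<^sub>R mat 1"])
  show "backward_density a s y' \<in> borel_measurable borel"
    unfolding backward_density_def [abs_def] by measurable
  fix y
  have "((\<lambda>y. out_score y - (a / s\<^sup>2) *\<^sub>R (a *\<^sub>R y - y')) has_derivative
      (\<lambda>v. out_hessian y *v v - (a / s\<^sup>2) *\<^sub>R (a *\<^sub>R v - 0))) (at y)"
    by (intro has_derivative_diff has_derivative_out_score has_derivative_scaleR_right
        has_derivative_ident has_derivative_const)
  moreover have "out_hessian y *v v - (a / s\<^sup>2) *\<^sub>R (a *\<^sub>R v - 0) = (out_hessian y - (a\<^sup>2 / s\<^sup>2) *\<^sub>R mat 1) *v v" for v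
    by (simp add: matrix_vector_mult_diff_rdistrib scaleR_matrix_vector_assoc [symmetric] power2_eq_square)
  ultimately show "((\<lambda>y. out_score y - (a / s\<^sup>2) *\<^sub>R (a *\<^sub>R y - y')) has_derivative
      (\<lambda>v. (out_hessian y - (a\<^sup>2 / s\<^sup>2) *\<^sub>R mat 1) *v v)) (at y)" by simp
  have neg: "- A *v v = - (A *v v)" for A :: "real ^ 'n ^ 'n" and v
    by (simp add: matrix_vector_mult_def vec_eq_iff sum_negf)
  have eq: "v \<bullet> (- (out_hessian y - (a\<^sup>2 / s\<^sup>2) *\<^sub>R mat 1) *v v) = v \<bullet> (- out_hessian y *v v) + (a\<^sup>2 / s\<^sup>2) * (norm v)\<^sup>2" for v
    unfolding power2_norm_eq_inner
    by (simp add: neg matrix_vector_mult_diff_rdistrib scaleR_matrix_vector_assoc [symmetric] inner_diff_right)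
  show "loewner_le ((1 / \<sigma>\<^sup>2 - (\<alpha> / \<sigma>\<^sup>2)\<^sup>2 * b + a\<^sup>2 / s\<^sup>2) *\<^sub>R mat 1) (- (out_hessian y - (a\<^sup>2 / s\<^sup>2) *\<^sub>R mat 1))"
    unfolding loewner_le_def eq using out_hessian_lower[OF cov]
    by (simp add: scaleR_matrix_vector_assoc [symmetric] power2_norm_eq_inner distrib_right)
  show "loewner_le (- (out_hessian y - (a\<^sup>2 / s\<^sup>2) *\<^sub>R mat 1)) ((1 / \<sigma>\<^sup>2 + a\<^sup>2 / s\<^sup>2) *\<^sub>R mat 1)"
    unfolding loewner_le_def eq using out_hessian_upper
    by (simp add: scaleR_matrix_vector_assoc [symmetric] power2_norm_eq_inner distrib_right)
qed (simp_all add: backward_density_pos nn_integral_backward_density GDERIV_ln_backward_density)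

end
end

text \<open>
  Independence is expressed by a product law, because \<^const>\<open>prob_space.indep_var\<close> would force \<open>V\<close>, which is a
  pair of vectors in the application, to have the same type as \<open>W\<close>.
\<close>

lemma (in prob_space) nn_integral_gaussian_step:
  fixes W :: "'a \<Rightarrow> real ^ 'n"
  assumes V [measurable]: "V \<in> M \<rightarrow>\<^sub>M N"
    and prod: "distr M N V \<Otimes>\<^sub>M distr M borel W = distr M (N \<Otimes>\<^sub>M borel) (\<lambda>\<omega>. (V \<omega>, W \<omega>))"
    and W: "distributed M lborel W (\<lambda>z. ennreal (std_gaussian_density z))"
    and h [measurable]: "h \<in> borel_measurable N" and s: "0 < s"
    and g [measurable]: "g \<in> borel_measurable (N \<Otimes>\<^sub>M borel)"
  shows "(\<integral>\<^sup>+\<omega>. g (V \<omega>, h (V \<omega>) + s *\<^sub>R W \<omega>) \<partial>M)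
    = (\<integral>\<^sup>+v. (\<integral>\<^sup>+y. g (v, y) * ennreal (gaussian_density s (y - h v)) \<partial>lborel) \<partial>distr M N V)"
proof -
  have Wm [measurable]: "W \<in> M \<rightarrow>\<^sub>M borel"
    using distributed_measurable[OF W] by simp
  have distrW: "distr M borel W = density lborel (\<lambda>z. ennreal (gaussian_density 1 z))"
    using distributed_distr_eq_density[OF W] by (simp add: std_gaussian_density_eq cong: distr_cong)
  interpret W: prob_space "distr M borel W" by (rule prob_space_distr) simp
  have "(\<integral>\<^sup>+\<omega>. g (V \<omega>, h (V \<omega>) + s *\<^sub>R W \<omega>) \<partial>M)
    = (\<integral>\<^sup>+z. g (fst z, h (fst z) + s *\<^sub>R snd z) \<partial>distr M (N \<Otimes>\<^sub>M borel) (\<lambda>x. (V x, W x)))"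
    by (subst nn_integral_distr) simp_all
  also have "\<dots> = (\<integral>\<^sup>+v. (\<integral>\<^sup>+w. g (v, h v + s *\<^sub>R w) \<partial>distr M borel W) \<partial>distr M N V)"
    unfolding prod [symmetric] by (subst W.nn_integral_fst [symmetric]) simp_all
  also have "\<dots> = (\<integral>\<^sup>+v. (\<integral>\<^sup>+y. g (v, y) * ennreal (gaussian_density s (y - h v)) \<partial>lborel) \<partial>distr M N V)"
  proof (rule nn_integral_cong)
    fix v assume "v \<in> space (distr M N V)"
    then have [measurable]: "v \<in> space N" by simp
    have "(\<integral>\<^sup>+w. g (v, h v + s *\<^sub>R w) \<partial>distr M borel W) = (\<integral>\<^sup>+w. g (v, h v + s *\<^sub>R w) * ennreal (gaussian_density 1 w) \<partial>lborel)"
      unfolding distrW by (subst nn_integral_density) (simp_all add: mult.commute)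
    also have "\<dots> = (\<integral>\<^sup>+y. g (v, y) * ennreal (gaussian_density s (y - h v)) \<partial>lborel)"
      by (rule nn_integral_affine_gaussian[OF _ s]) measurable
    finally show "(\<integral>\<^sup>+w. g (v, h v + s *\<^sub>R w) \<partial>distr M borel W) = (\<integral>\<^sup>+y. g (v, y) * ennreal (gaussian_density s (y - h v)) \<partial>lborel)" .
  qed
  finally show ?thesis .
qed

lemma nn_integral_gaussian_two_steps:
  fixes g :: "real ^ 'n \<Rightarrow> ennreal" and m :: "real ^ 'n"
  assumes g [measurable]: "g \<in> borel_measurable borel" and pos: "0 < \<sigma>" "0 < s" "a \<noteq> 0"
  shows "(\<integral>\<^sup>+y. (\<integral>\<^sup>+y'. g y' * ennreal (gaussian_density s (y' - a *\<^sub>R y)) \<partial>lborel)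
        * ennreal (gaussian_density \<sigma> (y - m)) \<partial>lborel)
    = (\<integral>\<^sup>+y'. g y' * ennreal (gaussian_density (sqrt (a\<^sup>2 * \<sigma>\<^sup>2 + s\<^sup>2)) (y' - a *\<^sub>R m)) \<partial>lborel)"
proof -
  have "(\<integral>\<^sup>+y. (\<integral>\<^sup>+y'. g y' * ennreal (gaussian_density s (y' - a *\<^sub>R y)) \<partial>lborel)
        * ennreal (gaussian_density \<sigma> (y - m)) \<partial>lborel)
    = (\<integral>\<^sup>+y. (\<integral>\<^sup>+y'. g y' * ennreal (gaussian_density \<sigma> (y - m) * gaussian_density s (y' - a *\<^sub>R y)) \<partial>lborel) \<partial>lborel)"
    by (subst nn_integral_multc [symmetric])
       (simp_all add: ennreal_mult gaussian_density_nonneg mult_ac)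
  also have "\<dots> = (\<integral>\<^sup>+y'. (\<integral>\<^sup>+y. g y' * ennreal (gaussian_density \<sigma> (y - m) * gaussian_density s (y' - a *\<^sub>R y)) \<partial>lborel) \<partial>lborel)"
    by (rule lborel_pair.Fubini') measurable
  also have "\<dots> = (\<integral>\<^sup>+y'. g y' * ennreal (gaussian_density (sqrt (a\<^sup>2 * \<sigma>\<^sup>2 + s\<^sup>2)) (y' - a *\<^sub>R m)) \<partial>lborel)"
    using pos by (simp add: nn_integral_cmult gaussian_density_affine_convolution)
  finally show ?thesis .
qed

lemma distributed_pairI:
  assumes "sigma_finite_measure L"
    and [measurable]: "V \<in> M \<rightarrow>\<^sub>M N" "Y \<in> M \<rightarrow>\<^sub>M L" "f \<in> borel_measurable (N \<Otimes>\<^sub>M L)"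
    and nn: "\<And>g. g \<in> borel_measurable (N \<Otimes>\<^sub>M L) \<Longrightarrow>
      (\<integral>\<^sup>+\<omega>. g (V \<omega>, Y \<omega>) \<partial>M) = (\<integral>\<^sup>+v. (\<integral>\<^sup>+y. g (v, y) * f (v, y) \<partial>L) \<partial>N)"
  shows "distributed M (N \<Otimes>\<^sub>M L) (\<lambda>\<omega>. (V \<omega>, Y \<omega>)) f"
  unfolding distributed_def
proof (intro conjI measure_eqI)
  interpret L: sigma_finite_measure L by fact
  fix A assume "A \<in> sets (distr M (N \<Otimes>\<^sub>M L) (\<lambda>\<omega>. (V \<omega>, Y \<omega>)))"
  then have A [measurable]: "A \<in> sets (N \<Otimes>\<^sub>M L)" by simp
  have "emeasure (distr M (N \<Otimes>\<^sub>M L) (\<lambda>\<omega>. (V \<omega>, Y \<omega>))) A = (\<integral>\<^sup>+z. indicator A z \<partial>distr M (N \<Otimes>\<^sub>M L) (\<lambda>\<omega>. (V \<omega>, Y \<omega>)))"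
    by simp
  also have "\<dots> = (\<integral>\<^sup>+\<omega>. indicator A (V \<omega>, Y \<omega>) \<partial>M)"
    by (rule nn_integral_distr) measurable
  also have "\<dots> = (\<integral>\<^sup>+v. (\<integral>\<^sup>+y. indicator A (v, y) * f (v, y) \<partial>L) \<partial>N)" by (rule nn) measurable
  also have "\<dots> = emeasure (density (N \<Otimes>\<^sub>M L) f) A"
    by (simp add: emeasure_density L.nn_integral_fst [symmetric] mult.commute)
  finally show "emeasure (distr M (N \<Otimes>\<^sub>M L) (\<lambda>\<omega>. (V \<omega>, Y \<omega>))) A = emeasure (density (N \<Otimes>\<^sub>M L) f) A" .
qed simp_all

section \<open>The chain\<close>

locale gaussian_chain = prob_space M for M :: "'w measure" +
  fixes X :: "'w \<Rightarrow> real ^ 'n" and W Y :: "nat \<Rightarrow> 'w \<Rightarrow> real ^ 'n" and a :: "nat \<Rightarrow> real"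
  assumes X [measurable]: "X \<in> borel_measurable M"
    and W: "\<And>k. distributed M lborel (W k) (\<lambda>z. ennreal (std_gaussian_density z))"
    and indep: "indep_vars (\<lambda>_. borel) (case_nat X W) UNIV"
    and Y1: "Y 1 = (\<lambda>\<omega>. a 0 *\<^sub>R X \<omega> + sqrt (1 - (a 0)\<^sup>2) *\<^sub>R W 0 \<omega>)"
    and Y_Suc: "\<And>k. k \<ge> 1 \<Longrightarrow> Y (Suc k) = (\<lambda>\<omega>. a k *\<^sub>R Y k \<omega> + sqrt (1 - (a k)\<^sup>2) *\<^sub>R W k \<omega>)"
    and a_nz: "\<And>k. a k \<noteq> 0" and a_lt: "\<And>k. (a k)\<^sup>2 < 1"
begin

definition \<alpha> :: "nat \<Rightarrow> real" where "\<alpha> k = (\<Prod>l<k. a l)"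

definition \<sigma> :: "nat \<Rightarrow> real" where "\<sigma> k = sqrt (1 - (\<alpha> k)\<^sup>2)"

definition noise :: "nat \<Rightarrow> real" where "noise k = sqrt (1 - (a k)\<^sup>2)"

lemma noise_pos: "0 < noise k" and noise_sq: "(noise k)\<^sup>2 = 1 - (a k)\<^sup>2"
  using a_lt[of k] by (simp_all add: noise_def)

lemma \<alpha>_nz: "\<alpha> k \<noteq> 0" by (simp add: \<alpha>_def a_nz)

lemma \<alpha>_sq: "(\<alpha> k)\<^sup>2 = (\<Prod>l<k. (a l)\<^sup>2)" by (simp add: \<alpha>_def prod_power_distrib)

lemma \<alpha>_sq_less: "k \<ge> 1 \<Longrightarrow> (\<alpha> k)\<^sup>2 < 1"
proof (induction k rule: dec_induct)
  case base
  then show ?case using a_lt[of 0] by (simp add: \<alpha>_def)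
next
  case (step k)
  have "(\<alpha> (Suc k))\<^sup>2 = (\<alpha> k)\<^sup>2 * (a k)\<^sup>2" by (simp add: \<alpha>_def power_mult_distrib)
  also have "\<dots> < 1 * 1" using step a_lt[of k] by (intro mult_strict_mono') auto
  finally show ?case by simp
qed

lemma \<sigma>_pos: "k \<ge> 1 \<Longrightarrow> 0 < \<sigma> k" and \<sigma>_sq: "k \<ge> 1 \<Longrightarrow> (\<sigma> k)\<^sup>2 = 1 - (\<alpha> k)\<^sup>2"
  using \<alpha>_sq_less[of k] by (simp_all add: \<sigma>_def)

lemma \<alpha>_Suc: "\<alpha> (Suc k) = a k * \<alpha> k" by (simp add: \<alpha>_def)

lemma \<sigma>_Suc: "k \<ge> 1 \<Longrightarrow> \<sigma> (Suc k) = sqrt ((a k)\<^sup>2 * (\<sigma> k)\<^sup>2 + (noise k)\<^sup>2)"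
  by (simp add: \<sigma>_sq noise_sq) (simp add: \<sigma>_def \<alpha>_Suc power_mult_distrib algebra_simps)

text \<open>
  \<open>X, W\<^sub>0, \<dots>, W\<^sub>k\<^sub>-\<^sub>1\<close>, indexed as in the independence assumption, where \<open>X\<close> has index \<open>0\<close> and \<open>W\<^sub>k\<close> has index \<open>k + 1\<close>.
  Both \<open>X\<close> and \<open>Y\<^sub>k\<close> are functions of this history, which is independent of \<open>W\<^sub>k\<close>.
\<close>

definition history :: "nat \<Rightarrow> 'w \<Rightarrow> nat \<Rightarrow> real ^ 'n" where
  "history k \<omega> = restrict (\<lambda>i. case_nat X W i \<omega>) {..k}"

lemma history_measurable [measurable]: "history k \<in> M \<rightarrow>\<^sub>M (\<Pi>\<^sub>M i\<in>{..k}. borel)"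
  and history_indep:
    "F \<in> (\<Pi>\<^sub>M i\<in>{..k}. borel) \<rightarrow>\<^sub>M N \<Longrightarrow>
     distr M N (\<lambda>\<omega>. F (history k \<omega>)) \<Otimes>\<^sub>M distr M borel (W k) =
     distr M (N \<Otimes>\<^sub>M borel) (\<lambda>\<omega>. (F (history k \<omega>), W k \<omega>))"
proof -
  let ?A = "\<Pi>\<^sub>M i\<in>{..k}. borel :: (real ^ 'n) measure" and ?B = "\<Pi>\<^sub>M i\<in>{Suc k}. borel :: (real ^ 'n) measure"
  define last where "last \<omega> = restrict (\<lambda>i. case_nat X W i \<omega>) {Suc k}" for \<omega>
  have "indep_var ?A (history k) ?B last"
    unfolding history_def [abs_def] last_def [abs_def] by (rule indep_var_restrict[OF indep]) auto
  then have hist [measurable]: "history k \<in> M \<rightarrow>\<^sub>M ?A" and last [measurable]: "last \<in> M \<rightarrow>\<^sub>M ?B"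
    and prod: "distr M ?A (history k) \<Otimes>\<^sub>M distr M ?B last = distr M (?A \<Otimes>\<^sub>M ?B) (\<lambda>\<omega>. (history k \<omega>, last \<omega>))"
    by (simp_all add: indep_var_distribution_eq)
  show "history k \<in> M \<rightarrow>\<^sub>M ?A" by fact
  assume F [measurable]: "F \<in> ?A \<rightarrow>\<^sub>M N"
  have W_last: "W k = (\<lambda>\<omega>. last \<omega> (Suc k))" by (simp add: last_def)
  interpret last: prob_space "distr M ?B last" by (rule prob_space_distr) simp
  interpret W: prob_space "distr (distr M ?B last) borel (\<lambda>v. v (Suc k))"
    by (rule last.prob_space_distr) simp
  have "distr M N (\<lambda>\<omega>. F (history k \<omega>)) \<Otimes>\<^sub>M distr M borel (W k)
      = distr (distr M ?A (history k)) N F \<Otimes>\<^sub>M distr (distr M ?B last) borel (\<lambda>v. v (Suc k))"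
    by (simp add: distr_distr o_def W_last)
  also have "\<dots> = distr (distr M ?A (history k) \<Otimes>\<^sub>M distr M ?B last) (N \<Otimes>\<^sub>M borel) (\<lambda>(x, y). (F x, y (Suc k)))"
    by (rule pair_measure_distr) (measurable, rule W.sigma_finite_measure_axioms)
  also have "\<dots> = distr M (N \<Otimes>\<^sub>M borel) (\<lambda>\<omega>. (F (history k \<omega>), W k \<omega>))"
    unfolding prod by (simp add: distr_distr o_def W_last)
  finally show "distr M N (\<lambda>\<omega>. F (history k \<omega>)) \<Otimes>\<^sub>M distr M borel (W k) =
     distr M (N \<Otimes>\<^sub>M borel) (\<lambda>\<omega>. (F (history k \<omega>), W k \<omega>))" .
qed

lemma Y_history_ex:
  assumes "k \<ge> 1"
  shows "\<exists>F. F \<in> (\<Pi>\<^sub>M i\<in>{..k}. borel) \<rightarrow>\<^sub>M borel \<Otimes>\<^sub>M borel \<and> (\<lambda>\<omega>. F (history k \<omega>)) = (\<lambda>\<omega>. (X \<omega>, Y k \<omega>))"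
  using assms
proof (induction k rule: dec_induct)
  case base
  define G :: "(nat \<Rightarrow> real ^ 'n) \<Rightarrow> (real ^ 'n) \<times> (real ^ 'n)" where
    "G = (\<lambda>v. (v 0, a 0 *\<^sub>R v 0 + sqrt (1 - (a 0)\<^sup>2) *\<^sub>R v 1))"
  have comp: "(\<lambda>v. v i) \<in> (\<Pi>\<^sub>M i\<in>{..1}. borel :: (real ^ 'n) measure) \<rightarrow>\<^sub>M borel" if "i \<le> 1" for i :: nat
    by (rule measurable_component_singleton) (use that in simp)
  have "G \<in> (\<Pi>\<^sub>M i\<in>{..1}. borel) \<rightarrow>\<^sub>M borel \<Otimes>\<^sub>M borel"
    unfolding G_def
    by (intro measurable_Pair borel_measurable_add borel_measurable_scaleR borel_measurable_const comp) simp_all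
  moreover have "(\<lambda>\<omega>. G (history 1 \<omega>)) = (\<lambda>\<omega>. (X \<omega>, Y 1 \<omega>))"
    by (rule ext) (simp only: G_def history_def Y1, simp)
  ultimately show ?case by (intro exI conjI)
next
  case (step k)
  from step.IH obtain F where F: "F \<in> (\<Pi>\<^sub>M i\<in>{..k}. borel) \<rightarrow>\<^sub>M borel \<Otimes>\<^sub>M borel"
    and FY: "(\<lambda>\<omega>. F (history k \<omega>)) = (\<lambda>\<omega>. (X \<omega>, Y k \<omega>))" by (elim exE conjE)
  define G where "G v = F (restrict v {..k})" for v
  have G: "G \<in> (\<Pi>\<^sub>M i\<in>{..Suc k}. borel) \<rightarrow>\<^sub>M borel \<Otimes>\<^sub>M borel"
    unfolding G_def by (rule measurable_compose[OF measurable_restrict_subset F]) simp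
  define H where "H v = (fst (G v), a k *\<^sub>R snd (G v) + sqrt (1 - (a k)\<^sup>2) *\<^sub>R v (Suc k))" for v
  have last: "(\<lambda>v. v (Suc k)) \<in> (\<Pi>\<^sub>M i\<in>{..Suc k}. borel :: (real ^ 'n) measure) \<rightarrow>\<^sub>M borel"
    by (rule measurable_component_singleton) simp
  have "H \<in> (\<Pi>\<^sub>M i\<in>{..Suc k}. borel) \<rightarrow>\<^sub>M borel \<Otimes>\<^sub>M borel"
    unfolding H_def
    by (intro measurable_Pair borel_measurable_add borel_measurable_scaleR borel_measurable_const last
        measurable_compose[OF G measurable_fst] measurable_compose[OF G measurable_snd])
  moreover have "H (history (Suc k) \<omega>) = (X \<omega>, Y (Suc k) \<omega>)" for \<omega>
  proof -
    have "restrict (history (Suc k) \<omega>) {..k} = history k \<omega>"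
      by (rule ext) (simp add: history_def)
    then have "G (history (Suc k) \<omega>) = (X \<omega>, Y k \<omega>)"
      using fun_cong[OF FY, of \<omega>] by (simp add: G_def)
    moreover have "history (Suc k) \<omega> (Suc k) = W k \<omega>"
      by (simp add: history_def)
    ultimately show ?thesis
      by (simp only: H_def Y_Suc[OF step.hyps(1)] fst_conv snd_conv)
  qed
  ultimately show ?case by (intro exI conjI ext)
qed

lemma Y_history:
  assumes "k \<ge> 1"
  obtains F where "F \<in> (\<Pi>\<^sub>M i\<in>{..k}. borel) \<rightarrow>\<^sub>M borel \<Otimes>\<^sub>M borel" "\<And>\<omega>. F (history k \<omega>) = (X \<omega>, Y k \<omega>)"
  using Y_history_ex[OF assms] by (metis (no_types))

lemma XY_measurable: "k \<ge> 1 \<Longrightarrow> (\<lambda>\<omega>. (X \<omega>, Y k \<omega>)) \<in> M \<rightarrow>\<^sub>M borel \<Otimes>\<^sub>M borel"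
proof -
  assume k: "k \<ge> 1"
  obtain F where F: "F \<in> (\<Pi>\<^sub>M i\<in>{..k}. borel) \<rightarrow>\<^sub>M borel \<Otimes>\<^sub>M borel" "\<And>\<omega>. F (history k \<omega>) = (X \<omega>, Y k \<omega>)"
    using Y_history[OF k] by metis
  from measurable_compose[OF history_measurable F(1)] show ?thesis by (simp add: F(2))
qed

lemma Y_measurable: "k \<ge> 1 \<Longrightarrow> Y k \<in> borel_measurable M"
  using measurable_comp[OF XY_measurable measurable_snd] by (simp add: o_def)

lemma nn_integral_next:
  assumes k: "k \<ge> 1" and V: "V \<in> (borel \<Otimes>\<^sub>M borel) \<rightarrow>\<^sub>M N"
    and h: "h \<in> borel_measurable N" "\<And>\<omega>. h (V (X \<omega>, Y k \<omega>)) = a k *\<^sub>R Y k \<omega>"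
    and g: "g \<in> borel_measurable (N \<Otimes>\<^sub>M borel)"
  shows "(\<integral>\<^sup>+\<omega>. g (V (X \<omega>, Y k \<omega>), Y (Suc k) \<omega>) \<partial>M)
    = (\<integral>\<^sup>+v. (\<integral>\<^sup>+y. g (v, y) * ennreal (gaussian_density (noise k) (y - h v)) \<partial>lborel)
         \<partial>distr M N (\<lambda>\<omega>. V (X \<omega>, Y k \<omega>)))"
proof -
  obtain F where F: "F \<in> (\<Pi>\<^sub>M i\<in>{..k}. borel) \<rightarrow>\<^sub>M borel \<Otimes>\<^sub>M borel" "\<And>\<omega>. F (history k \<omega>) = (X \<omega>, Y k \<omega>)"
    using Y_history[OF k] by metis
  have "distr M N (\<lambda>\<omega>. V (X \<omega>, Y k \<omega>)) \<Otimes>\<^sub>M distr M borel (W k) =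
     distr M (N \<Otimes>\<^sub>M borel) (\<lambda>\<omega>. (V (X \<omega>, Y k \<omega>), W k \<omega>))"
    using history_indep[OF measurable_compose[OF F(1) V]] by (simp add: F(2))
  moreover have "Y (Suc k) \<omega> = h (V (X \<omega>, Y k \<omega>)) + noise k *\<^sub>R W k \<omega>" for \<omega>
    by (simp add: h Y_Suc[OF k] noise_def)
  ultimately show ?thesis
    using nn_integral_gaussian_step[OF measurable_compose[OF XY_measurable[OF k] V] _ W h(1) noise_pos g]
    by simp
qed

text \<open>
  The joint law of \<open>X\<close> and \<open>Y\<^sub>k\<close> is that of input and output of a single channel: given \<open>X = x\<close>, each step
  maps one Gaussian law to another, and \<open>\<sigma>\<^sub>k\<^sub>+\<^sub>1\<^sup>2 = a\<^sub>k\<^sup>2 \<sigma>\<^sub>k\<^sup>2 + (1 - a\<^sub>k\<^sup>2)\<close>.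
\<close>

lemma nn_integral_X_Y:
  assumes "k \<ge> 1" "g \<in> borel_measurable (borel \<Otimes>\<^sub>M borel)"
  shows "(\<integral>\<^sup>+\<omega>. g (X \<omega>, Y k \<omega>) \<partial>M)
    = (\<integral>\<^sup>+x. (\<integral>\<^sup>+y. g (x, y) * ennreal (gaussian_density (\<sigma> k) (y - \<alpha> k *\<^sub>R x)) \<partial>lborel) \<partial>distr M borel X)"
  using assms
proof (induction k arbitrary: g rule: dec_induct)
  case (base g)
  have X0: "history 0 \<omega> 0 = X \<omega>" for \<omega> by (simp add: history_def)
  have comp: "(\<lambda>v. v 0) \<in> (\<Pi>\<^sub>M i\<in>{..0::nat}. borel :: (real ^ 'n) measure) \<rightarrow>\<^sub>M borel"
    by (rule measurable_component_singleton) simp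
  have prod: "distr M borel X \<Otimes>\<^sub>M distr M borel (W 0) = distr M (borel \<Otimes>\<^sub>M borel) (\<lambda>\<omega>. (X \<omega>, W 0 \<omega>))"
    using history_indep[OF comp] by (simp add: X0)
  have eqs: "Y 1 \<omega> = a 0 *\<^sub>R X \<omega> + noise 0 *\<^sub>R W 0 \<omega>" "\<sigma> 1 = noise 0" "\<alpha> 1 = a 0" for \<omega>
    by (simp_all only: Y1 noise_def \<sigma>_def \<alpha>_def) simp_all
  show ?case
    unfolding eqs by (rule nn_integral_gaussian_step[OF X prod W _ noise_pos base]) simp
next
  case (step k g)
  have g: "g \<in> borel_measurable (borel \<Otimes>\<^sub>M borel)" by fact
  define G where "G z = (\<integral>\<^sup>+y'. g (fst z, y') * ennreal (gaussian_density (noise k) (y' - a k *\<^sub>R snd z)) \<partial>lborel)" for z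
  have "(\<lambda>z. g (fst (fst z), snd z) * ennreal (gaussian_density (noise k) (snd z - a k *\<^sub>R snd (fst z))))
      \<in> borel_measurable ((borel \<Otimes>\<^sub>M borel) \<Otimes>\<^sub>M lborel)"
    by (intro borel_measurable_times_ennreal measurable_compose[OF _ g]) measurable
  then have G: "G \<in> borel_measurable (borel \<Otimes>\<^sub>M borel)"
    unfolding G_def by (intro lborel.borel_measurable_nn_integral) (simp add: case_prod_beta')
  have g1: "(\<lambda>y'. g (x, y')) \<in> borel_measurable borel" for x
    by (rule measurable_compose[OF measurable_Pair1' g]) simp
  have "(\<integral>\<^sup>+\<omega>. g (X \<omega>, Y (Suc k) \<omega>) \<partial>M) = (\<integral>\<^sup>+v. G v \<partial>distr M (borel \<Otimes>\<^sub>M borel) (\<lambda>\<omega>. (X \<omega>, Y k \<omega>)))"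
  proof -
    have 1: "(\<lambda>z. g (fst (fst z), snd z)) \<in> borel_measurable ((borel \<Otimes>\<^sub>M borel) \<Otimes>\<^sub>M borel)"
      by (rule measurable_compose[OF _ g]) measurable
    have 2: "(\<lambda>v :: (real ^ 'n) \<times> (real ^ 'n). a k *\<^sub>R snd v) \<in> borel_measurable (borel \<Otimes>\<^sub>M borel)" by measurable
    from nn_integral_next[OF \<open>1 \<le> k\<close> measurable_ident 2 _ 1] show ?thesis
      by (simp add: G_def)
  qed
  also have "\<dots> = (\<integral>\<^sup>+\<omega>. G (X \<omega>, Y k \<omega>) \<partial>M)"
    by (rule nn_integral_distr[OF XY_measurable[OF \<open>1 \<le> k\<close>]]) (simp add: G)
  also have "\<dots> = (\<integral>\<^sup>+x. (\<integral>\<^sup>+y. G (x, y) * ennreal (gaussian_density (\<sigma> k) (y - \<alpha> k *\<^sub>R x)) \<partial>lborel) \<partial>distr M borel X)"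
    by (rule step.IH[OF G])
  also have "\<dots> = (\<integral>\<^sup>+x. (\<integral>\<^sup>+y'. g (x, y') * ennreal (gaussian_density (\<sigma> (Suc k)) (y' - \<alpha> (Suc k) *\<^sub>R x)) \<partial>lborel) \<partial>distr M borel X)"
    using nn_integral_gaussian_two_steps[OF g1 \<sigma>_pos[OF \<open>1 \<le> k\<close>] noise_pos a_nz]
    by (simp add: G_def \<sigma>_Suc[OF \<open>1 \<le> k\<close>] \<alpha>_Suc)
  finally show ?case .
qed

end

sublocale gaussian_chain \<subseteq> input: prob_space "distr M borel X"
  by (rule prob_space_distr) simp

context gaussian_chain
begin

lemma channel: "k \<ge> 1 \<Longrightarrow> gaussian_channel (distr M borel X) (\<alpha> k) (\<sigma> k)"
  by unfold_locales (simp_all add: \<alpha>_nz \<sigma>_pos)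

abbreviation dens :: "nat \<Rightarrow> real ^ 'n \<Rightarrow> real" where
  "dens k \<equiv> gaussian_channel.out_density (distr M borel X) (\<alpha> k) (\<sigma> k)"

abbreviation post :: "nat \<Rightarrow> real ^ 'n \<Rightarrow> (real ^ 'n) measure" where
  "post k \<equiv> gaussian_channel.posterior (distr M borel X) (\<alpha> k) (\<sigma> k)"

abbreviation bwd :: "nat \<Rightarrow> real ^ 'n \<Rightarrow> real ^ 'n \<Rightarrow> real" where
  "bwd k \<equiv> gaussian_channel.backward_density (distr M borel X) (\<alpha> k) (\<sigma> k) (a k) (noise k)"

lemma distributed_X_Y:
  assumes k: "k \<ge> 1"
  shows "distributed M (distr M borel X \<Otimes>\<^sub>M lborel) (\<lambda>\<omega>. (X \<omega>, Y k \<omega>))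
      (\<lambda>(x, y). ennreal (gaussian_density (\<sigma> k) (y - \<alpha> k *\<^sub>R x)))"
proof (rule distributed_pairI)
  fix g :: "(real ^ 'n) \<times> (real ^ 'n) \<Rightarrow> ennreal" assume "g \<in> borel_measurable (distr M borel X \<Otimes>\<^sub>M lborel)"
  then have "g \<in> borel_measurable (borel \<Otimes>\<^sub>M borel)" by simp
  from nn_integral_X_Y[OF k this]
  show "(\<integral>\<^sup>+\<omega>. g (X \<omega>, Y k \<omega>) \<partial>M) = (\<integral>\<^sup>+v. (\<integral>\<^sup>+y. g (v, y) * (case (v, y) of (x, y) \<Rightarrow> ennreal (gaussian_density (\<sigma> k) (y - \<alpha> k *\<^sub>R x))) \<partial>lborel) \<partial>distr M borel X)"
    by simp
qed (use Y_measurable[OF k] in \<open>simp_all add: lborel.sigma_finite_measure_axioms\<close>)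

lemma is_pdf_Y: "k \<ge> 1 \<Longrightarrow> is_pdf M (Y k) (dens k)"
  and cond_law_Y: "k \<ge> 1 \<Longrightarrow> cond_law M X (Y k) = post k"
  using channel_is_pdf[OF X channel distributed_X_Y] channel_cond_law[OF X channel distributed_X_Y] by auto

lemma pdf_Y: "k \<ge> 1 \<Longrightarrow> pdf M (Y k) = dens k"
  by (rule pdf_eqI[OF is_pdf_Y])

lemma dens_Suc:
  "k \<ge> 1 \<Longrightarrow> dens (Suc k) = gaussian_channel.out_density (distr M borel X) (a k * \<alpha> k) (sqrt ((a k)\<^sup>2 * (\<sigma> k)\<^sup>2 + (noise k)\<^sup>2))"
  by (simp add: \<sigma>_Suc \<alpha>_Suc)

lemma cond_pdf_Y:
  assumes k: "k \<ge> 1"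
  shows "cond_pdf M (Y k) (Y (Suc k)) = bwd k"
proof -
  interpret ch: gaussian_channel "distr M borel X" "\<alpha> k" "\<sigma> k" by (rule channel[OF k])
  let ?f = "\<lambda>(y, y'). dens k y * gaussian_density (noise k) (y' - a k *\<^sub>R y)"
  have Yk [measurable]: "Y k \<in> borel_measurable M" "Y (Suc k) \<in> borel_measurable M"
    using Y_measurable k by auto
  have distrY: "distr M borel (Y k) = density lborel (\<lambda>y. ennreal (dens k y))"
    using is_pdf_Y[OF k] distributed_distr_eq_density[of M lborel "Y k"] by (auto simp: is_pdf_def cong: distr_cong)
  have "distributed M (lborel \<Otimes>\<^sub>M lborel) (\<lambda>\<omega>. (Y k \<omega>, Y (Suc k) \<omega>)) (\<lambda>z. ennreal (?f z))"
  proof (rule distributed_pairI)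
    fix g :: "(real ^ 'n) \<times> (real ^ 'n) \<Rightarrow> ennreal" assume "g \<in> borel_measurable (lborel \<Otimes>\<^sub>M lborel)"
    then have g [measurable]: "g \<in> borel_measurable (borel \<Otimes>\<^sub>M borel)" by simp
    have "(\<integral>\<^sup>+\<omega>. g (Y k \<omega>, Y (Suc k) \<omega>) \<partial>M) = (\<integral>\<^sup>+v. (\<integral>\<^sup>+y. g (v, y) * ennreal (gaussian_density (noise k) (y - a k *\<^sub>R v)) \<partial>lborel)
         \<partial>distr M borel (Y k))"
      using nn_integral_next[OF k measurable_snd _ _ g, of "\<lambda>y. a k *\<^sub>R y"] by simp
    also have "\<dots> = (\<integral>\<^sup>+v. ennreal (dens k v) * (\<integral>\<^sup>+y. g (v, y) * ennreal (gaussian_density (noise k) (y - a k *\<^sub>R v)) \<partial>lborel) \<partial>lborel)"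
      unfolding distrY by (rule nn_integral_density) measurable
    also have "\<dots> = (\<integral>\<^sup>+v. (\<integral>\<^sup>+y. g (v, y) * ennreal (?f (v, y)) \<partial>lborel) \<partial>lborel)"
      by (simp add: nn_integral_cmult [symmetric] ennreal_mult gaussian_density_nonneg less_imp_le[OF ch.out_density_pos] mult_ac)
    finally show "(\<integral>\<^sup>+\<omega>. g (Y k \<omega>, Y (Suc k) \<omega>) \<partial>M) = (\<integral>\<^sup>+v. (\<integral>\<^sup>+y. g (v, y) * ennreal (?f (v, y)) \<partial>lborel) \<partial>lborel)" .
  qed (simp_all add: lborel.sigma_finite_measure_axioms)
  then have "is_pdf M (\<lambda>\<omega>. (Y k \<omega>, Y (Suc k) \<omega>)) ?f"
    unfolding is_pdf_def lborel_prod
    by (auto simp: case_prod_beta' gaussian_density_nonneg less_imp_le[OF ch.out_density_pos]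
        intro!: continuous_intros continuous_on_compose2[OF ch.continuous_out_density])
  from pdf_eqI[OF this] show ?thesis
    using k by (simp add: fun_eq_iff cond_pdf_def pdf_Y ch.backward_density_def dens_Suc)
qed

end

section \<open>Length of the trajectory\<close>

text \<open>
  With \<open>u\<^sub>k = \<Prod>l<k. (a\<^sub>l)\<^sup>2\<close> and \<open>q = 1 / (8 B\<^sub>m\<^sub>a\<^sub>x u\<^sub>k + 3) \<le> 1 / (2 \<lambda>\<^sub>k + 3)\<close>, a step removes at least the fraction \<open>q\<close> of
  \<open>u\<^sub>k\<close>.  This lowers \<open>8 B\<^sub>m\<^sub>a\<^sub>x u\<^sub>k + 3 ln u\<^sub>k\<close> by at least \<open>8 B\<^sub>m\<^sub>a\<^sub>x u\<^sub>k q + 3 q = 1\<close>.  The potential starts at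
  \<open>4 B\<^sub>m\<^sub>a\<^sub>x - 3 ln 2\<close>, and it exceeds \<open>1 - 3 ln (8 B\<^sub>m\<^sub>a\<^sub>x)\<close> as long as the stopping criterion fails.
\<close>

lemma trajectory_length:
  fixes a B lam :: "nat \<Rightarrow> real"
  assumes a0: "(a 0)\<^sup>2 = 1 / 2"
    and B0: "\<And>k. k \<ge> 1 \<Longrightarrow> 0 \<le> B k"
    and Bmax: "\<And>k. k \<ge> 1 \<Longrightarrow> B k \<le> Bmax"
    and lam: "\<And>k. k \<ge> 1 \<Longrightarrow> lam k = 4 * B k * (\<Prod>l<k. (a l)\<^sup>2)"
    and a: "\<And>k. k \<ge> 1 \<Longrightarrow> (a k)\<^sup>2 = (2 * lam k + 2) / (2 * lam k + 3)"
  obtains K where "K \<ge> 1" "real K \<le> 7 * (1 + Bmax)" "8 * B K * (\<Prod>l<K. (a l)\<^sup>2) \<le> 1"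
proof -
  define u where "u k = (\<Prod>l<k. (a l)\<^sup>2)" for k
  have u1: "u 1 = 1 / 2" by (simp add: u_def a0)
  have Bmax0: "0 \<le> Bmax" using B0[of 1] Bmax[of 1] by simp
  have pos: "0 < u k \<and> 0 \<le> lam k" if "k \<ge> 1" for k
    using that
  proof (induction k rule: dec_induct)
    case base
    then show ?case using B0[of 1] lam[of 1] by (simp add: u_def a0)
  next
    case (step k)
    then have "0 < u (Suc k)" by (simp add: u_def a)
    then show ?case using B0[of "Suc k"] lam[of "Suc k"] by (simp add: u_def)
  qed
  have decrease: "1 + 8 * Bmax * u (Suc k) + 3 * ln (u (Suc k)) \<le> 8 * Bmax * u k + 3 * ln (u k)"
    if k: "k \<ge> 1" for k
  proof -
    define q where "q = 1 / (8 * Bmax * u k + 3)"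
    have q: "0 < q" "q \<le> 1 / (2 * lam k + 3)"
    proof -
      have "2 * lam k \<le> 8 * Bmax * u k"
        using lam[OF k] Bmax[OF k] pos[OF k] by (simp add: u_def)
      then show "0 < q" "q \<le> 1 / (2 * lam k + 3)"
        using pos[OF k] by (auto simp: q_def intro!: divide_left_mono)
    qed
    have "u (Suc k) = u k * (1 - 1 / (2 * lam k + 3))"
      using pos[OF k] by (simp add: u_def a[OF k] field_simps)
    also have "\<dots> \<le> u k * (1 - q)"
      using q pos[OF k] by (intro mult_left_mono) auto
    finally have le: "u (Suc k) \<le> u k * (1 - q)" .
    have uS: "0 < u (Suc k)" using pos[of "Suc k"] by simp
    have q1: "q < 1" using le uS pos[OF k] by (smt (verit) mult_nonneg_nonpos)
    have "ln (u (Suc k)) \<le> ln (u k * (1 - q))" using le uS pos[OF k] by simp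
    also have "\<dots> = ln (u k) + ln (1 - q)" using pos[OF k] q1 by (simp add: ln_mult)
    also have "ln (1 - q) \<le> - q" using ln_le_minus_one[of "1 - q"] q1 by simp
    finally have "ln (u (Suc k)) \<le> ln (u k) - q" by simp
    moreover have "8 * Bmax * u (Suc k) \<le> 8 * Bmax * u k - q * (8 * Bmax * u k)"
      using mult_left_mono[OF le, of "8 * Bmax"] Bmax0 by (simp add: algebra_simps)
    moreover have "q * (8 * Bmax * u k) + 3 * q = 1"
    proof -
      have "0 < 8 * Bmax * u k + 3" using Bmax0 pos[OF k] by (simp add: add_nonneg_pos)
      then have "q * (8 * Bmax * u k + 3) = 1" by (simp add: q_def)
      then show ?thesis by (simp add: algebra_simps)
    qed
    ultimately show ?thesis by linarith
  qed
  have potential: "real n + 8 * Bmax * u (Suc n) + 3 * ln (u (Suc n)) \<le> 4 * Bmax + 3 * ln (1 / 2)" for n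
  proof (induction n)
    case 0
    show ?case unfolding One_nat_def [symmetric] u1 by simp
  next
    case (Suc n)
    then show ?case using decrease[of "Suc n"] by simp
  qed
  have ln4: "ln (4 :: real) \<le> 2"
  proof -
    have "ln (4 :: real) = 2 * ln 2" using ln_realpow[of 2 2] by simp
    then show ?thesis using ln_le_minus_one[of "2 :: real"] by simp
  qed
  \<comment> \<open>the crude estimate \<open>3 ln (4 B\<^sub>m\<^sub>a\<^sub>x) \<le> 3 (B\<^sub>m\<^sub>a\<^sub>x - 1) + 3 ln 4 \<le> 3 B\<^sub>m\<^sub>a\<^sub>x + 3\<close> turns the logarithm into the remaining \<open>3 B\<^sub>m\<^sub>a\<^sub>x\<close> of \<open>7 B\<^sub>m\<^sub>a\<^sub>x\<close>\<close>
  have long: "real (Suc n) \<le> 7 * Bmax + 3" if "8 * B (Suc n) * u (Suc n) > 1" for n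
  proof -
    have u: "0 < u (Suc n)" using pos[of "Suc n"] by simp
    have "1 < 8 * Bmax * u (Suc n)"
    proof -
      have "B (Suc n) * u (Suc n) \<le> Bmax * u (Suc n)"
        using Bmax[of "Suc n"] u by (intro mult_right_mono) simp_all
      then show ?thesis using that by simp
    qed
    then have "Bmax \<noteq> 0" by auto
    then have B: "0 < Bmax" using Bmax0 by simp
    have lt: "1 / (8 * Bmax) < u (Suc n)"
      using \<open>1 < 8 * Bmax * u (Suc n)\<close> B by (simp add: divide_less_eq mult_ac)
    have "- ln (8 * Bmax) = ln (1 / (8 * Bmax))" using B by (simp add: ln_div)
    also have "\<dots> < ln (u (Suc n))" using lt B u by simp
    finally have 1: "- ln (8 * Bmax) < ln (u (Suc n))" .
    have "ln (8 * Bmax) + ln (1 / 2) = ln 4 + ln Bmax"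
    proof -
      have "ln (8 * Bmax) + ln (1 / 2) = ln (8 * Bmax * (1 / 2))" using B by (subst ln_mult) auto
      also have "\<dots> = ln (4 * Bmax)" by simp
      finally show ?thesis using B by (simp add: ln_mult)
    qed
    moreover have "ln Bmax \<le> Bmax - 1" using B by (rule ln_le_minus_one)
    ultimately have "ln (8 * Bmax) + ln (1 / 2) \<le> Bmax + 1" using ln4 by linarith
    with potential[of n] 1 \<open>1 < 8 * Bmax * u (Suc n)\<close> show ?thesis by simp
  qed
  have ex: "\<exists>k. 8 * B (Suc k) * u (Suc k) \<le> 1"
  proof (rule ccontr)
    assume "\<not> ?thesis"
    then have le: "real (Suc n) \<le> 7 * Bmax + 3" for n
      using long[of n] by (simp add: not_le)
    obtain n where "7 * Bmax + 3 < real n" using reals_Archimedean2 by blast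
    with le[of n] show False by simp
  qed
  define j where "j = (LEAST k. 8 * B (Suc k) * u (Suc k) \<le> 1)"
  have j: "8 * B (Suc j) * u (Suc j) \<le> 1" unfolding j_def using ex by (rule LeastI_ex)
  show ?thesis
  proof (rule that[of "Suc j"])
    show "real (Suc j) \<le> 7 * (1 + Bmax)"
    proof (cases j)
      case 0
      then show ?thesis using Bmax0 by simp
    next
      case (Suc i)
      then have "8 * B (Suc i) * u (Suc i) > 1"
        using not_less_Least[of i "\<lambda>k. 8 * B (Suc k) * u (Suc k) \<le> 1"]
        by (simp add: j_def [symmetric] not_le)
      then show ?thesis using long[of i] Suc by simp
    qed
    show "8 * B (Suc j) * (\<Prod>l<Suc j. (a l)\<^sup>2) \<le> 1" using j by (simp only: u_def)
  qed simp
qed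

section \<open>Discrepancies in terms of test functions\<close>

text \<open>
  \<open>\<psi> (\<integral>\<phi>(f) dp)\<close> is a generalised mean of \<open>f\<close> under \<open>p\<close>: the ordinary mean for \<open>\<phi> = \<psi> = id\<close>, the cumulant generating
  functional \<open>ln (\<integral>exp(f) dp)\<close> for \<open>\<phi> = exp\<close> and \<open>\<psi> = ln\<close>.
\<close>

definition mean_bound ::
    "(real \<Rightarrow> real) \<Rightarrow> (real \<Rightarrow> real) \<Rightarrow> real set \<Rightarrow> real \<Rightarrow> 'b::topological_space measure \<Rightarrow> 'b measure \<Rightarrow> bool" where
  "mean_bound \<phi> \<psi> I c q p \<longleftrightarrow>
     (\<forall>f\<in>borel_measurable borel. range f \<subseteq> I \<longrightarrow> (\<integral>x. f x \<partial>q) \<le> c + \<psi> (\<integral>x. \<phi> (f x) \<partial>p))"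

lemma nn_integral_layer_cake:
  fixes f :: "'b::topological_space \<Rightarrow> real"
  assumes "prob_space q" and sets [measurable_cong]: "sets q = sets borel"
    and f [measurable]: "f \<in> borel_measurable borel" and "range f \<subseteq> {0..1}"
  shows "(\<integral>\<^sup>+x. ennreal (f x) \<partial>q) = (\<integral>\<^sup>+t. emeasure q {x. t < f x} * indicator {0..1} t \<partial>lborel)"
proof -
  interpret q: prob_space q by fact
  interpret P: pair_sigma_finite "lborel :: real measure" q ..
  have f01: "0 \<le> f x" "f x \<le> 1" for x using assms(4) by (auto simp: image_subset_iff)
  have space: "space q = UNIV" using sets_eq_imp_space_eq[OF sets] by simp
  have "(\<integral>\<^sup>+x. ennreal (f x) \<partial>q) = (\<integral>\<^sup>+x. (\<integral>\<^sup>+t. (if 0 \<le> t \<and> t < f x then 1 else 0) \<partial>lborel) \<partial>q)"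
  proof (rule nn_integral_cong)
    fix x
    have "(\<integral>\<^sup>+t. (if 0 \<le> t \<and> t < f x then 1 else 0) \<partial>lborel) = (\<integral>\<^sup>+t. indicator {0..<f x} t \<partial>lborel)"
      by (intro nn_integral_cong) auto
    then show "ennreal (f x) = (\<integral>\<^sup>+t. (if 0 \<le> t \<and> t < f x then 1 else 0) \<partial>lborel)"
      using f01[of x] by simp
  qed
  also have "\<dots> = (\<integral>\<^sup>+t. (\<integral>\<^sup>+x. (if 0 \<le> t \<and> t < f x then 1 else 0) \<partial>q) \<partial>lborel)"
    by (rule P.Fubini') measurable
  also have "\<dots> = (\<integral>\<^sup>+t. emeasure q {x. t < f x} * indicator {0..1} t \<partial>lborel)"
  proof (rule nn_integral_cong)
    fix t
    have [measurable]: "{x. t < f x} \<in> sets q" unfolding sets by measurable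
    show "(\<integral>\<^sup>+x. (if 0 \<le> t \<and> t < f x then 1 else 0) \<partial>q) = emeasure q {x. t < f x} * indicator {0..1} t"
    proof (cases "0 \<le> t \<and> t \<le> 1")
      case True
      then have "(\<integral>\<^sup>+x. (if 0 \<le> t \<and> t < f x then 1 else 0) \<partial>q) = (\<integral>\<^sup>+x. indicator {x. t < f x} x \<partial>q)"
        by (intro nn_integral_cong) auto
      then show ?thesis using True by simp
    next
      case False
      then have "(if 0 \<le> t \<and> t < f x then 1 else 0 :: ennreal) = 0" for x using f01(2)[of x] by auto
      then show ?thesis using False by simp
    qed
  qed
  finally show ?thesis .
qed

text \<open>
  Indicators as test functions give the deviation on single sets; conversely the layer-cake formula writes a test function with
  values in \<open>[0, 1]\<close> as an average of indicators.
\<close>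

lemma tv_dist_le_iff:
  assumes q: "prob_space q" and p: "prob_space p"
    and sets [measurable_cong]: "sets q = sets borel" "sets p = sets borel"
  shows "tv_dist q p \<le> ereal c \<longleftrightarrow> mean_bound id id {0..1} c q p"
proof
  interpret q: prob_space q by fact
  interpret p: prob_space p by fact
  have space: "space q = UNIV" "space p = UNIV"
    using sets_eq_imp_space_eq[OF sets(1)] sets_eq_imp_space_eq[OF sets(2)] by simp_all
  {
    assume tv: "tv_dist q p \<le> ereal c"
    have dev: "\<bar>measure q A - measure p A\<bar> \<le> c" if "A \<in> sets borel" for A
    proof -
      have "ereal \<bar>measure q A - measure p A\<bar> \<le> tv_dist q p"
        unfolding tv_dist_def by (rule SUP_upper) (simp add: sets that)
      then show ?thesis using tv order_trans by fastforce
    qed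
    then have set: "measure q A \<le> measure p A + c" if "A \<in> sets borel" for A
      using dev[OF that] by linarith
    have c: "0 \<le> c" using dev[of "{}"] by simp
    show "mean_bound id id {0..1} c q p"
      unfolding mean_bound_def
    proof (intro ballI impI)
      fix f :: "'a \<Rightarrow> real" assume f [measurable]: "f \<in> borel_measurable borel" and r: "range f \<subseteq> {0..1}"
      have f01: "0 \<le> f x" "f x \<le> 1" for x using r by (auto simp: image_subset_iff)
      have "(\<integral>\<^sup>+x. ennreal (f x) \<partial>q) = (\<integral>\<^sup>+t. emeasure q {x. t < f x} * indicator {0..1} t \<partial>lborel)"
        by (rule nn_integral_layer_cake[OF q sets(1) f r])
      also have "\<dots> \<le> (\<integral>\<^sup>+t. emeasure p {x. t < f x} * indicator {0..1} t + ennreal c * indicator {0..1} t \<partial>lborel)"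
      proof (rule nn_integral_mono)
        fix t
        have "emeasure q {x. t < f x} \<le> emeasure p {x. t < f x} + ennreal c"
          using set[of "{x. t < f x}"] c
          by (simp add: q.emeasure_eq_measure p.emeasure_eq_measure ennreal_plus [symmetric] del: ennreal_plus)
        then show "emeasure q {x. t < f x} * indicator {0..1} t \<le> emeasure p {x. t < f x} * indicator {0..1} t + ennreal c * indicator {0..1} t"
          by (auto split: split_indicator)
      qed
      also have "\<dots> = (\<integral>\<^sup>+x. ennreal (f x) \<partial>p) + ennreal c"
      proof (subst nn_integral_add)
        have "(\<lambda>t. emeasure p {x. t < f x}) = (\<lambda>t. emeasure p (Pair t -` {z \<in> space (lborel \<Otimes>\<^sub>M p). fst z < f (snd z)}))"
          by (simp add: space_pair_measure space)
        also have "\<dots> \<in> borel_measurable lborel"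
          by (rule p.measurable_emeasure_Pair) measurable
        finally show "(\<lambda>t. emeasure p {x. t < f x} * indicator {0..1} t) \<in> borel_measurable lborel" by measurable
      qed (simp_all add: nn_integral_layer_cake[OF p sets(2) f r] nn_integral_cmult)
      finally have "(\<integral>\<^sup>+x. ennreal (f x) \<partial>q) \<le> (\<integral>\<^sup>+x. ennreal (f x) \<partial>p) + ennreal c" .
      moreover have int: "integrable q f" "integrable p f"
        using f01 by (auto intro!: q.integrable_const_bound[of _ 1] p.integrable_const_bound[of _ 1])
      ultimately have "ennreal (\<integral>x. f x \<partial>q) \<le> ennreal ((\<integral>x. f x \<partial>p) + c)"
        using f01 c by (simp add: nn_integral_eq_integral ennreal_plus)
      then show "(\<integral>x. f x \<partial>q) \<le> c + id (\<integral>x. id (f x) \<partial>p)"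
        using f01 c by (subst (asm) ennreal_le_iff) (simp_all add: add.commute)
    qed
  }
  {
    assume m: "mean_bound id id {0..1} c q p"
    show "tv_dist q p \<le> ereal c"
      unfolding tv_dist_def
    proof (rule SUP_least)
      fix A assume "A \<in> sets p"
      then have A [measurable]: "A \<in> sets borel" by (simp add: sets)
      have le: "measure q C \<le> c + measure p C" if [measurable]: "C \<in> sets borel" for C
      proof -
        have "(indicator C :: 'a \<Rightarrow> real) \<in> borel_measurable borel" "range (indicator C :: 'a \<Rightarrow> real) \<subseteq> {0..1}"
          using that by (auto simp: indicator_def)
        with m have "(\<integral>x. indicator C x \<partial>q) \<le> c + id (\<integral>x. id (indicator C x) \<partial>p)"
          unfolding mean_bound_def by blast
        then show ?thesis using that by (simp add: sets)
      qed
      have "measure q (UNIV - A) = 1 - measure q A" "measure p (UNIV - A) = 1 - measure p A"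
        using q.prob_compl[of A] p.prob_compl[of A] A by (auto simp: space sets)
      with le[OF A] le[of "UNIV - A"] show "ereal \<bar>measure q A - measure p A\<bar> \<le> ereal c"
        by (auto simp: abs_le_iff)
    qed
  }
qed

lemma absolutely_continuous_density:
  assumes q: "prob_space q" and p: "prob_space p" and sets: "sets q = sets p"
    and ac: "absolutely_continuous p q"
  obtains r where "r \<in> borel_measurable p" "\<And>x. 0 \<le> r x" "q = density p (\<lambda>x. ennreal (r x))"
    "entropy_density (exp 1) p q = (\<lambda>x. ln (r x))"
proof
  interpret q: prob_space q by fact
  interpret p: prob_space p by fact
  let ?r = "\<lambda>x. enn2real (RN_deriv p q x)"
  have "AE x in p. RN_deriv p q x \<noteq> \<infinity>"
    using p.RN_deriv_finite[OF _ ac] sets q.sigma_finite_measure_axioms by auto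
  then have "density p (\<lambda>x. ennreal (?r x)) = density p (RN_deriv p q)"
    by (intro density_cong) (auto simp: less_top)
  also have "\<dots> = q" by (rule p.density_RN_deriv[OF ac sets])
  finally show "q = density p (\<lambda>x. ennreal (?r x))" ..
  show "entropy_density (exp 1) p q = (\<lambda>x. ln (?r x))"
    by (simp add: entropy_density_def log_def fun_eq_iff)
qed simp_all

text \<open>
  The Donsker-Varadhan formula.  For the density \<open>r = dq/dp\<close>, integrating \<open>ln t \<le> t - 1\<close> at \<open>t = exp(f) / (r \<integral>exp(f) dp)\<close>
  against \<open>q\<close> gives \<open>\<integral>f dq - ln (\<integral>exp(f) dp) \<le> \<integral>ln r dq\<close>.  Conversely, the multiples of the indicator of a \<open>p\<close>-null set force \<open>q\<close>
  to vanish on it, and the truncations of \<open>ln r\<close> are test functions for which the right-hand side tends to \<open>c\<close>.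
\<close>

lemma kl_div_le_iff:
  assumes q: "prob_space q" and p: "prob_space p"
    and sets: "sets q = sets borel" "sets p = sets borel"
  shows "kl_div q p \<le> ereal c \<longleftrightarrow> (\<forall>b. mean_bound exp ln {-b..b} c q p)"
proof
  note [measurable_cong] = sets
  interpret q: prob_space q by fact
  interpret p: prob_space p by fact
  have space: "space q = UNIV" "space p = UNIV"
    using sets_eq_imp_space_eq[OF sets(1)] sets_eq_imp_space_eq[OF sets(2)] by simp_all
  {
    assume kl: "kl_div q p \<le> ereal c"
    then have ac: "absolutely_continuous p q" and int: "integrable q (entropy_density (exp 1) p q)"
      and le: "(\<integral>x. entropy_density (exp 1) p q x \<partial>q) \<le> c"
      by (auto simp: kl_div_def KL_divergence_def split: if_splits)
    obtain r where rm: "r \<in> borel_measurable p" and r0: "\<And>x. 0 \<le> r x" and q_eq: "q = density p (\<lambda>x. ennreal (r x))"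
      and ent: "entropy_density (exp 1) p q = (\<lambda>x. ln (r x))"
      using absolutely_continuous_density[OF q p _ ac] sets by auto
    have r [measurable]: "r \<in> borel_measurable borel" using rm unfolding measurable_cong_sets[OF sets(2) refl] .
    show "\<forall>b. mean_bound exp ln {-b..b} c q p"
      unfolding mean_bound_def
    proof (intro allI ballI impI)
      fix b and f :: "'a \<Rightarrow> real" assume f [measurable]: "f \<in> borel_measurable borel" and b: "range f \<subseteq> {- b..b}"
      have fb: "\<bar>f x\<bar> \<le> b" for x
      proof -
        have "f x \<in> {- b..b}" using b by blast
        then show ?thesis by (simp add: abs_le_iff)
      qed
      have fb': "- b \<le> f x" "f x \<le> b" for x using fb[of x] by linarith+
      have intf: "integrable q f" using fb by (intro q.integrable_const_bound[of _ b]) simp_all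
      have inte: "integrable p (\<lambda>x. exp (f x))"
        using fb' by (intro p.integrable_const_bound[of _ "exp b"]) simp_all
      define Z where "Z = (\<integral>x. exp (f x) \<partial>p)"
      have Z: "0 < Z"
      proof -
        have "(\<integral>x. exp (- b) \<partial>p) \<le> Z"
          unfolding Z_def using fb' inte by (intro integral_mono) simp_all
        then have "exp (- b) \<le> Z" by (simp add: p.prob_space)
        then show ?thesis using exp_gt_zero[of "- b"] by linarith
      qed
      let ?g = "\<lambda>x. exp (f x) / (Z * r x)"
      \<comment> \<open>division by \<open>0\<close> yields \<open>0\<close>, so \<open>?g\<close> vanishes where \<open>r\<close> does\<close>
      have rg: "r x *\<^sub>R ?g x = exp (f x) / Z * indicator {x. 0 < r x} x" for x
        using r0[of x] Z by (auto simp: field_simps split: split_indicator)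
      have int': "integrable p (\<lambda>x. r x *\<^sub>R ?g x)"
      proof (rule Bochner_Integration.integrable_bound[where f = "\<lambda>x. exp (f x) / Z"])
        show "AE x in p. norm (r x *\<^sub>R ?g x) \<le> norm (exp (f x) / Z)"
          unfolding rg by (auto split: split_indicator)
      qed (use inte in auto)
      have intg: "integrable q ?g"
        unfolding q_eq using r0 int' by (subst integrable_density) auto
      have "(\<integral>x. ?g x \<partial>q) = (\<integral>x. r x *\<^sub>R ?g x \<partial>p)"
        unfolding q_eq using r0 by (intro integral_density) auto
      also have "\<dots> \<le> (\<integral>x. exp (f x) / Z \<partial>p)"
        using int' inte Z by (intro integral_mono) (auto simp: rg split: split_indicator)
      also have "\<dots> = 1" using Z by (simp add: Z_def)
      finally have g1: "(\<integral>x. ?g x \<partial>q) \<le> 1" .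
      have "AE x in q. 0 < r x" unfolding q_eq by (subst AE_density) auto
      then have "AE x in q. f x - ln Z - ln (r x) \<le> ?g x - 1"
      proof (rule eventually_mono)
        fix x assume rx: "0 < r x"
        have "ln (?g x) \<le> ?g x - 1" using rx Z by (intro ln_le_minus_one) simp
        moreover have "ln (?g x) = f x - ln Z - ln (r x)" using rx Z by (simp add: ln_div ln_mult)
        ultimately show "f x - ln Z - ln (r x) \<le> ?g x - 1" by simp
      qed
      then have "(\<integral>x. f x - ln Z - ln (r x) \<partial>q) \<le> (\<integral>x. ?g x - 1 \<partial>q)"
        using intf intg int[unfolded ent] by (intro integral_mono_AE) auto
      then have "(\<integral>x. f x \<partial>q) - ln Z - (\<integral>x. ln (r x) \<partial>q) \<le> (\<integral>x. ?g x \<partial>q) - 1"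
        using intf intg int[unfolded ent] by (simp add: q.prob_space)
      then show "(\<integral>x. f x \<partial>q) \<le> c + ln (\<integral>x. exp (f x) \<partial>p)"
        using g1 le[unfolded ent] by (simp add: Z_def)
    qed
  }
  {
    assume m: "\<forall>b. mean_bound exp ln {-b..b} c q p"
    have test: "(\<integral>x. f x \<partial>q) \<le> c + ln (\<integral>x. exp (f x) \<partial>p)"
      if "f \<in> borel_measurable borel" "\<And>x. \<bar>f x\<bar> \<le> b" for f b
    proof -
      have "range f \<subseteq> {- b..b}"
      proof (rule image_subsetI)
        show "f x \<in> {- b..b}" for x using that(2)[of x] by (simp add: abs_le_iff)
      qed
      then show ?thesis using m[rule_format, of b] that(1) unfolding mean_bound_def by blast
    qed
    have ac: "absolutely_continuous p q"
      unfolding absolutely_continuous_def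
    proof
      fix A assume A: "A \<in> null_sets p"
      then have [measurable]: "A \<in> sets borel" by (auto simp: null_sets_def sets)
      have le: "real n * measure q A \<le> c" for n
      proof -
        have "(\<integral>x. exp (real n * indicator A x) \<partial>p) = (\<integral>x. 1 \<partial>p)"
        proof (rule integral_cong_AE)
          show "AE x in p. exp (real n * indicator A x) = (1 :: real)"
            using AE_not_in[OF A] by (rule eventually_mono) simp
        qed measurable
        then have "(\<integral>x. exp (real n * indicator A x) \<partial>p) = 1" by (simp add: p.prob_space)
        with test[of "\<lambda>x. real n * indicator A x" "real n"] show ?thesis
          by (simp add: abs_mult sets split: split_indicator)
      qed
      have "measure q A = 0"
      proof (rule ccontr)
        assume "measure q A \<noteq> 0"
        then have "0 < measure q A" by (simp add: zero_less_measure_iff)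
        moreover obtain n where "c / measure q A < real n" using reals_Archimedean2 by blast
        ultimately show False using le[of n] by (simp add: divide_less_eq)
      qed
      then show "A \<in> null_sets q" by (simp add: null_sets_def sets q.emeasure_eq_measure)
    qed
    obtain r where rm: "r \<in> borel_measurable p" and r0: "\<And>x. 0 \<le> r x" and q_eq: "q = density p (\<lambda>x. ennreal (r x))"
      and ent: "entropy_density (exp 1) p q = (\<lambda>x. ln (r x))"
      using absolutely_continuous_density[OF q p _ ac] sets by auto
    have r [measurable]: "r \<in> borel_measurable borel" using rm unfolding measurable_cong_sets[OF sets(2) refl] .
    have rpos: "AE x in q. 0 < r x" unfolding q_eq by (subst AE_density) auto
    have intr: "integrable p r" and int_r: "(\<integral>x. r x \<partial>p) = 1"
    proof -
      have nn: "(\<integral>\<^sup>+x. ennreal (r x) \<partial>p) = 1"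
        using q.emeasure_space_1 unfolding q_eq by (simp add: emeasure_density space)
      then show "integrable p r" using r0 by (intro integrableI_nonneg) auto
      then show "(\<integral>x. r x \<partial>p) = 1" using nn r0 by (simp add: nn_integral_eq_integral)
    qed
    \<comment> \<open>the negative part of \<open>ln r\<close> is \<open>q\<close>-integrable, because \<open>- r ln r \<le> 1\<close>\<close>
    define N where "N x = max 0 (- ln (r x))" for x
    have N [measurable]: "N \<in> borel_measurable borel" unfolding N_def by measurable
    have intN: "integrable q N"
    proof -
      have "integrable p (\<lambda>x. r x *\<^sub>R N x)"
      proof (rule p.integrable_const_bound[of _ 1])
        show "AE x in p. norm (r x *\<^sub>R N x) \<le> 1"
        proof (rule AE_I2)
          fix x
          show "norm (r x *\<^sub>R N x) \<le> 1"
          proof (cases "r x = 0")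
            case False
            then have "0 < r x" using r0[of x] by simp
            then have "- ln (r x) \<le> 1 / r x"
              using ln_le_minus_one[of "1 / r x"] by (simp add: ln_div)
            then have "N x \<le> 1 / r x" using \<open>0 < r x\<close> by (simp add: N_def)
            moreover have "0 \<le> N x" by (simp add: N_def)
            ultimately show ?thesis using \<open>0 < r x\<close> by (simp add: field_simps)
          qed simp
        qed
      qed measurable
      then show ?thesis unfolding q_eq using r0 by (subst integrable_density) auto
    qed
    \<comment> \<open>\<open>\<integral>exp (f n) dp \<le> 1 + 1 / (n + 1)\<close>, as \<open>r\<close> has integral \<open>1\<close> and the lower truncation adds at most \<open>1 / (n + 1)\<close>\<close>
    define f where "f n x = ln (max (1 / real (Suc n)) (min (real (Suc n)) (r x)))" for n x
    have f [measurable]: "f n \<in> borel_measurable borel" for n unfolding f_def by measurable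
    have clamp: "1 / real (Suc n) \<le> max (1 / real (Suc n)) (min (real (Suc n)) t)"
      "max (1 / real (Suc n)) (min (real (Suc n)) t) \<le> real (Suc n)" for n t
    proof -
      have "1 / real (Suc n) \<le> 1" "1 \<le> real (Suc n)" by simp_all
      then have "1 / real (Suc n) \<le> real (Suc n)" by (rule order_trans)
      then show "1 / real (Suc n) \<le> max (1 / real (Suc n)) (min (real (Suc n)) t)"
        "max (1 / real (Suc n)) (min (real (Suc n)) t) \<le> real (Suc n)"
        by (simp_all del: of_nat_Suc)
    qed
    have clamp_pos: "0 < max (1 / real (Suc n)) (min (real (Suc n)) t)" for n t
      by (rule less_le_trans[OF _ clamp(1)]) simp
    have fb: "\<bar>f n x\<bar> \<le> ln (real (Suc n))" for n x
    proof -
      have "ln (1 / real (Suc n)) \<le> f n x" "f n x \<le> ln (real (Suc n))"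
        unfolding f_def using clamp[of n "r x"] clamp_pos[of n "r x"]
        by (intro ln_mono; simp del: of_nat_Suc)+
      then show ?thesis by (simp add: ln_div abs_le_iff)
    qed
    have intf: "integrable q (f n)" for n
      using fb by (auto intro!: q.integrable_const_bound[of _ "ln (real (Suc n))"])
    have fle: "(\<integral>x. f n x \<partial>q) \<le> c + 1 / real (Suc n)" for n
    proof -
      have exp_f: "exp (f n x) = max (1 / real (Suc n)) (min (real (Suc n)) (r x))" for x
      proof -
        have "0 < 1 / real (Suc n)" by simp
        then show ?thesis unfolding f_def using clamp(1)[of n "r x"] by (intro exp_ln) linarith
      qed
      have inte: "integrable p (\<lambda>x. exp (f n x))"
        unfolding exp_f using clamp[of n] less_imp_le[OF clamp_pos[of n]]
        by (intro p.integrable_const_bound[of _ "real (Suc n)"])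
           (simp_all only: real_norm_def abs_of_nonneg AE_I2, measurable)
      have "(\<integral>x. exp (f n x) \<partial>p) \<le> (\<integral>x. r x + 1 / real (Suc n) \<partial>p)"
      proof (rule integral_mono)
        fix x
        have "min (real (Suc n)) (r x) \<le> r x" "0 \<le> 1 / real (Suc n)" by simp_all
        then have "min (real (Suc n)) (r x) \<le> r x + 1 / real (Suc n)" by linarith
        then show "exp (f n x) \<le> r x + 1 / real (Suc n)"
          unfolding exp_f using r0[of x] by (intro max.boundedI) (simp_all del: of_nat_Suc)
      qed (use inte intr in simp_all)
      also have "\<dots> = 1 + 1 / real (Suc n)" using intr by (simp add: int_r p.prob_space del: of_nat_Suc)
      finally have 1: "(\<integral>x. exp (f n x) \<partial>p) \<le> 1 + 1 / real (Suc n)" .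
      have "(\<integral>x. 1 / real (Suc n) \<partial>p) \<le> (\<integral>x. exp (f n x) \<partial>p)"
        using inte clamp(1)[of n] by (intro integral_mono) (auto simp: exp_f simp del: of_nat_Suc)
      then have "1 / real (Suc n) \<le> (\<integral>x. exp (f n x) \<partial>p)" by (simp add: p.prob_space del: of_nat_Suc)
      then have "0 < (\<integral>x. exp (f n x) \<partial>p)" by (smt (verit) of_nat_0_less_iff zero_less_Suc zero_less_divide_1_iff)
      then have "ln (\<integral>x. exp (f n x) \<partial>p) \<le> 1 / real (Suc n)"
        using 1 ln_le_minus_one[of "\<integral>x. exp (f n x) \<partial>p"] by linarith
      with test[OF f fb, of n] show ?thesis by linarith
    qed
    have gN: "0 \<le> f n x + N x" if "0 < r x" for n x
    proof (cases "r x \<le> 1")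
      case True
      have "r x \<le> max (1 / real (Suc n)) (min (real (Suc n)) (r x))" using True by auto
      then have "ln (r x) \<le> f n x" unfolding f_def using that by (intro ln_mono) auto
      then show ?thesis by (simp add: N_def)
    next
      case False
      then have "1 \<le> max (1 / real (Suc n)) (min (real (Suc n)) (r x))" by auto
      then have "0 \<le> f n x" unfolding f_def by (rule ln_ge_zero)
      then show ?thesis by (simp add: N_def)
    qed
    have lim: "(\<lambda>n. ennreal (f n x + N x)) \<longlonglongrightarrow> ennreal (ln (r x) + N x)" if rx: "0 < r x" for x
    proof -
      obtain n0 where n0: "1 / r x + r x < real n0" using reals_Archimedean2 by blast
      have "f n x = ln (r x)" if "n0 \<le> n" for n
      proof -
        have n: "1 / r x + r x < real (Suc n)" using n0 that by linarith
        moreover have "0 < 1 / r x" using rx by simp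
        ultimately have "r x < real (Suc n)" "1 / r x < real (Suc n)" using rx by linarith+
        then have "1 / real (Suc n) < r x" using rx by (simp add: field_simps del: of_nat_Suc)
        then show ?thesis using \<open>r x < real (Suc n)\<close> by (simp add: f_def)
      qed
      then have "\<forall>n\<ge>n0. ennreal (f n x + N x) = ennreal (ln (r x) + N x)" by simp
      then show ?thesis by (intro tendsto_eventually) (auto simp: eventually_sequentially)
    qed
    \<comment> \<open>adding \<open>N\<close> makes the truncations nonnegative, so that Fatou's lemma applies; the added mass is finite\<close>
    have inverse_n: "(\<lambda>n. 1 / real (Suc n)) \<longlonglongrightarrow> 0"
      using LIMSEQ_inverse_real_of_nat by (simp add: inverse_eq_divide)
    have "(\<integral>\<^sup>+x. ennreal (ln (r x) + N x) \<partial>q) = (\<integral>\<^sup>+x. liminf (\<lambda>n. ennreal (f n x + N x)) \<partial>q)"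
    proof (rule nn_integral_cong_AE, rule eventually_mono[OF rpos])
      show "ennreal (ln (r x) + N x) = liminf (\<lambda>n. ennreal (f n x + N x))" if "0 < r x" for x
        using lim_imp_Liminf[OF trivial_limit_sequentially lim[OF that]] by simp
    qed
    also have "\<dots> \<le> liminf (\<lambda>n. \<integral>\<^sup>+x. ennreal (f n x + N x) \<partial>q)"
      by (rule nn_integral_liminf) measurable
    also have "\<dots> \<le> liminf (\<lambda>n. ennreal (c + 1 / real (Suc n) + (\<integral>x. N x \<partial>q)))"
    proof (intro Liminf_mono always_eventually allI)
      fix n
      have "(\<integral>\<^sup>+x. ennreal (f n x + N x) \<partial>q) = ennreal (\<integral>x. f n x + N x \<partial>q)"
        by (intro nn_integral_eq_integral Bochner_Integration.integrable_add intf intN eventually_mono[OF rpos gN])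
      also have "(\<integral>x. f n x + N x \<partial>q) \<le> c + 1 / real (Suc n) + (\<integral>x. N x \<partial>q)"
        using intf intN fle[of n] by simp
      finally show "(\<integral>\<^sup>+x. ennreal (f n x + N x) \<partial>q) \<le> ennreal (c + 1 / real (Suc n) + (\<integral>x. N x \<partial>q))"
        by (auto intro: ennreal_leI)
    qed
    also have "\<dots> = ennreal (c + 0 + (\<integral>x. N x \<partial>q))"
      by (rule lim_imp_Liminf[OF trivial_limit_sequentially])
         (intro tendsto_ennrealI tendsto_add tendsto_const inverse_n)
    finally have fin: "(\<integral>\<^sup>+x. ennreal (ln (r x) + N x) \<partial>q) \<le> ennreal (c + (\<integral>x. N x \<partial>q))" by simp
    have P0: "0 \<le> ln (r x) + N x" for x by (simp add: N_def)
    have intP: "integrable q (\<lambda>x. ln (r x) + N x)"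
      using fin P0 by (intro integrableI_nonneg) (auto intro: le_less_trans)
    have intl: "integrable q (\<lambda>x. ln (r x))"
      using Bochner_Integration.integrable_diff[OF intP intN] by simp
    have c0: "0 \<le> c + (\<integral>x. N x \<partial>q)"
    proof -
      have "0 \<le> c + 1 / real (Suc n) + (\<integral>x. N x \<partial>q)" for n
      proof -
        have "0 \<le> (\<integral>x. f n x + N x \<partial>q)"
          by (rule integral_nonneg_AE[OF eventually_mono[OF rpos gN]])
        also have "\<dots> = (\<integral>x. f n x \<partial>q) + (\<integral>x. N x \<partial>q)"
          by (rule Bochner_Integration.integral_add[OF intf intN])
        finally show ?thesis using fle[of n] by linarith
      qed
      moreover have "(\<lambda>n. c + 1 / real (Suc n) + (\<integral>x. N x \<partial>q)) \<longlonglongrightarrow> c + 0 + (\<integral>x. N x \<partial>q)"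
        by (intro tendsto_add tendsto_const inverse_n)
      ultimately have "0 \<le> c + 0 + (\<integral>x. N x \<partial>q)"
        by (intro LIMSEQ_le_const) auto
      then show ?thesis by simp
    qed
    have "ennreal (\<integral>x. ln (r x) + N x \<partial>q) \<le> ennreal (c + (\<integral>x. N x \<partial>q))"
      using fin P0 intP by (simp add: nn_integral_eq_integral)
    then have "(\<integral>x. ln (r x) \<partial>q) \<le> c"
      using c0 intl intN by (simp add: ennreal_le_iff)
    then show "kl_div q p \<le> ereal c"
      using ac intl by (simp add: kl_div_def KL_divergence_def ent)
  }
qed

section \<open>Composition of Markov kernels\<close>

lemma integral_bind_bounded:
  fixes f :: "'b::topological_space \<Rightarrow> real" and q :: "'b measure"
  assumes q: "q \<in> space (prob_algebra borel)" and k: "k \<in> borel \<rightarrow>\<^sub>M prob_algebra borel"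
    and f [measurable]: "f \<in> borel_measurable borel" and bound: "\<And>x. \<bar>f x\<bar> \<le> b"
  shows "(\<integral>x. f x \<partial>(q \<bind> k)) = (\<integral>y. (\<integral>x. f x \<partial>k y) \<partial>q)"
proof -
  note [measurable] = measurable_prob_algebraD[OF k]
  have sq [measurable_cong]: "sets q = sets borel" and pq: "prob_space q"
    using q by (auto simp: space_prob_algebra)
  have sk [measurable_cong]: "sets (k y) = sets borel" and pk: "prob_space (k y)" for y
    using measurable_space[OF k, of y] by (auto simp: space_prob_algebra)
  have sb [measurable_cong]: "sets (q \<bind> k) = sets borel" by (rule sets_bind'[OF q k])
  interpret q: prob_space q by (rule pq)
  interpret k: prob_space "k y" for y by (rule pk)
  interpret b: prob_space "q \<bind> k" by (rule prob_space_bind'[OF q k])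
  define g where "g x = f x + b" for x
  have g [measurable]: "g \<in> borel_measurable borel" unfolding g_def by measurable
  have g0: "0 \<le> g x" and g1: "g x \<le> 2 * b" for x
    using bound[of x] by (auto simp: g_def abs_le_iff)
  have int: "integrable M h" if "prob_space M" "sets M = sets borel" "h \<in> borel_measurable borel" "\<And>x. \<bar>h x\<bar> \<le> c" for M :: "'b measure" and h :: "'b \<Rightarrow> real" and c
  proof -
    interpret M: prob_space M by fact
    show ?thesis
      by (rule M.integrable_const_bound[of _ c]) (use that in \<open>simp_all cong: measurable_cong_sets\<close>)
  qed
  have inner: "(\<integral>x. g x \<partial>k y) = (\<integral>x. f x \<partial>k y) + b" for y
    using int[OF pk sk f bound, of y] by (simp add: g_def k.prob_space)
  have meas: "(\<lambda>y. \<integral>x. f x \<partial>k y) \<in> borel_measurable borel"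
    by (rule measurable_compose[OF measurable_prob_algebraD[OF k] integral_measurable_subprob_algebra[OF f]])
  have inner_le: "\<bar>\<integral>x. f x \<partial>k y\<bar> \<le> b" for y
  proof -
    have "\<bar>\<integral>x. f x \<partial>k y\<bar> \<le> (\<integral>x. \<bar>f x\<bar> \<partial>k y)" by (rule integral_abs_bound)
    also have "\<dots> \<le> (\<integral>x. b \<partial>k y)"
      using bound int[OF pk sk f bound, of y] by (intro integral_mono) auto
    finally show ?thesis by (simp add: k.prob_space)
  qed
  have inner_nonneg: "0 \<le> (\<integral>x. f x \<partial>k y) + b" for y using inner_le[of y] by linarith
  have gint: "integrable M g" if "prob_space M" "sets M = sets borel" for M
    by (rule int[OF that g, of "2 * b"]) (use g0 g1 in auto)
  have "ennreal (\<integral>x. g x \<partial>(q \<bind> k)) = (\<integral>\<^sup>+x. ennreal (g x) \<partial>(q \<bind> k))"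
    using gint[OF b.prob_space_axioms sb] g0 by (simp add: nn_integral_eq_integral)
  also have "\<dots> = (\<integral>\<^sup>+y. (\<integral>\<^sup>+x. ennreal (g x) \<partial>k y) \<partial>q)"
    by (rule nn_integral_bind) measurable
  also have "\<dots> = (\<integral>\<^sup>+y. ennreal ((\<integral>x. f x \<partial>k y) + b) \<partial>q)"
    using gint[OF pk sk] g0 by (simp add: nn_integral_eq_integral inner)
  also have "\<dots> = ennreal (\<integral>y. (\<integral>x. f x \<partial>k y) + b \<partial>q)"
    using int[OF pq sq meas inner_le] inner_nonneg
    by (intro nn_integral_eq_integral) auto
  finally have "ennreal (\<integral>x. g x \<partial>(q \<bind> k)) = ennreal (\<integral>y. (\<integral>x. f x \<partial>k y) + b \<partial>q)" .
  moreover have "0 \<le> (\<integral>x. g x \<partial>(q \<bind> k))" using g0 by simp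
  moreover have "0 \<le> (\<integral>y. (\<integral>x. f x \<partial>k y) + b \<partial>q)"
    by (rule Bochner_Integration.integral_nonneg) (rule inner_nonneg)
  ultimately have "(\<integral>x. g x \<partial>(q \<bind> k)) = (\<integral>y. (\<integral>x. f x \<partial>k y) + b \<partial>q)"
    by (simp add: ennreal_inj)
  then show ?thesis
    using int[OF b.prob_space_axioms sb f bound] int[OF pq sq meas inner_le]
    by (simp add: g_def b.prob_space q.prob_space)
qed

text \<open>
  \<open>\<phi>\<close> maps \<open>{l..u}\<close> into \<open>{\<phi> l..\<phi> u}\<close> with inverse \<open>\<psi>\<close>, so that the generalised mean of a function with values in
  \<open>{l..u}\<close> stays in \<open>{l..u}\<close> and can serve as a test function again.
\<close>

locale generalized_mean =
  fixes \<phi> \<psi> :: "real \<Rightarrow> real" and l u :: real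
  assumes \<phi>_measurable [measurable]: "\<phi> \<in> borel_measurable borel"
    and \<psi>_measurable [measurable]: "\<psi> \<in> borel_measurable borel"
    and \<phi>_in: "\<And>t. t \<in> {l..u} \<Longrightarrow> \<phi> t \<in> {\<phi> l..\<phi> u}"
    and \<psi>_in: "\<And>s. s \<in> {\<phi> l..\<phi> u} \<Longrightarrow> \<psi> s \<in> {l..u}"
    and \<psi>_\<phi>: "\<And>t. t \<in> {l..u} \<Longrightarrow> \<psi> (\<phi> t) = t"
    and \<phi>_\<psi>: "\<And>s. s \<in> {\<phi> l..\<phi> u} \<Longrightarrow> \<phi> (\<psi> s) = s"
begin

lemma domain_bounded: "t \<in> {l..u} \<Longrightarrow> \<bar>t\<bar> \<le> \<bar>l\<bar> + \<bar>u\<bar>"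
  by auto

lemma \<phi>_bounded: "t \<in> {l..u} \<Longrightarrow> \<bar>\<phi> t\<bar> \<le> \<bar>\<phi> l\<bar> + \<bar>\<phi> u\<bar>"
  using \<phi>_in[of t] by auto

lemma
  fixes f :: "'b::topological_space \<Rightarrow> real"
  assumes "prob_space p" and sets: "sets p = sets borel"
    and f: "f \<in> borel_measurable borel" and r: "range f \<subseteq> {l..u}"
  shows mean_in: "\<psi> (\<integral>x. \<phi> (f x) \<partial>p) \<in> {l..u}"
    and \<phi>_mean: "\<phi> (\<psi> (\<integral>x. \<phi> (f x) \<partial>p)) = (\<integral>x. \<phi> (f x) \<partial>p)"
proof -
  interpret prob_space p by fact
  have fI: "f x \<in> {l..u}" for x using r by blast
  have "(\<lambda>x. \<phi> (f x)) \<in> borel_measurable p"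
    using measurable_compose[OF f \<phi>_measurable] sets by (simp cong: measurable_cong_sets)
  then have int: "integrable p (\<lambda>x. \<phi> (f x))"
    using \<phi>_bounded[OF fI] by (intro integrable_const_bound[of _ "\<bar>\<phi> l\<bar> + \<bar>\<phi> u\<bar>"]) auto
  have "(\<integral>x. \<phi> l \<partial>p) \<le> (\<integral>x. \<phi> (f x) \<partial>p)" "(\<integral>x. \<phi> (f x) \<partial>p) \<le> (\<integral>x. \<phi> u \<partial>p)"
    using int \<phi>_in[OF fI] by (intro integral_mono; simp)+
  then have "(\<integral>x. \<phi> (f x) \<partial>p) \<in> {\<phi> l..\<phi> u}" by (simp add: prob_space)
  then show "\<psi> (\<integral>x. \<phi> (f x) \<partial>p) \<in> {l..u}" "\<phi> (\<psi> (\<integral>x. \<phi> (f x) \<partial>p)) = (\<integral>x. \<phi> (f x) \<partial>p)"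
    by (rule \<psi>_in, rule \<phi>_\<psi>)
qed

text \<open>
  Errors add up: integrate the bound for \<open>k' y\<close> over \<open>q\<close>, then use the bound for \<open>q\<close> with the test function
  \<open>h y = \<psi> (\<integral>\<phi>(f) dk(y))\<close>; since \<open>\<phi> (h y) = \<integral>\<phi>(f) dk(y)\<close>, its generalised mean under \<open>p\<close> is that of \<open>f\<close> under \<open>p \<bind> k\<close>.
\<close>

lemma mean_bound_bind:
  fixes q p :: "'b::topological_space measure" and k k' :: "'b \<Rightarrow> 'b measure"
  assumes q: "q \<in> space (prob_algebra borel)" and p: "p \<in> space (prob_algebra borel)"
    and k': "k' \<in> borel \<rightarrow>\<^sub>M prob_algebra borel" and k: "k \<in> borel \<rightarrow>\<^sub>M prob_algebra borel"
    and qp: "mean_bound \<phi> \<psi> {l..u} c q p" and kk: "\<And>y. mean_bound \<phi> \<psi> {l..u} d (k' y) (k y)"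
  shows "mean_bound \<phi> \<psi> {l..u} (c + d) (q \<bind> k') (p \<bind> k)"
  unfolding mean_bound_def
proof (intro ballI impI)
  fix f :: "'b \<Rightarrow> real" assume f [measurable]: "f \<in> borel_measurable borel" and r: "range f \<subseteq> {l..u}"
  have fI: "f x \<in> {l..u}" for x using r by blast
  have pq: "prob_space q" "sets q = sets borel"
    using q by (auto simp: space_prob_algebra)
  have pk: "prob_space (k y)" "sets (k y) = sets borel" for y
    using measurable_space[OF k, of y] by (auto simp: space_prob_algebra)
  have pk': "prob_space (k' y)" "sets (k' y) = sets borel" for y
    using measurable_space[OF k', of y] by (auto simp: space_prob_algebra)
  interpret q: prob_space q by (rule pq)
  define h where "h y = \<psi> (\<integral>x. \<phi> (f x) \<partial>k y)" for y
  have phif: "(\<lambda>x. \<phi> (f x)) \<in> borel_measurable borel" by measurable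
  have h [measurable]: "h \<in> borel_measurable borel"
    unfolding h_def
    by (intro measurable_compose[OF _ \<psi>_measurable]
        measurable_compose[OF measurable_prob_algebraD[OF k] integral_measurable_subprob_algebra[OF phif]])
  have hI: "range h \<subseteq> {l..u}" unfolding h_def using mean_in[OF pk f r] by auto
  have hphi: "\<phi> (h y) = (\<integral>x. \<phi> (f x) \<partial>k y)" for y
    unfolding h_def by (rule \<phi>_mean[OF pk f r])
  have hb: "\<bar>h y\<bar> \<le> \<bar>l\<bar> + \<bar>u\<bar>" for y using hI by (intro domain_bounded) blast
  have meas': "(\<lambda>y. \<integral>x. f x \<partial>k' y) \<in> borel_measurable borel"
    by (rule measurable_compose[OF measurable_prob_algebraD[OF k'] integral_measurable_subprob_algebra[OF f]])
  have inner_le: "\<bar>\<integral>x. f x \<partial>k' y\<bar> \<le> \<bar>l\<bar> + \<bar>u\<bar>" for y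
  proof -
    interpret k': prob_space "k' y" by (rule pk')
    have "integrable (k' y) f"
      using domain_bounded[OF fI] pk'(2)[of y] by (intro k'.integrable_const_bound[of _ "\<bar>l\<bar> + \<bar>u\<bar>"]) (simp_all cong: measurable_cong_sets)
    then have "(\<integral>x. \<bar>f x\<bar> \<partial>k' y) \<le> (\<integral>x. \<bar>l\<bar> + \<bar>u\<bar> \<partial>k' y)"
      using domain_bounded[OF fI] by (intro integral_mono) auto
    then show ?thesis by (intro order_trans[OF integral_abs_bound]) (simp add: k'.prob_space)
  qed
  have int1: "integrable q (\<lambda>y. \<integral>x. f x \<partial>k' y)"
    using inner_le meas' pq(2) by (intro q.integrable_const_bound[of _ "\<bar>l\<bar> + \<bar>u\<bar>"]) (simp_all cong: measurable_cong_sets)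
  have int2: "integrable q h"
    using hb h pq(2) by (intro q.integrable_const_bound[of _ "\<bar>l\<bar> + \<bar>u\<bar>"]) (simp_all cong: measurable_cong_sets)
  have "(\<integral>x. f x \<partial>(q \<bind> k')) = (\<integral>y. (\<integral>x. f x \<partial>k' y) \<partial>q)"
    using domain_bounded[OF fI] by (rule integral_bind_bounded[OF q k' f])
  also have "\<dots> \<le> (\<integral>y. d + h y \<partial>q)"
  proof (rule integral_mono)
    show "(\<integral>x. f x \<partial>k' y) \<le> d + h y" for y
      using kk[of y] f r unfolding mean_bound_def h_def by blast
  qed (use int1 int2 in auto)
  also have "\<dots> = d + (\<integral>y. h y \<partial>q)" using int2 by (simp add: q.prob_space)
  also have "(\<integral>y. h y \<partial>q) \<le> c + \<psi> (\<integral>y. \<phi> (h y) \<partial>p)"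
    using qp h hI unfolding mean_bound_def by blast
  also have "(\<integral>y. \<phi> (h y) \<partial>p) = (\<integral>x. \<phi> (f x) \<partial>(p \<bind> k))"
    unfolding hphi using \<phi>_bounded[OF fI] by (rule integral_bind_bounded[OF p k phif, symmetric])
  finally show "(\<integral>x. f x \<partial>(q \<bind> k')) \<le> c + d + \<psi> (\<integral>x. \<phi> (f x) \<partial>(p \<bind> k))" by simp
qed

end

lemma generalized_mean_id: "generalized_mean id id 0 1"
  by unfold_locales auto

lemma generalized_mean_exp: "generalized_mean exp ln (- b) b"
proof
  fix s :: real assume s: "s \<in> {exp (- b)..exp b}"
  then have pos: "0 < s" using exp_gt_zero[of "- b"] by (simp only: atLeastAtMost_iff) linarith
  then show "exp (ln s) = s" by simp
  show "ln s \<in> {- b..b}"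
    using s pos ln_mono[of "exp (- b)" s] ln_mono[of s "exp b"] by simp
qed auto

text \<open>
  The kernels are applied in the order \<open>\<kappa>\<^sub>j, \<dots>, \<kappa>\<^sub>1\<close>, as in \<^const>\<open>backward_prog\<close>.
\<close>

primrec backward_law :: "(nat \<Rightarrow> 'b \<Rightarrow> 'b measure) \<Rightarrow> nat \<Rightarrow> 'b::topological_space \<Rightarrow> 'b measure" where
  "backward_law \<kappa> 0 = return borel"
| "backward_law \<kappa> (Suc j) = (\<lambda>y. \<kappa> (Suc j) y \<bind> backward_law \<kappa> j)"

lemma backward_law_kernel:
  assumes "\<And>k. k \<in> {1..j} \<Longrightarrow> \<kappa> k \<in> borel \<rightarrow>\<^sub>M prob_algebra borel"
  shows "backward_law \<kappa> j \<in> borel \<rightarrow>\<^sub>M prob_algebra borel"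
  using assms
proof (induction j)
  case 0
  then show ?case by (simp add: measurable_return_prob_space)
next
  case (Suc j)
  then show ?case
    unfolding backward_law.simps by (intro measurable_bind_prob_space[of _ _ borel]) auto
qed

lemma (in generalized_mean) mean_bound_backward_law:
  assumes "\<And>k. k \<in> {1..j} \<Longrightarrow> \<kappa>' k \<in> borel \<rightarrow>\<^sub>M prob_algebra borel"
    and "\<And>k. k \<in> {1..j} \<Longrightarrow> \<kappa> k \<in> borel \<rightarrow>\<^sub>M prob_algebra borel"
    and "\<And>k y. k \<in> {1..j} \<Longrightarrow> mean_bound \<phi> \<psi> {l..u} \<delta> (\<kappa>' k y) (\<kappa> k y)"
  shows "mean_bound \<phi> \<psi> {l..u} (real j * \<delta>) (backward_law \<kappa>' j y) (backward_law \<kappa> j (y :: 'b::topological_space))"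
  using assms(1-3)
proof (induction j arbitrary: y)
  case 0
  show ?case
    unfolding mean_bound_def by (auto simp: integral_return \<psi>_\<phi> image_subset_iff)
next
  case (Suc j)
  have "\<kappa>' (Suc j) y \<in> space (prob_algebra borel)" "\<kappa> (Suc j) y \<in> space (prob_algebra borel)"
    using measurable_space[OF Suc.prems(1)[of "Suc j"], of y] measurable_space[OF Suc.prems(2)[of "Suc j"], of y] by auto
  then have "mean_bound \<phi> \<psi> {l..u} (\<delta> + real j * \<delta>) (backward_law \<kappa>' (Suc j) y) (backward_law \<kappa> (Suc j) y)"
    unfolding backward_law.simps using Suc
    by (intro mean_bound_bind backward_law_kernel) auto
  then show ?case by (simp add: algebra_simps)
qed

lemma discrepancy_backward_law:
  fixes \<kappa> \<kappa>' :: "nat \<Rightarrow> 'b::topological_space \<Rightarrow> 'b measure"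
  assumes D: "D \<in> {tv_dist, kl_div}"
    and \<kappa>': "\<And>k. k \<in> {1..j} \<Longrightarrow> \<kappa>' k \<in> borel \<rightarrow>\<^sub>M prob_algebra borel"
    and \<kappa>: "\<And>k. k \<in> {1..j} \<Longrightarrow> \<kappa> k \<in> borel \<rightarrow>\<^sub>M prob_algebra borel"
    and le: "\<And>k y. k \<in> {1..j} \<Longrightarrow> D (\<kappa>' k y) (\<kappa> k y) \<le> ereal \<delta>"
  shows "D (backward_law \<kappa>' j y) (backward_law \<kappa> j y) \<le> ereal (real j * \<delta>)"
proof -
  have k: "prob_space (\<kappa>' k y)" "sets (\<kappa>' k y) = sets borel" "prob_space (\<kappa> k y)" "sets (\<kappa> k y) = sets borel"
    if "k \<in> {1..j}" for k y
    using measurable_space[OF \<kappa>'[OF that], of y] measurable_space[OF \<kappa>[OF that], of y]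
    by (auto simp: space_prob_algebra)
  have b: "prob_space (backward_law \<kappa>' j y)" "sets (backward_law \<kappa>' j y) = sets borel"
    "prob_space (backward_law \<kappa> j y)" "sets (backward_law \<kappa> j y) = sets borel"
    using measurable_space[OF backward_law_kernel[of j \<kappa>', OF \<kappa>'], of y]
      measurable_space[OF backward_law_kernel[of j \<kappa>, OF \<kappa>], of y]
    by (auto simp: space_prob_algebra)
  from D consider "D = tv_dist" | "D = kl_div" by auto
  then show ?thesis
  proof cases
    case 1
    interpret generalized_mean id id 0 1 by (rule generalized_mean_id)
    have "mean_bound id id {0..1} (real j * \<delta>) (backward_law \<kappa>' j y) (backward_law \<kappa> j y)"
      by (rule mean_bound_backward_law[OF \<kappa>' \<kappa>])
         (use le[unfolded 1] k in \<open>simp_all add: tv_dist_le_iff\<close>)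
    then show ?thesis unfolding 1 by (subst tv_dist_le_iff[OF b(1,3,2,4)])
  next
    case 2
    have "mean_bound exp ln {-m..m} (real j * \<delta>) (backward_law \<kappa>' j y) (backward_law \<kappa> j y)" for m
    proof -
      interpret generalized_mean exp ln "- m" m by (rule generalized_mean_exp)
      show ?thesis
        by (rule mean_bound_backward_law[OF \<kappa>' \<kappa>])
           (use le[unfolded 2] k in \<open>simp_all add: kl_div_le_iff\<close>)
    qed
    then show ?thesis unfolding 2 by (subst kl_div_le_iff[OF b(1,3,2,4)]) blast
  qed
qed

text \<open>
  If each \<open>\<kappa>\<^sub>k\<close> is a backward transition for the marginals \<open>P\<^sub>k\<^sub>+\<^sub>1, P\<^sub>k\<close>, running all of them recovers the first marginal.
\<close>

lemma bind_backward_law: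
  assumes \<kappa>: "\<And>k. k \<in> {1..j} \<Longrightarrow> \<kappa> k \<in> borel \<rightarrow>\<^sub>M prob_algebra borel"
    and P: "\<And>k. k \<in> {1..Suc j} \<Longrightarrow> sets (P k) = sets borel"
    and step: "\<And>k. k \<in> {1..j} \<Longrightarrow> P (Suc k) \<bind> \<kappa> k = P k"
  shows "P (Suc j) \<bind> backward_law \<kappa> j = P 1"
  using assms
proof (induction j)
  case 0
  then show ?case by (simp add: bind_return'')
next
  case (Suc j)
  have "sets (P (Suc (Suc j))) = sets borel" by (rule Suc.prems(2)) simp
  moreover have "\<kappa> (Suc j) \<in> borel \<rightarrow>\<^sub>M subprob_algebra borel"
    by (rule measurable_prob_algebraD[OF Suc.prems(1)]) simp
  ultimately have M1: "\<kappa> (Suc j) \<in> P (Suc (Suc j)) \<rightarrow>\<^sub>M subprob_algebra borel"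
    using measurable_cong_sets[of "P (Suc (Suc j))" borel] by blast
  have "backward_law \<kappa> j \<in> borel \<rightarrow>\<^sub>M prob_algebra borel"
    by (rule backward_law_kernel, rule Suc.prems(1)) simp
  then have M2: "backward_law \<kappa> j \<in> borel \<rightarrow>\<^sub>M subprob_algebra borel"
    by (rule measurable_prob_algebraD)
  have "P (Suc (Suc j)) \<bind> backward_law \<kappa> (Suc j) = (P (Suc (Suc j)) \<bind> \<kappa> (Suc j)) \<bind> backward_law \<kappa> j"
    unfolding backward_law.simps by (rule bind_assoc[OF M1 M2, symmetric])
  also have "\<dots> = P (Suc j) \<bind> backward_law \<kappa> j" using Suc.prems(3)[of "Suc j"] by simp
  also have "\<dots> = P 1" by (rule Suc.IH) (use Suc.prems in auto)
  finally show ?case .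
qed

text \<open>
  The sampling version of \<^const>\<open>backward_law\<close>: stage \<open>k\<close> draws from its kernel by means of the seed \<open>\<omega> k\<close>.
\<close>

primrec backward_run :: "(nat \<Rightarrow> 'b \<Rightarrow> 's \<Rightarrow> 'b) \<Rightarrow> (nat \<Rightarrow> 's) \<Rightarrow> nat \<Rightarrow> 'b \<Rightarrow> 'b" where
  "backward_run draw \<omega> 0 y = y"
| "backward_run draw \<omega> (Suc j) y = backward_run draw \<omega> j (draw (Suc j) y (\<omega> (Suc j)))"

lemma backward_run_cong:
  "(\<And>k. k \<in> {1..j} \<Longrightarrow> \<omega> k = \<omega>' k) \<Longrightarrow> backward_run draw \<omega> j y = backward_run draw \<omega>' j y"
  by (induction j arbitrary: y) auto

lemma backward_run_measurable:
  assumes draw: "\<And>k. k \<in> {1..j} \<Longrightarrow> (\<lambda>(y, s). draw k y s) \<in> borel \<Otimes>\<^sub>M R \<rightarrow>\<^sub>M borel" and "j \<le> K"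
  shows "(\<lambda>(\<omega>, y). backward_run draw \<omega> j y) \<in> (Pi\<^sub>M {1..K} (\<lambda>_. R)) \<Otimes>\<^sub>M borel \<rightarrow>\<^sub>M borel"
  using assms
proof (induction j)
  case 0
  then show ?case by (simp add: case_prod_beta')
next
  case (Suc j)
  have comp: "(\<lambda>\<omega>. \<omega> (Suc j)) \<in> Pi\<^sub>M {1..K} (\<lambda>_. R) \<rightarrow>\<^sub>M R"
    using Suc.prems by (intro measurable_component_singleton) auto
  have "(\<lambda>z. (\<lambda>(y, s). draw (Suc j) y s) (snd z, fst z (Suc j))) \<in> (Pi\<^sub>M {1..K} (\<lambda>_. R)) \<Otimes>\<^sub>M borel \<rightarrow>\<^sub>M borel"
    by (rule measurable_compose[OF _ Suc.prems(1)])
       (use comp in \<open>auto intro!: measurable_Pair measurable_snd measurable_compose[OF measurable_fst comp]\<close>)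
  then have "(\<lambda>z. (\<lambda>(\<omega>, y). backward_run draw \<omega> j y) (fst z, draw (Suc j) (snd z) (fst z (Suc j))))
      \<in> (Pi\<^sub>M {1..K} (\<lambda>_. R)) \<Otimes>\<^sub>M borel \<rightarrow>\<^sub>M borel"
    using Suc by (intro measurable_compose[OF measurable_Pair[OF measurable_fst] Suc.IH]) auto
  then show ?case by (simp add: case_prod_beta')
qed

text \<open>
  The seed of the first executed stage \<open>j + 1\<close> is split off by Fubini's theorem; the later stages use only the seeds
  \<open>1, \<dots>, j\<close>, and are independent of it.
\<close>

lemma distr_backward_run:
  fixes draw :: "nat \<Rightarrow> 'b::topological_space \<Rightarrow> 's \<Rightarrow> 'b"
  assumes R: "prob_space R"
    and draw: "\<And>k. k \<in> {1..j} \<Longrightarrow> (\<lambda>(y, s). draw k y s) \<in> borel \<Otimes>\<^sub>M R \<rightarrow>\<^sub>M borel"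
  shows "distr (Pi\<^sub>M {1..j} (\<lambda>_. R)) borel (\<lambda>\<omega>. backward_run draw \<omega> j y)
    = backward_law (\<lambda>k y. distr R borel (draw k y)) j y"
  using draw
proof (induction j arbitrary: y)
  case 0
  interpret P: prob_space "Pi\<^sub>M ({} :: nat set) (\<lambda>_. R)" by (intro prob_space_PiM R)
  show ?case using P.distr_const[of y borel] by simp
next
  case (Suc j)
  let ?d = "\<lambda>k y. distr R borel (draw k y)" and ?P = "\<lambda>i. Pi\<^sub>M {1..i :: nat} (\<lambda>_. R)"
  interpret R: prob_space R by fact
  interpret product_sigma_finite "\<lambda>_::nat. R" by unfold_locales
  have kernel: "(\<lambda>y. distr R borel (draw k y)) \<in> borel \<rightarrow>\<^sub>M prob_algebra borel" if "k \<in> {1..Suc j}" for k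
    by (rule measurable_distr_prob_space2[OF measurable_const Suc.prems[OF that]])
       (simp add: space_prob_algebra R.prob_space_axioms)
  have run_meas: "(\<lambda>\<omega>. backward_run draw \<omega> i y) \<in> ?P i \<rightarrow>\<^sub>M borel" if "i \<le> Suc j" for i y
  proof -
    have "(\<lambda>\<omega>. (\<lambda>(\<omega>, y). backward_run draw \<omega> i y) (\<omega>, y)) \<in> ?P i \<rightarrow>\<^sub>M borel"
      using that Suc.prems by (intro measurable_compose[OF _ backward_run_measurable[of i draw R i]]) auto
    then show ?thesis by simp
  qed
  have draw1: "draw (Suc j) y \<in> R \<rightarrow>\<^sub>M borel"
    using measurable_compose[OF measurable_Pair1' Suc.prems[of "Suc j"], of y] by simp
  note law = backward_law_kernel[of j ?d, OF kernel]
  have IH: "distr (?P j) borel (\<lambda>\<omega>. backward_run draw \<omega> j y)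
    = backward_law ?d j y" for y
    by (rule Suc.IH) (use Suc.prems in auto)
  show ?case
  proof (rule measure_eqI)
    have "backward_law ?d (Suc j) y \<in> space (prob_algebra borel)"
      by (rule measurable_space[OF backward_law_kernel[OF kernel]]) auto
    then show "sets (distr (?P (Suc j)) borel (\<lambda>\<omega>. backward_run draw \<omega> (Suc j) y))
      = sets (backward_law ?d (Suc j) y)"
      unfolding space_prob_algebra by simp
    fix A assume "A \<in> sets (distr (?P (Suc j)) borel (\<lambda>\<omega>. backward_run draw \<omega> (Suc j) y))"
    then have A: "A \<in> sets borel" by simp
    have ins: "{1..Suc j} = insert (Suc j) {1..j}" by auto
    have upd: "backward_run draw (fun_upd \<omega> (Suc j) s) (Suc j) y = backward_run draw \<omega> j (draw (Suc j) y s)" for \<omega> s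
      by (auto intro!: backward_run_cong)
    have f: "(\<lambda>\<omega>. indicator A (backward_run draw \<omega> (Suc j) y)) \<in> borel_measurable (?P (Suc j))"
      using A by (intro measurable_compose[OF run_meas[OF order_refl] borel_measurable_indicator])
    have "emeasure (distr (?P (Suc j)) borel (\<lambda>\<omega>. backward_run draw \<omega> (Suc j) y)) A
      = (\<integral>\<^sup>+x. indicator A x \<partial>distr (?P (Suc j)) borel (\<lambda>\<omega>. backward_run draw \<omega> (Suc j) y))"
      using A by simp
    also have "\<dots> = (\<integral>\<^sup>+\<omega>. indicator A (backward_run draw \<omega> (Suc j) y) \<partial>?P (Suc j))"
      using A by (intro nn_integral_distr run_meas) auto
    also have "\<dots> = (\<integral>\<^sup>+s. (\<integral>\<^sup>+\<omega>. indicator A (backward_run draw (fun_upd \<omega> (Suc j) s) (Suc j) y) \<partial>?P j) \<partial>R)"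
      using f unfolding ins by (intro product_nn_integral_insert_rev) auto
    also have "\<dots> = (\<integral>\<^sup>+s. (\<integral>\<^sup>+\<omega>. indicator A (backward_run draw \<omega> j (draw (Suc j) y s)) \<partial>?P j) \<partial>R)"
      unfolding upd ..
    also have "\<dots> = (\<integral>\<^sup>+s. emeasure (backward_law ?d j (draw (Suc j) y s)) A \<partial>R)"
    proof (rule nn_integral_cong)
      fix s
      have "(\<integral>\<^sup>+\<omega>. indicator A (backward_run draw \<omega> j (draw (Suc j) y s)) \<partial>?P j)
        = (\<integral>\<^sup>+x. indicator A x \<partial>distr (?P j) borel (\<lambda>\<omega>. backward_run draw \<omega> j (draw (Suc j) y s)))"
        using A by (intro nn_integral_distr[symmetric] run_meas) auto
      then show "(\<integral>\<^sup>+\<omega>. indicator A (backward_run draw \<omega> j (draw (Suc j) y s)) \<partial>?P j)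
        = emeasure (backward_law ?d j (draw (Suc j) y s)) A"
        using A by (simp add: IH [symmetric])
    qed
    also have "\<dots> = (\<integral>\<^sup>+x. emeasure (backward_law ?d j x) A \<partial>distr R borel (draw (Suc j) y))"
      using law A by (intro nn_integral_distr[symmetric] draw1)
        (auto intro!: measurable_compose[OF measurable_prob_algebraD measurable_emeasure_subprob_algebra])
    also have "\<dots> = emeasure (backward_law ?d (Suc j) y) A"
      unfolding backward_law.simps
      using law measurable_space[OF kernel[of "Suc j"], of y] A by (intro emeasure_bind_prob_algebra[symmetric]) auto
    finally show "emeasure (distr (?P (Suc j)) borel (\<lambda>\<omega>. backward_run draw \<omega> (Suc j) y)) A
      = emeasure (backward_law ?d (Suc j) y) A" .
  qed
qed

lemma run_bind_prog: "run \<O> (bind_prog P h) = run \<O> (h (run \<O> P))"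
  by (induction P) simp_all

lemma query_count_bind_prog:
  "query_count \<O> (bind_prog P h) = query_count \<O> P + query_count \<O> (h (run \<O> P))"
  by (induction P) simp_all

lemma run_relay: "run \<O> (relay t conv P) = run (\<lambda>x. conv x (\<O> (t x))) P"
  by (induction P) simp_all

lemma query_count_relay: "query_count \<O> (relay t conv P) = query_count (\<lambda>x. conv x (\<O> (t x))) P"
  by (induction P) simp_all

section \<open>Strong log-concavity and the sampling procedure\<close>

lemma score_eqI:
  assumes "GDERIV (\<lambda>z. ln (p z)) x :> g"
  shows "score p x = g"
  unfolding score_def
proof (rule the_equality)
  show "GDERIV (\<lambda>z. ln (p z)) x :> g" by (rule assms)
  fix g' assume "GDERIV (\<lambda>z. ln (p z)) x :> g'"
  with assms have "(\<lambda>v. v \<bullet> g') = (\<lambda>v. v \<bullet> g)"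
    unfolding gderiv_def by (rule has_derivative_unique[rotated])
  then have "\<forall>v. v \<bullet> g' = v \<bullet> g" by (simp only: fun_eq_iff simp_thms)
  then show "g' = g" by (simp only: vector_eq_ldot)
qed

lemma op_norm_nonneg: "0 \<le> op_norm A"
  unfolding op_norm_def by (rule onorm_pos_le) (rule matrix_vector_mul_bounded_linear)

lemma inner_matrix_le_op_norm: "v \<bullet> (A *v v) \<le> op_norm A * (norm v)\<^sup>2"
proof -
  have "norm (A *v v) \<le> op_norm A * norm v"
    unfolding op_norm_def by (rule onorm) (rule matrix_vector_mul_bounded_linear)
  then have "norm v * norm (A *v v) \<le> norm v * (op_norm A * norm v)"
    by (intro mult_left_mono) simp_all
  then show ?thesis
    using norm_cauchy_schwarz[of v "A *v v"] by (simp add: power2_eq_square mult_ac)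
qed

context gaussian_channel
begin

lemma out_score_measurable [measurable]: "out_score \<in> borel_measurable borel"
  by (intro borel_measurable_continuous_onI has_derivative_continuous_on[of UNIV out_score "\<lambda>y v. out_hessian y *v v"])
     (use has_derivative_out_score in auto)

lemma score_out_density: "score out_density = out_score"
  by (rule ext) (rule score_eqI[OF GDERIV_ln_out_density])

lemma density_oracle_measurable [measurable]:
  "density_oracle out_density c \<in> borel_measurable borel"
  unfolding density_oracle_def [abs_def] score_out_density by measurable

lemma backward_answer_measurable:
  "(\<lambda>(y', x). backward_answer a y' x (density_oracle out_density c x)) \<in> borel_measurable (borel \<Otimes>\<^sub>M borel)"
  unfolding backward_answer_def density_oracle_def score_out_density by simp measurable

definition out_law :: "(real ^ 'n) measure" where
  "out_law = density lborel (\<lambda>y. ennreal (out_density y))"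

definition backward_kernel :: "real \<Rightarrow> real \<Rightarrow> real ^ 'n \<Rightarrow> (real ^ 'n) measure" where
  "backward_kernel a s y' = density lborel (\<lambda>y. ennreal (backward_density a s y' y))"

lemma sets_out_law [simp, measurable_cong]: "sets out_law = sets borel"
  by (simp add: out_law_def)

lemma prob_space_out_law: "prob_space out_law"
  by standard (simp add: out_law_def emeasure_density nn_integral_out_density_1)

context
  fixes a s :: real
  assumes a: "a \<noteq> 0" and s: "0 < s"
begin

interpretation nxt: gaussian_channel \<mu> "a * \<alpha>" "sqrt (a\<^sup>2 * \<sigma>\<^sup>2 + s\<^sup>2)"
  by (rule next_channel[OF a s])

lemma emeasure_backward_kernel:
  "A \<in> sets borel \<Longrightarrow>
    emeasure (backward_kernel a s y') A = (\<integral>\<^sup>+y. ennreal (backward_density a s y' y) * indicator A y \<partial>lborel)"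
  unfolding backward_kernel_def by (rule emeasure_density) (simp_all add: backward_density_def [abs_def])

lemma backward_kernel_kernel: "backward_kernel a s \<in> borel \<rightarrow>\<^sub>M prob_algebra borel"
proof (intro measurable_prob_algebraI measurable_subprob_algebra)
  show prob: "prob_space (backward_kernel a s y')" for y'
  proof
    show "emeasure (backward_kernel a s y') (space (backward_kernel a s y')) = 1"
      using emeasure_backward_kernel[of UNIV y'] nn_integral_backward_density[OF a s, of y']
      by (simp add: backward_kernel_def)
  qed
  then show "subprob_space (backward_kernel a s y')" for y' by (rule prob_space_imp_subprob_space)
  show "sets (backward_kernel a s y') = sets borel" for y' by (simp add: backward_kernel_def)
  fix A :: "(real ^ 'n) set" assume A: "A \<in> sets borel"
  then show "(\<lambda>y'. emeasure (backward_kernel a s y') A) \<in> borel_measurable borel"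
    unfolding emeasure_backward_kernel[OF A] backward_density_def by measurable
qed

text \<open>
  The joint density of two consecutive outputs, integrated first over the later one.
\<close>

lemma bind_backward_kernel: "nxt.out_law \<bind> backward_kernel a s = out_law"
proof (rule measure_eqI)
  have nxt: "nxt.out_law \<in> space (prob_algebra borel)"
    by (simp add: space_prob_algebra nxt.prob_space_out_law)
  show "sets (nxt.out_law \<bind> backward_kernel a s) = sets out_law"
    using sets_bind'[OF nxt backward_kernel_kernel] by simp
  fix A assume "A \<in> sets (nxt.out_law \<bind> backward_kernel a s)"
  then have A [measurable]: "A \<in> sets borel" using sets_bind'[OF nxt backward_kernel_kernel] by simp
  have meas: "(\<lambda>y'. emeasure (backward_kernel a s y') A) \<in> borel_measurable borel"
    by (rule measurable_compose[OF measurable_prob_algebraD[OF backward_kernel_kernel] measurable_emeasure_subprob_algebra[OF A]])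
  have "emeasure (nxt.out_law \<bind> backward_kernel a s) A = (\<integral>\<^sup>+y'. emeasure (backward_kernel a s y') A \<partial>nxt.out_law)"
    by (rule emeasure_bind_prob_algebra[OF nxt backward_kernel_kernel A])
  also have "\<dots> = (\<integral>\<^sup>+y'. ennreal (nxt.out_density y') * emeasure (backward_kernel a s y') A \<partial>lborel)"
    unfolding nxt.out_law_def using meas by (intro nn_integral_density) auto
  also have "\<dots> = (\<integral>\<^sup>+y'. (\<integral>\<^sup>+y. ennreal (out_density y * gaussian_density s (y' - a *\<^sub>R y)) * indicator A y \<partial>lborel) \<partial>lborel)"
  proof (rule nn_integral_cong)
    fix y'
    have eq: "ennreal (nxt.out_density y') * ennreal (backward_density a s y' y)
        = ennreal (out_density y * gaussian_density s (y' - a *\<^sub>R y))" for y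
      using nxt.out_density_pos[of y'] less_imp_le[OF backward_density_pos[OF a s, of y' y]]
      by (subst ennreal_mult [symmetric]) (simp_all add: backward_density_def)
    have "ennreal (nxt.out_density y') * emeasure (backward_kernel a s y') A
       = (\<integral>\<^sup>+y. ennreal (nxt.out_density y') * (ennreal (backward_density a s y' y) * indicator A y) \<partial>lborel)"
      unfolding emeasure_backward_kernel[OF A] backward_density_def
      by (rule nn_integral_cmult [symmetric]) measurable
    then show "ennreal (nxt.out_density y') * emeasure (backward_kernel a s y') A
      = (\<integral>\<^sup>+y. ennreal (out_density y * gaussian_density s (y' - a *\<^sub>R y)) * indicator A y \<partial>lborel)"
      by (simp add: mult.assoc [symmetric] eq)
  qed
  also have "\<dots> = (\<integral>\<^sup>+y. (\<integral>\<^sup>+y'. ennreal (out_density y * gaussian_density s (y' - a *\<^sub>R y)) * indicator A y \<partial>lborel) \<partial>lborel)"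
    by (rule lborel_pair.Fubini') measurable
  also have "\<dots> = (\<integral>\<^sup>+y. ennreal (out_density y) * indicator A y \<partial>lborel)"
  proof (rule nn_integral_cong)
    fix y
    have "(\<integral>\<^sup>+y'. ennreal (out_density y * gaussian_density s (y' - a *\<^sub>R y)) * indicator A y \<partial>lborel)
      = (\<integral>\<^sup>+y'. (ennreal (out_density y) * indicator A y) * ennreal (gaussian_density s (y' - a *\<^sub>R y)) \<partial>lborel)"
      by (intro nn_integral_cong)
         (simp add: ennreal_mult less_imp_le[OF out_density_pos] gaussian_density_nonneg mult_ac)
    also have "\<dots> = ennreal (out_density y) * indicator A y"
      using s by (subst nn_integral_cmult) (simp_all add: nn_integral_gaussian_density)
    finally show "(\<integral>\<^sup>+y'. ennreal (out_density y * gaussian_density s (y' - a *\<^sub>R y)) * indicator A y \<partial>lborel)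
      = ennreal (out_density y) * indicator A y" .
  qed
  also have "\<dots> = emeasure out_law A"
    unfolding out_law_def by (rule emeasure_density [symmetric]) simp_all
  finally show "emeasure (nxt.out_law \<bind> backward_kernel a s) A = emeasure out_law A" .
qed

text \<open>
  The unknown additive constant of the marginal oracle absorbs the normalising constant, which depends on \<open>y'\<close>.
\<close>

lemma backward_answer_oracle:
  assumes "s\<^sup>2 = 1 - a\<^sup>2"
  shows "\<exists>c'. (\<lambda>x. backward_answer a y' x (density_oracle out_density c x)) = density_oracle (backward_density a s y') c'"
proof (intro exI ext)
  fix x
  have "score (backward_density a s y') x = out_score x - (a / (1 - a\<^sup>2)) *\<^sub>R (a *\<^sub>R x - y')"
    using score_eqI[OF GDERIV_ln_backward_density[OF a s]] by (simp add: assms)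
  then show "backward_answer a y' x (density_oracle out_density c x) =
    density_oracle (backward_density a s y')
      (c - (real CARD('n) * ln (1 / sqrt (2 * pi * s\<^sup>2)) - ln (nxt.out_density y'))) x"
    by (simp add: backward_answer_def density_oracle_def score_out_density ln_backward_density[OF a s] assms)
qed

end
end

context gaussian_chain
begin

lemma distr_Y: "k \<ge> 1 \<Longrightarrow> distr M borel (Y k) = gaussian_channel.out_law (distr M borel X) (\<alpha> k) (\<sigma> k)"
  using is_pdf_Y[of k] distributed_distr_eq_density[of M lborel "Y k"]
  by (auto simp: gaussian_channel.out_law_def[OF channel] is_pdf_def cong: distr_cong)

abbreviation bkernel :: "nat \<Rightarrow> real ^ 'n \<Rightarrow> (real ^ 'n) measure" where
  "bkernel k \<equiv> gaussian_channel.backward_kernel (distr M borel X) (\<alpha> k) (\<sigma> k) (a k) (noise k)"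

lemma distr_Y_bind_bkernel: "k \<ge> 1 \<Longrightarrow> distr M borel (Y (Suc k)) \<bind> bkernel k = distr M borel (Y k)"
  using gaussian_channel.bind_backward_kernel[OF channel a_nz noise_pos, of k k k]
  by (simp add: distr_Y \<alpha>_Suc \<sigma>_Suc)

lemma \<alpha>_sq_antimono: "k \<ge> 1 \<Longrightarrow> (\<alpha> k)\<^sup>2 \<le> (a 0)\<^sup>2"
proof (induction k rule: dec_induct)
  case base
  then show ?case by (simp add: \<alpha>_def)
next
  case (step k)
  have "(\<alpha> (Suc k))\<^sup>2 = (\<alpha> k)\<^sup>2 * (a k)\<^sup>2" by (simp add: \<alpha>_def power_mult_distrib)
  also have "\<dots> \<le> (\<alpha> k)\<^sup>2 * 1" using a_lt[of k] by (intro mult_left_mono) auto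
  finally show ?case using step by simp
qed

context
  fixes B :: real and k :: nat
  assumes k: "k \<ge> 1" and a0: "(a 0)\<^sup>2 = 1 / 2" and B: "0 \<le> B"
    and cov: "\<And>y v. v \<bullet> (cov_matrix (post k y) *v v) \<le> B * (norm v)\<^sup>2"
begin

text \<open>
  The first step has \<open>a\<^sub>0\<^sup>2 = 1/2\<close> precisely to keep the noise level \<open>\<sigma>\<^sub>k\<^sup>2\<close> in \<open>[1/2, 1]\<close>.
\<close>

lemma inv_var_bounds: "1 \<le> 1 / (\<sigma> k)\<^sup>2" "1 / (\<sigma> k)\<^sup>2 \<le> 2"
  using \<alpha>_sq_antimono[OF k] \<sigma>_sq[OF k] by (simp_all add: a0 divide_le_eq le_divide_eq)

lemma cov_term_eq: "(\<alpha> k / (\<sigma> k)\<^sup>2)\<^sup>2 * B = ((\<alpha> k)\<^sup>2 * B) * (1 / (\<sigma> k)\<^sup>2)\<^sup>2"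
  by (simp add: power_divide)

text \<open>
  With \<open>t = 1 / \<sigma>\<^sub>k\<^sup>2 \<le> 2\<close>, the covariance term is at most \<open>t\<^sup>2 / 8 \<le> t / 4\<close>.
\<close>

lemma slc_dens:
  assumes small: "8 * B * (\<alpha> k)\<^sup>2 \<le> 1"
  shows "slc 4 (dens k)"
proof -
  let ?t = "1 / (\<sigma> k)\<^sup>2"
  let ?m = "?t - (\<alpha> k / (\<sigma> k)\<^sup>2)\<^sup>2 * B"
  have "((\<alpha> k)\<^sup>2 * B) * ?t\<^sup>2 \<le> (1 / 8) * ?t\<^sup>2"
    using small by (intro mult_right_mono) (simp_all add: mult_ac)
  also have "\<dots> \<le> (1 / 8) * (2 * ?t)"
  proof -
    have "?t * ?t \<le> 2 * ?t" using inv_var_bounds by (intro mult_right_mono) linarith+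
    then show ?thesis by (simp only: power2_eq_square)
  qed
  finally have m: "?m \<ge> (3 / 4) * ?t" unfolding cov_term_eq by linarith
  then have "0 < ?m" using inv_var_bounds by linarith
  moreover have "?m \<le> ?t" using B by simp
  moreover have "?t / ?m \<le> 4"
  proof -
    have "t \<le> 4 * m" if "3 / 4 * t \<le> m" "1 \<le> t" for t m :: real using that by linarith
    from this[OF m] show ?thesis
      unfolding pos_divide_le_eq[OF \<open>0 < ?m\<close>] using inv_var_bounds by blast
  qed
  ultimately show ?thesis
    unfolding slc_def using gaussian_channel.slc_bounds_out_density[OF channel[OF k] cov]
    by (intro exI[of _ ?m] exI[of _ ?t] conjI) simp_all
qed

text \<open>
  With \<open>t = 1 / \<sigma>\<^sub>k\<^sup>2 \<le> 2\<close>, the covariance term is at most \<open>\<lambda> t\<^sup>2 / 4 \<le> \<lambda>\<close>, so that the curvature lies between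
  \<open>t + \<lambda> + 2\<close> and \<open>t + 2 \<lambda> + 2\<close>.
\<close>

lemma slc_bwd:
  assumes ak: "(a k)\<^sup>2 = (2 * lam + 2) / (2 * lam + 3)" and lam: "lam = 4 * B * (\<alpha> k)\<^sup>2"
  shows "slc_cond 4 (bwd k)"
proof -
  let ?t = "1 / (\<sigma> k)\<^sup>2"
  let ?e = "(a k)\<^sup>2 / (noise k)\<^sup>2"
  let ?m = "?t - (\<alpha> k / (\<sigma> k)\<^sup>2)\<^sup>2 * B + ?e"
  have lam0: "0 \<le> lam" using B lam by simp
  have "1 - (a k)\<^sup>2 = 1 / (2 * lam + 3)" using lam0 unfolding ak by (simp add: field_simps)
  then have e: "?e = 2 * lam + 2" using lam0 unfolding noise_sq ak by simp
  have "?t\<^sup>2 \<le> 2\<^sup>2" using inv_var_bounds by (intro power_mono) auto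
  then have "((\<alpha> k)\<^sup>2 * B) * ?t\<^sup>2 \<le> ((\<alpha> k)\<^sup>2 * B) * 4"
    using B by (intro mult_left_mono) auto
  then have m: "?m \<ge> ?t + lam + 2" unfolding cov_term_eq e using lam by (simp add: mult_ac)
  then have "0 < ?m" using inv_var_bounds lam0 by linarith
  moreover have "?m \<le> ?t + ?e" using B by simp
  moreover have "(?t + ?e) / ?m \<le> 4"
    unfolding pos_divide_le_eq[OF \<open>0 < ?m\<close>]
  proof (rule order_trans)
    have "t + (2 * lam + 2) \<le> 4 * (t + lam + 2)" if "1 \<le> t" for t :: real
      using that lam0 by (simp add: algebra_simps)
    then show "?t + ?e \<le> 4 * (?t + lam + 2)" using inv_var_bounds unfolding e by blast
    show "4 * (?t + lam + 2) \<le> 4 * ?m" using m by (rule mult_left_mono) simp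
  qed
  ultimately show ?thesis
    unfolding slc_cond_def
    using gaussian_channel.slc_bounds_backward_density[OF channel[OF k] a_nz noise_pos cov]
    by (intro exI[of _ ?m] exI[of _ "?t + ?e"] conjI allI) simp_all
qed

end

context
  fixes D :: "(real ^ 'n) measure \<Rightarrow> (real ^ 'n) measure \<Rightarrow> ereal" and N :: "real \<Rightarrow> enat"
    and R :: "'s measure" and S :: "real \<Rightarrow> 's \<Rightarrow> 'n sampler_prog" and c :: "nat \<Rightarrow> real"
    and K :: nat and \<delta> :: real
  assumes K: "K \<ge> 1" and \<delta>: "0 < \<delta>"
    and slc_top: "slc 4 (dens K)" and slc_back: "\<And>k. k \<in> {1..<K} \<Longrightarrow> slc_cond 4 (bwd k)"
    and sampler: "slc_sampler D N R S"
begin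

abbreviation (input) "orc \<equiv> marginal_oracle (\<lambda>k. pdf M (Y k)) c"

text \<open>
  Stage \<open>K\<close> samples from \<open>p\<^sub>K\<close>, which is treated as a kernel that ignores the current point.  The whole procedure then
  runs through kernels only, from an arbitrary starting point.
\<close>

definition stage_oracle :: "nat \<Rightarrow> real ^ 'n \<Rightarrow> real ^ 'n \<Rightarrow> 'n answer" where
  "stage_oracle k y x = (if k = K then density_oracle (dens K) (c K) x
     else backward_answer (a k) y x (density_oracle (dens k) (c k) x))"

definition draw :: "nat \<Rightarrow> real ^ 'n \<Rightarrow> 's \<Rightarrow> real ^ 'n" where
  "draw k y s = run (stage_oracle k y) (S \<delta> s)"

definition target :: "nat \<Rightarrow> real ^ 'n \<Rightarrow> (real ^ 'n) measure" where
  "target k = (if k = K then (\<lambda>y. distr M borel (Y K)) else bkernel k)"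

lemma R: "prob_space R" and procedure: "measurable_procedure R (S \<delta>)"
  and sampler_error: "slc 4 p \<Longrightarrow>
    D (distr R borel (\<lambda>s. run (density_oracle p c') (S \<delta> s))) (density lborel (\<lambda>x. ennreal (p x))) \<le> ereal \<delta>"
  and sampler_queries: "slc 4 p \<Longrightarrow> s \<in> space R \<Longrightarrow>
    enat (query_count (density_oracle p c') (S \<delta> s)) \<le> N \<delta>"
  using sampler \<delta> unfolding slc_sampler_def by auto

lemma stage_density:
  assumes k: "k \<in> {1..K}"
  shows "\<exists>p c'. slc 4 p \<and> stage_oracle k y = density_oracle p c' \<and> target k y = density lborel (\<lambda>x. ennreal (p x))"
proof (cases "k = K")
  case True
  then show ?thesis
    using slc_top K
    by (intro exI[of _ "dens K"] exI[of _ "c K"])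
       (auto simp: stage_oracle_def target_def distr_Y gaussian_channel.out_law_def[OF channel])
next
  case False
  then have k1: "k \<in> {1..<K}" "k \<ge> 1" using k by auto
  obtain c' where "(\<lambda>x. backward_answer (a k) y x (density_oracle (dens k) (c k) x)) = density_oracle (bwd k y) c'"
    using gaussian_channel.backward_answer_oracle[OF channel[OF k1(2)] a_nz noise_pos noise_sq] by blast
  then have "stage_oracle k y = density_oracle (bwd k y) c'"
    using False by (simp add: stage_oracle_def [abs_def])
  moreover have "slc 4 (bwd k y)" using slc_back[OF k1(1)] unfolding slc_cond_def slc_def by blast
  ultimately show ?thesis
    using False by (auto simp: target_def gaussian_channel.backward_kernel_def[OF channel[OF k1(2)]])
qed

lemma draw_measurable:
  assumes k: "k \<in> {1..K}"
  shows "(\<lambda>(y, s). draw k y s) \<in> borel \<Otimes>\<^sub>M R \<rightarrow>\<^sub>M borel"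
proof -
  have k1: "k \<ge> 1" using k by simp
  have "(\<lambda>(y, x). stage_oracle k y x) \<in> borel_measurable (borel \<Otimes>\<^sub>M borel)"
  proof (cases "k = K")
    case True
    have "(\<lambda>z. density_oracle (dens K) (c K) (snd z)) \<in> borel_measurable (borel \<Otimes>\<^sub>M borel)"
      by (rule measurable_compose[OF measurable_snd gaussian_channel.density_oracle_measurable[OF channel[OF K]]])
    then show ?thesis using True by (simp add: stage_oracle_def case_prod_beta')
  next
    case False
    then show ?thesis
      using gaussian_channel.backward_answer_measurable[OF channel[OF k1]] by (simp add: stage_oracle_def)
  qed
  then show ?thesis using procedure unfolding measurable_procedure_def draw_def by blast
qed

lemma target_kernel:
  assumes k: "k \<in> {1..K}"
  shows "target k \<in> borel \<rightarrow>\<^sub>M prob_algebra borel"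
proof (cases "k = K")
  case True
  have "distr M borel (Y K) \<in> space (prob_algebra borel)"
    using K by (simp add: space_prob_algebra prob_space_distr Y_measurable)
  then show ?thesis using True by (simp add: target_def)
next
  case False
  then show ?thesis
    using gaussian_channel.backward_kernel_kernel[OF channel a_nz noise_pos] k by (simp add: target_def)
qed

lemma draw_kernel:
  assumes k: "k \<in> {1..K}"
  shows "(\<lambda>y. distr R borel (draw k y)) \<in> borel \<rightarrow>\<^sub>M prob_algebra borel"
  by (rule measurable_distr_prob_space2[OF measurable_const draw_measurable[OF k]])
     (simp add: space_prob_algebra R)

lemma backward_law_target: "backward_law target K y = distr M borel (Y 1)"
proof -
  obtain J where J: "Suc J = K" using K by (cases K) auto
  have "distr M borel (Y (Suc J)) \<bind> backward_law target J = distr M borel (Y 1)"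
  proof (rule bind_backward_law[where P = "\<lambda>k. distr M borel (Y k)"])
    show "distr M borel (Y (Suc k)) \<bind> target k = distr M borel (Y k)" if "k \<in> {1..J}" for k
    proof -
      have "k \<noteq> K" using that J by auto
      then show ?thesis using that by (simp add: target_def distr_Y_bind_bkernel)
    qed
  qed (use target_kernel J in auto)
  moreover have "backward_law target (Suc J) y = distr M borel (Y (Suc J)) \<bind> backward_law target J"
  proof -
    have "target (Suc J) y = distr M borel (Y (Suc J))" by (simp add: J) (simp add: target_def)
    then show ?thesis by (simp only: backward_law.simps)
  qed
  ultimately show ?thesis by (simp add: J)
qed

lemma run_backward_prog:
  "j < K \<Longrightarrow> run orc (backward_prog a (S \<delta>) \<omega> j y) = backward_run draw \<omega> j y"
proof (induction j arbitrary: y)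
  case (Suc j)
  then show ?case
    by (simp add: run_bind_prog run_relay draw_def stage_oracle_def [abs_def] marginal_oracle_def pdf_Y)
qed simp

lemma run_sequential_prog:
  "run orc (sequential_prog a (S \<delta>) K \<omega>) = backward_run draw \<omega> K y"
proof -
  obtain J where J: "K = Suc J" using K by (cases K) auto
  have "draw K y (\<omega> K) = run (density_oracle (dens K) (c K)) (S \<delta> (\<omega> K))"
    by (simp add: draw_def stage_oracle_def [abs_def])
  then show ?thesis
    using run_backward_prog[of J] K
    by (simp add: sequential_prog_def run_bind_prog run_relay J marginal_oracle_def pdf_Y)
qed

lemma sequential_measurable:
  "(\<lambda>\<omega>. run orc (sequential_prog a (S \<delta>) K \<omega>)) \<in> borel_measurable (Pi\<^sub>M {1..K} (\<lambda>_. R))"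
proof -
  have "(\<lambda>\<omega>. (\<lambda>(\<omega>, y). backward_run draw \<omega> K y) (\<omega>, 0)) \<in> Pi\<^sub>M {1..K} (\<lambda>_. R) \<rightarrow>\<^sub>M borel"
    by (rule measurable_compose[OF _ backward_run_measurable[OF draw_measurable order_refl]]) auto
  then show ?thesis by (simp add: run_sequential_prog[of _ 0])
qed

lemma sequential_error:
  assumes D: "D \<in> {tv_dist, kl_div}"
  shows "D (distr (Pi\<^sub>M {1..K} (\<lambda>_. R)) borel (\<lambda>\<omega>. run orc (sequential_prog a (S \<delta>) K \<omega>))) (distr M borel (Y 1))
    \<le> ereal (real K * \<delta>)"
proof -
  have "D (backward_law (\<lambda>k y. distr R borel (draw k y)) K 0) (backward_law target K 0) \<le> ereal (real K * \<delta>)"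
  proof (rule discrepancy_backward_law[OF D draw_kernel target_kernel])
    fix k y assume k: "k \<in> {1..K}"
    show "D (distr R borel (draw k y)) (target k y) \<le> ereal \<delta>"
      using stage_density[OF k, of y] sampler_error unfolding draw_def [abs_def] by fastforce
  qed
  moreover have "distr (Pi\<^sub>M {1..K} (\<lambda>_. R)) borel (\<lambda>\<omega>. run orc (sequential_prog a (S \<delta>) K \<omega>))
      = backward_law (\<lambda>k y. distr R borel (draw k y)) K 0"
    unfolding run_sequential_prog[of _ 0] by (rule distr_backward_run[OF R draw_measurable])
  ultimately show ?thesis by (simp add: backward_law_target)
qed

lemma stage_queries:
  "k \<in> {1..K} \<Longrightarrow> s \<in> space R \<Longrightarrow> enat (query_count (stage_oracle k y) (S \<delta> s)) \<le> N \<delta>"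
  using stage_density[of k y] sampler_queries by fastforce

lemma backward_queries:
  assumes "\<omega> \<in> space (Pi\<^sub>M {1..K} (\<lambda>_. R))" "j < K"
  shows "enat (query_count orc (backward_prog a (S \<delta>) \<omega> j y)) \<le> (\<Sum>k=1..j. N \<delta>)"
  using assms(2)
proof (induction j arbitrary: y)
  case (Suc j)
  have "\<omega> (Suc j) \<in> space R" using assms(1) Suc.prems by (auto simp: space_PiM PiE_iff)
  then have "enat (query_count (stage_oracle (Suc j) y) (S \<delta> (\<omega> (Suc j)))) \<le> N \<delta>"
    using Suc.prems by (intro stage_queries) auto
  moreover have "(\<lambda>x. backward_answer (a (Suc j)) y x (orc (Suc j, x))) = stage_oracle (Suc j) y"
    using Suc.prems by (simp add: stage_oracle_def [abs_def] marginal_oracle_def pdf_Y)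
  ultimately have "enat (query_count orc (backward_prog a (S \<delta>) \<omega> (Suc j) y)) \<le> N \<delta> + (\<Sum>k=1..j. N \<delta>)"
    using Suc by (simp add: query_count_bind_prog query_count_relay add_mono flip: plus_enat_simps(1))
  then show ?case by (simp add: distrib_right)
qed (simp flip: zero_enat_def)

lemma sequential_queries:
  assumes \<omega>: "\<omega> \<in> space (Pi\<^sub>M {1..K} (\<lambda>_. R))"
  shows "enat (query_count orc (sequential_prog a (S \<delta>) K \<omega>)) \<le> (\<Sum>k=0..K. N \<delta>)"
proof -
  obtain J where J: "K = Suc J" using K by (cases K) auto
  have "\<omega> K \<in> space R" using \<omega> K by (auto simp: space_PiM PiE_iff)
  then have "enat (query_count (stage_oracle K undefined) (S \<delta> (\<omega> K))) \<le> N \<delta>"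
    using K by (intro stage_queries) auto
  moreover have "(\<lambda>x. orc (K, x)) = stage_oracle K undefined"
    using K by (simp add: stage_oracle_def [abs_def] marginal_oracle_def pdf_Y)
  ultimately have "enat (query_count orc (sequential_prog a (S \<delta>) K \<omega>)) \<le> N \<delta> + (\<Sum>k=1..J. N \<delta>)"
    using backward_queries[OF \<omega>, of J]
    by (simp add: sequential_prog_def query_count_bind_prog query_count_relay add_mono J flip: plus_enat_simps(1))
  also have "\<dots> = (\<Sum>k=1..K. N \<delta>)" by (simp add: J distrib_right)
  also have "\<dots> \<le> (\<Sum>k=0..K. N \<delta>)" by (rule sum_mono2) auto
  finally show ?thesis .
qed

end
end

theorem corollary1:
  fixes M :: "'w measure"
    and X :: "'w \<Rightarrow> real ^ 'n"
    and W Y :: "nat \<Rightarrow> 'w \<Rightarrow> real ^ 'n"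
    and a B lam :: "nat \<Rightarrow> real"
    and Bmax :: real
  assumes "prob_space M"
    and "X \<in> borel_measurable M"
    and "\<And>k. distributed M lborel (W k) (\<lambda>z. ennreal (std_gaussian_density z))"
    and "prob_space.indep_vars M (\<lambda>_. borel) (case_nat X W) UNIV"
    and "Y 1 = (\<lambda>\<omega>. (1 / sqrt 2) *\<^sub>R X \<omega> + (1 / sqrt 2) *\<^sub>R W 0 \<omega>)"
    and "\<And>k. k \<ge> 1 \<Longrightarrow>
           Y (Suc k) = (\<lambda>\<omega>. a k *\<^sub>R Y k \<omega> + sqrt (1 - (a k)\<^sup>2) *\<^sub>R W k \<omega>)"
    and "a 0 = 1 / sqrt 2"
    and "\<And>k. k \<ge> 1 \<Longrightarrow> ereal (B k) = (SUP y. ereal (op_norm (cond_cov M X (Y k) y)))"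
    and "\<And>k. k \<ge> 1 \<Longrightarrow> lam k = 4 * B k * (\<Prod>l<k. (a l)\<^sup>2)"
    and "\<And>k. k \<ge> 1 \<Longrightarrow> (a k)\<^sup>2 = (2 * lam k + 2) / (2 * lam k + 3)"
    and "\<And>k. k \<ge> 1 \<Longrightarrow> B k \<le> Bmax"
  shows "\<exists>K\<ge>1.
    real K \<le> 7 * (1 + Bmax) \<and>
    (B K \<noteq> 0 \<longrightarrow> (\<Prod>l<K. (a l)\<^sup>2) \<le> 1 / (8 * B K)) \<and>
    slc 4 (pdf M (Y K)) \<and>
    (\<forall>k\<in>{1..<K}. slc_cond 4 (cond_pdf M (Y k) (Y (Suc k)))) \<and>
    (\<forall>D\<in>{tv_dist, kl_div}. \<forall>\<epsilon>>0. \<forall>N (R :: 's measure) S c.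
       slc_sampler D N R S \<longrightarrow>
       (let \<delta> = \<epsilon> / (real K + 1);
            \<O> = marginal_oracle (\<lambda>k. pdf M (Y k)) c;
            Q = sequential_prog a (S \<delta>) K;
            seeds = Pi\<^sub>M {1..K} (\<lambda>_. R)
        in (\<lambda>\<omega>. run \<O> (Q \<omega>)) \<in> borel_measurable seeds \<and>
           D (distr seeds borel (\<lambda>\<omega>. run \<O> (Q \<omega>))) (distr M borel (Y 1)) \<le> ereal \<epsilon> \<and>
           (\<forall>\<omega>\<in>space seeds. enat (query_count \<O> (Q \<omega>)) \<le> (\<Sum>k=0..K. N \<delta>))))"
proof -
  interpret prob_space M by fact
  have B0: "0 \<le> B k" if "k \<ge> 1" for k
  proof -
    have "ereal 0 \<le> ereal (op_norm (cond_cov M X (Y k) 0))" by (simp add: op_norm_nonneg)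
    also have "\<dots> \<le> ereal (B k)" unfolding assms(8)[OF that] by (rule SUP_upper) simp
    finally show ?thesis by simp
  qed
  have lam0: "0 \<le> lam k" if "k \<ge> 1" for k
    using B0[OF that] by (simp add: assms(9)[OF that] prod_nonneg)
  have a0: "(a 0)\<^sup>2 = 1 / 2" by (simp add: assms(7) power_divide)
  have a_sq: "0 < (a k)\<^sup>2 \<and> (a k)\<^sup>2 < 1" for k
    using lam0[of k] a0 by (cases "k \<ge> 1") (auto simp: assms(10) not_le)
  have noise0: "sqrt (1 - (a 0)\<^sup>2) = 1 / sqrt 2" by (simp add: a0 real_sqrt_divide)
  interpret gaussian_chain M X W Y a
  proof
    show "Y 1 = (\<lambda>\<omega>. a 0 *\<^sub>R X \<omega> + sqrt (1 - (a 0)\<^sup>2) *\<^sub>R W 0 \<omega>)"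
      unfolding noise0 using assms(5) by (simp only: assms(7))
    show "a k \<noteq> 0" "(a k)\<^sup>2 < 1" for k using a_sq[of k] by auto
  qed (use assms in auto)
  have cov: "v \<bullet> (cov_matrix (post k y) *v v) \<le> B k * (norm v)\<^sup>2" if k: "k \<ge> 1" for k y v
  proof -
    have "ereal (op_norm (cond_cov M X (Y k) y)) \<le> ereal (B k)"
      unfolding assms(8)[OF k] by (rule SUP_upper) simp
    then have "op_norm (cov_matrix (post k y)) \<le> B k"
      by (simp add: cond_cov_def cond_law_Y[OF k])
    then show ?thesis
      by (intro order_trans[OF inner_matrix_le_op_norm] mult_right_mono) simp_all
  qed
  obtain K where K: "K \<ge> 1" "real K \<le> 7 * (1 + Bmax)" "8 * B K * (\<Prod>l<K. (a l)\<^sup>2) \<le> 1"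
    using trajectory_length[OF a0 B0 assms(11) assms(9) assms(10)] by metis
  have prod: "B K \<noteq> 0 \<longrightarrow> (\<Prod>l<K. (a l)\<^sup>2) \<le> 1 / (8 * B K)"
    using K(3) B0[OF K(1)] by (auto simp: le_divide_eq mult_ac)
  have top: "slc 4 (dens K)"
    using slc_dens[OF K(1) a0 B0[OF K(1)] cov[OF K(1)]] K(3) by (simp add: \<alpha>_sq)
  have backward: "slc_cond 4 (bwd k)" if "k \<in> {1..<K}" for k
  proof -
    have k: "k \<ge> 1" using that by simp
    show ?thesis
      by (rule slc_bwd[OF k a0 B0[OF k] cov[OF k] assms(10)[OF k]])
         (simp add: assms(9)[OF k] \<alpha>_sq)
  qed
  show ?thesis
  proof (intro exI[of _ K] conjI ballI allI impI)
    show "slc 4 (pdf M (Y K))" using top by (simp add: pdf_Y[OF K(1)])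
    show "slc_cond 4 (cond_pdf M (Y k) (Y (Suc k)))" if "k \<in> {1..<K}" for k
      using backward[OF that] that by (simp add: cond_pdf_Y)
    fix D :: "(real ^ 'n) measure \<Rightarrow> (real ^ 'n) measure \<Rightarrow> ereal" and \<epsilon> :: real and N and R :: "'s measure" and S c
    assume D: "D \<in> {tv_dist, kl_div}" and \<epsilon>: "0 < \<epsilon>" and sampler: "slc_sampler D N R S"
    have \<delta>: "0 < \<epsilon> / (real K + 1)" using \<epsilon> by simp
    have "real K * (\<epsilon> / (real K + 1)) \<le> \<epsilon>" using \<epsilon> by (simp add: divide_le_eq)
    then have le: "ereal (real K * (\<epsilon> / (real K + 1))) \<le> ereal \<epsilon>" by simp
    show "let \<delta> = \<epsilon> / (real K + 1);
            \<O> = marginal_oracle (\<lambda>k. pdf M (Y k)) c;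
            Q = sequential_prog a (S \<delta>) K;
            seeds = Pi\<^sub>M {1..K} (\<lambda>_. R)
        in (\<lambda>\<omega>. run \<O> (Q \<omega>)) \<in> borel_measurable seeds \<and>
           D (distr seeds borel (\<lambda>\<omega>. run \<O> (Q \<omega>))) (distr M borel (Y 1)) \<le> ereal \<epsilon> \<and>
           (\<forall>\<omega>\<in>space seeds. enat (query_count \<O> (Q \<omega>)) \<le> (\<Sum>k=0..K. N \<delta>))"
      unfolding Let_def
      using sequential_measurable[OF K(1) \<delta> top backward sampler]
        order_trans[OF sequential_error[OF K(1) \<delta> top backward sampler D] le]
        sequential_queries[OF K(1) \<delta> top backward sampler]
      by blast
  qed (use K prod in auto)
qed

end
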